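(* Consider the model and standardized statistic $\widetilde W_N$ described in the context, under the null hypothesis $\mathcal H_0(\boldsymbol T):\boldsymbol T\boldsymbol\mu=\mathbf 0$, along a sequence of designs following one of the asymptotic frameworks (I)–(V). Let $\beta_s=\lambda_s/\sqrt{\sum_{\ell=1}^{ad}\lambda_\ell^2}$ for $s=1,\dots,ad$ (and $\beta_s:=0$ for $s>ad$). Let $(C_s)_{s\ge1}$ be i.i.d. $\chi^2_1$ random variables and $Z\sim\mathcal N(0,1)$ independent of them. (a) Let $(b_s)_{s\ge1}$ be a non-increasing sequence in $[0,1]$ such that $r:=\#\{s:b_s\neq0\}$ is finite and $\sum_{s=1}^r b_s^2\le 1$. Then $\widetilde W_N$ converges in distribution to $\sum_{s=1}^r b_s\,(C_s-1)/\sqrt2+\sqrt{1-\sum_{s=1}^r b_s^2}\cdot Z$ if and only if $\beta_s\to b_s$ for every $s\in\mathbb N$ as $N\to\infty$. (b) If there is a non-increasing sequence $(b_s)_{s\ge1}$ in $(0,1)$ with $\sum_{s=1}^\infty b_s^2=1$ such that $\beta_s\to b_s$ for every $s\in\mathbb N$ as $N\to\infty$, then $\widetilde W_N$ converges in distribution to $\sum_{s=1}^\infty b_s\,(C_s-1)/\sqrt2$.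
   Context: Model: there are $a$ independent groups; for $i=1,\dots,a$ and $j=1,\dots,n_i$ the observations $\boldsymbol X_{i,j}\in\mathbb R^d$ are independent with $\boldsymbol X_{i,j}\sim\mathcal N_d(\boldsymbol\mu_i,\boldsymbol\Sigma)$, where $\boldsymbol\Sigma$ is a common positive definite $d\times d$ matrix. $N=\sum_{i=1}^a n_i$, $n_{\max}=\max_i n_i$, $\boldsymbol\mu=(\boldsymbol\mu_1^\top,\dots,\boldsymbol\mu_a^\top)^\top$. The hypothesis matrix is $\boldsymbol T=\boldsymbol T_W\otimes\boldsymbol T_S$ with $\boldsymbol T_W$ an $a\times a$ and $\boldsymbol T_S$ a $d\times d$ symmetric idempotent (orthogonal projection) matrix, both nonzero. Group means $\overline{\boldsymbol X}_i=n_i^{-1}\sum_{j}\boldsymbol X_{i,j}$, $\overline{\boldsymbol X}=(\overline{\boldsymbol X}_1^\top,\dots,\overline{\boldsymbol X}_a^\top)^\top$, and $Q_N=N\,\overline{\boldsymbol X}^\top\boldsymbol T\overline{\boldsymbol X}$. Under $\mathcal H_0$, $E(Q_N)=\operatorname{tr}(\boldsymbol T_S\boldsymbol\Sigma)\sum_{i=1}^a\frac{N}{n_i}(\boldsymbol T_W)_{ii}$ and $\operatorname{Var}(Q_N)=2\operatorname{tr}((\boldsymbol T_S\boldsymbol\Sigma)^2)\sum_{i,r=1}^a\frac{N^2}{n_in_r}(\boldsymbol T_W)_{ir}^2$, and $\widetilde W_N=(Q_N-E_{\mathcal H_0}(Q_N))/\sqrt{\operatorname{Var}_{\mathcal H_0}(Q_N)}$.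 $\boldsymbol V_N=\bigoplus_{i=1}^a\frac{N}{n_i}\boldsymbol\Sigma$ (block diagonal) and $\lambda_1\ge\lambda_2\ge\dots\ge\lambda_{ad}$ are the eigenvalues of $\boldsymbol T\boldsymbol V_N\boldsymbol T$. Asymptotic frameworks: all of $a,d,n_1,\dots,n_a,\boldsymbol\Sigma,\boldsymbol\mu,\boldsymbol T_W,\boldsymbol T_S$ may depend on an index along which $N\to\infty$, and one of the following holds (quantities not listed stay bounded): (I) $a\to\infty$; (II) $a,d\to\infty$; (III) $a,n_{\max}\to\infty$; (IV) $d,n_{\max}\to\infty$; (V) $a,d,n_{\max}\to\infty$. No condition on ratios $n_i/N$ is assumed. *)

theory Defs
  imports "HOL-Probability.Probability" "Jordan_Normal_Form.Char_Poly"
begin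

definition mtrace :: "real mat \<Rightarrow> real" where
  "mtrace A = (\<Sum>i<dim_row A. A $$ (i, i))"

definition kron :: "real mat \<Rightarrow> real mat \<Rightarrow> real mat" where
  "kron A B = mat (dim_row A * dim_row B) (dim_col A * dim_col B)
     (\<lambda>(p, q). A $$ (p div dim_row B, q div dim_col B) * B $$ (p mod dim_row B, q mod dim_col B))"

definition orth_proj :: "nat \<Rightarrow> real mat \<Rightarrow> bool" where
  "orth_proj m P \<longleftrightarrow> P \<in> carrier_mat m m \<and> transpose_mat P = P \<and> P * P = P"

definition pos_def :: "nat \<Rightarrow> real mat \<Rightarrow> bool" where
  "pos_def m S \<longleftrightarrow> S \<in> carrier_mat m m \<and> transpose_mat S = S \<and>
     (\<forall>v \<in> carrier_vec m. v \<noteq> 0\<^sub>v m \<longrightarrow> v \<bullet> (S *\<^sub>v v) > 0)"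

definition eigs_desc :: "real mat \<Rightarrow> real list" where
  "eigs_desc A = (THE ls. sorted_wrt (\<ge>) ls \<and>
       char_poly A = prod_list (map (\<lambda>l. [:- l, 1:]) ls))"

text \<open>Gaussian random vector in R^d (coordinates 0..d-1) with mean m and covariance S
  (positive definite), defined by: every nontrivial linear combination is univariate normal
  with the corresponding mean and variance.\<close>
definition mvnormal :: "'a measure \<Rightarrow> ('a \<Rightarrow> nat \<Rightarrow> real) \<Rightarrow> nat \<Rightarrow> real vec \<Rightarrow> real mat \<Rightarrow> bool" where
  "mvnormal M Y d m S \<longleftrightarrow>
     (\<forall>s<d. (\<lambda>\<omega>. Y \<omega> s) \<in> borel_measurable M) \<and>
     (\<forall>v \<in> carrier_vec d. v \<noteq> 0\<^sub>v d \<longrightarrow>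
        distributed M lborel (\<lambda>\<omega>. \<Sum>s<d. v $ s * Y \<omega> s)
          (normal_density (v \<bullet> m) (sqrt (v \<bullet> (S *\<^sub>v v)))))"

definition stack :: "nat \<Rightarrow> nat \<Rightarrow> (nat \<Rightarrow> real vec) \<Rightarrow> real vec" where
  "stack a d m = vec (a * d) (\<lambda>p. m (p div d) $ (p mod d))"

definition group_means :: "nat \<Rightarrow> nat \<Rightarrow> (nat \<Rightarrow> nat) \<Rightarrow> (nat \<Rightarrow> nat \<Rightarrow> nat \<Rightarrow> real) \<Rightarrow> real vec" where
  "group_means a d n x = vec (a * d)
     (\<lambda>p. (1 / real (n (p div d))) * (\<Sum>j<n (p div d). x (p div d) j (p mod d)))"

definition totalN :: "nat \<Rightarrow> (nat \<Rightarrow> nat) \<Rightarrow> nat" where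
  "totalN a n = (\<Sum>i<a. n i)"

definition nmax :: "nat \<Rightarrow> (nat \<Rightarrow> nat) \<Rightarrow> nat" where
  "nmax a n = Max (n ` {..<a})"

definition QN :: "nat \<Rightarrow> nat \<Rightarrow> (nat \<Rightarrow> nat) \<Rightarrow> real mat \<Rightarrow> real mat \<Rightarrow> (nat \<Rightarrow> nat \<Rightarrow> nat \<Rightarrow> real) \<Rightarrow> real" where
  "QN a d n TW TS x = real (totalN a n) *
     (group_means a d n x \<bullet> (kron TW TS *\<^sub>v group_means a d n x))"

definition EQ0 :: "nat \<Rightarrow> (nat \<Rightarrow> nat) \<Rightarrow> real mat \<Rightarrow> real mat \<Rightarrow> real mat \<Rightarrow> real" where
  "EQ0 a n TW TS S = mtrace (TS * S) *
     (\<Sum>i<a. real (totalN a n) / real (n i) * TW $$ (i, i))"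

definition VarQ0 :: "nat \<Rightarrow> (nat \<Rightarrow> nat) \<Rightarrow> real mat \<Rightarrow> real mat \<Rightarrow> real mat \<Rightarrow> real" where
  "VarQ0 a n TW TS S = 2 * mtrace ((TS * S) * (TS * S)) *
     (\<Sum>i<a. \<Sum>r<a. (real (totalN a n))\<^sup>2 / (real (n i) * real (n r)) * (TW $$ (i, r))\<^sup>2)"

definition Wtilde :: "nat \<Rightarrow> nat \<Rightarrow> (nat \<Rightarrow> nat) \<Rightarrow> real mat \<Rightarrow> real mat \<Rightarrow> real mat \<Rightarrow> (nat \<Rightarrow> nat \<Rightarrow> nat \<Rightarrow> real) \<Rightarrow> real" where
  "Wtilde a d n TW TS S x = (QN a d n TW TS x - EQ0 a n TW TS S) / sqrt (VarQ0 a n TW TS S)"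

definition VN :: "nat \<Rightarrow> nat \<Rightarrow> (nat \<Rightarrow> nat) \<Rightarrow> real mat \<Rightarrow> real mat" where
  "VN a d n S = mat (a * d) (a * d) (\<lambda>(p, q).
     if p div d = q div d then real (totalN a n) / real (n (p div d)) * S $$ (p mod d, q mod d) else 0)"

text \<open>beta s (0-indexed: beta 0 is the paper's beta_1), 0 beyond a*d\<close>
definition beta :: "nat \<Rightarrow> nat \<Rightarrow> (nat \<Rightarrow> nat) \<Rightarrow> real mat \<Rightarrow> real mat \<Rightarrow> real mat \<Rightarrow> nat \<Rightarrow> real" where
  "beta a d n TW TS S s =
     (let T = kron TW TS; ls = eigs_desc (T * VN a d n S * T) in
      if s < length ls then ls ! s / sqrt (\<Sum>l\<leftarrow>ls. l\<^sup>2) else 0)"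

definition to_inf :: "(nat \<Rightarrow> nat) \<Rightarrow> bool" where
  "to_inf f \<longleftrightarrow> filterlim (\<lambda>k. real (f k)) at_top sequentially"

definition bdd_seq :: "(nat \<Rightarrow> nat) \<Rightarrow> bool" where
  "bdd_seq f \<longleftrightarrow> (\<exists>B. \<forall>k. f k \<le> B)"

definition frameworks :: "(nat \<Rightarrow> nat) \<Rightarrow> (nat \<Rightarrow> nat) \<Rightarrow> (nat \<Rightarrow> nat) \<Rightarrow> bool" where
  "frameworks a d nm \<longleftrightarrow>
     (to_inf a \<and> bdd_seq d \<and> bdd_seq nm) \<or>
     (to_inf a \<and> to_inf d \<and> bdd_seq nm) \<or>
     (to_inf a \<and> bdd_seq d \<and> to_inf nm) \<or>
     (bdd_seq a \<and> to_inf d \<and> to_inf nm) \<or>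
     (to_inf a \<and> to_inf d \<and> to_inf nm)"

definition chi2_1 :: "real measure" where
  "chi2_1 = distr (density lborel std_normal_density) borel (\<lambda>x. x\<^sup>2)"

end

theory Submission
  imports Defs
begin

text \<open>
  With T the hypothesis projection and V the covariance matrix of the scaled group means, the quadratic
  form is the sum of the squares of the coordinates of the projected scaled mean vector in an eigenbasis
  of T V T. These coordinates are centred under the null hypothesis and jointly Gaussian with diagonal
  covariance, so the form has the law of a sum of independent chi-squares weighted by the eigenvalues.
  After standardization the weights are the beta's, whose squares sum to 1.

  Convergence of the weights gives convergence of the products of characteristic functions: the leading
  factors converge individually, and the remaining small weights produce a Gaussian factor by a Lindeberg
  argument or, if the squares of the limits sum to 1, a factor close to 1. Conversely, E exp (- u W) is at
  most exp (u^2 / 2) for u >= 0, so weak convergence implies convergence of these one-sided Laplace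
  transforms. Their logarithms are u^2 / 2 minus half the sum of F (sqrt 2 u beta_s) with
  F y = y^2 / 2 - y + ln (1 + y), which determines all power sums of order at least 3 and, by peeling off
  the largest weight repeatedly, every single weight.
\<close>

section \<open>Recovering weights from power sums\<close>

text \<open>The statistics live on different probability spaces, so each is first replaced by a
  variable of the same law built from the single family \<open>C\<close>, \<open>Z\<close>;
  afterwards only weight sequences vary. The weights of the statistic always have square sum 1,
  while the limit b may have a smaller one: the missing mass is spread over ever more vanishing
  weights and turns Gaussian. Order 2 therefore says nothing about b, and power sums are compared
  from order 3 on, where such weights contribute nothing in the limit. The Laplace transform is
  one-sided because a chi-square has positive exponential moments only of order below 1/2, whereas E
  exp (- u W) is finite for all u >= 0. It is also real and positive, so its logarithm needs no
  choice of branch. Its bound at 2 u supplies the uniform integrability without which weak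
  convergence says nothing about an unbounded exponential. In part (b) the limit is a pointwise
  series, so its almost sure convergence has to be known before its characteristic function can be
  computed.\<close>

lemma tail_power_sum_bounds:
  fixes c :: "nat \<Rightarrow> real"
  assumes anti: "antimono c" and nonneg: "\<And>i. 0 \<le> c i" and zero: "\<And>i. i \<ge> m \<Longrightarrow> c i = 0"
    and sq: "(\<Sum>i<m. (c i)\<^sup>2) \<le> 1"
  shows "c s ^ (q + 2) \<le> (\<Sum>i<m. c i ^ (q + 2)) - (\<Sum>i<s. c i ^ (q + 2))"
    and "(\<Sum>i<m. c i ^ (q + 2)) - (\<Sum>i<s. c i ^ (q + 2)) \<le> c s ^ q"
proof -
  \<comment> \<open>Padding with zeros up to \<open>max m (Suc s)\<close> puts the index s inside
    the range even when s >= m.\<close>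
  have m0: "(\<Sum>i<m. c i ^ (q + 2)) = (\<Sum>i<max m (Suc s). c i ^ (q + 2))"
    by (rule sum.mono_neutral_left) (auto simp: zero)
  have eq: "(\<Sum>i<m. c i ^ (q + 2)) - (\<Sum>i<s. c i ^ (q + 2)) = (\<Sum>i\<in>{s..<max m (Suc s)}. c i ^ (q + 2))"
    unfolding m0 unfolding lessThan_atLeast0 by (subst sum_diff_nat_ivl) auto
  show "c s ^ (q + 2) \<le> (\<Sum>i<m. c i ^ (q + 2)) - (\<Sum>i<s. c i ^ (q + 2))"
    unfolding eq by (rule member_le_sum) (auto simp: nonneg)
  have "(\<Sum>i\<in>{s..<max m (Suc s)}. c i ^ (q + 2)) \<le> (\<Sum>i\<in>{s..<max m (Suc s)}. c s ^ q * (c i)\<^sup>2)"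
    by (intro sum_mono, subst power_add, intro mult_right_mono power_mono antimonoD[OF anti])
      (auto simp: nonneg)
  also have "\<dots> = c s ^ q * (\<Sum>i\<in>{s..<max m (Suc s)}. (c i)\<^sup>2)"
    by (simp add: sum_distrib_left)
  also have "(\<Sum>i\<in>{s..<max m (Suc s)}. (c i)\<^sup>2) \<le> (\<Sum>i<max m (Suc s). (c i)\<^sup>2)"
    by (rule sum_mono2) auto
  also have "(\<Sum>i<max m (Suc s). (c i)\<^sup>2) = (\<Sum>i<m. (c i)\<^sup>2)"
    by (rule sum.mono_neutral_right) (auto simp: zero)
  also note sq
  finally show "(\<Sum>i<m. c i ^ (q + 2)) - (\<Sum>i<s. c i ^ (q + 2)) \<le> c s ^ q"
    unfolding eq by (simp add: nonneg mult_left_mono)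
qed

text \<open>The factor C absorbs the mismatch between the exponents q and q + 2 in the sandwich
  argument that follows.\<close>

lemma ex_power_gt:
  fixes x y :: real
  assumes "0 < x" "x < y"
  shows "\<exists>q\<ge>1. C * x ^ q < y ^ q"
proof -
  have "filterlim (\<lambda>q. (y / x) ^ q) at_top sequentially"
    using assms by (intro filterlim_realpow_sequentially_gt1[THEN filterlim_at_infinity_imp_filterlim_at_top]) auto
  then have "\<forall>\<^sub>F q in sequentially. (y / x) ^ q > C"
    by (auto simp: filterlim_at_top_dense)
  then have "\<forall>\<^sub>F q in sequentially. (y / x) ^ q > C \<and> q \<ge> 1"
    using eventually_ge_at_top[of 1] by eventually_elim auto
  then obtain q where "q \<ge> 1" "(y / x) ^ q > C"
    by (auto simp: eventually_sequentially)
  then show ?thesis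
    using assms by (intro exI[of _ q]) (auto simp: power_divide field_simps)
qed

text \<open>On the scale of q-th roots the gap between the exponents q and q + 2 disappears for
  large q. Instead of taking roots, a midpoint w is put between y and the tested bound z, and q is
  chosen so large that the powers on both sides of w are separated. As q does not depend on k,
  convergence of \<open>Q k q\<close> for this one q is enough.\<close>

lemma tendsto_of_power_sandwich:
  fixes x :: "nat \<Rightarrow> real" and y :: real and Q :: "nat \<Rightarrow> nat \<Rightarrow> real"
  assumes x: "\<And>k. 0 \<le> x k" and y: "0 \<le> y"
    and lower: "\<And>k q. x k ^ (q + 2) \<le> Q k q" and upper: "\<And>k q. Q k q \<le> x k ^ q"
    and lower': "\<And>q. y ^ (q + 2) \<le> L q" and upper': "\<And>q. L q \<le> y ^ q"
    and conv: "\<And>q. q \<ge> 1 \<Longrightarrow> (\<lambda>k. Q k q) \<longlonglongrightarrow> L q"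
  shows "x \<longlonglongrightarrow> y"
proof (rule order_tendstoI)
  fix z assume "y < z"
  show "\<forall>\<^sub>F k in sequentially. x k < z"
  proof -
    define w where "w = (y + z) / 2"
    have w: "0 < w" "y \<le> w" "w < z" using \<open>y < z\<close> y by (auto simp: w_def)
    \<comment> \<open>The factor 1 / z^2 upgrades the conclusion to w^q < z^(q + 2), the exponent in
      \<open>lower\<close>.\<close>
    obtain q where q: "q \<ge> 1" "1 / z\<^sup>2 * w ^ q < z ^ q" using ex_power_gt[OF w(1,3)] by blast
    have "L q \<le> w ^ q" using upper'[of q] power_mono[OF w(2) y, of q] by linarith
    also have "\<dots> < z ^ (q + 2)" using q w by (simp add: field_simps power2_eq_square)
    finally have "\<forall>\<^sub>F k in sequentially. Q k q < z ^ (q + 2)"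
      using conv[OF q(1)] by (auto dest: order_tendstoD)
    then show ?thesis
    proof eventually_elim
      case (elim k)
      then have "x k ^ (q + 2) < z ^ (q + 2)" using lower[of k q] by linarith
      then show ?case using w by (intro power_less_imp_less_base[of "x k" "q+2" z]) auto
    qed
  qed
next
  fix z assume "z < y"
  show "\<forall>\<^sub>F k in sequentially. z < x k"
  proof (cases "z < 0")
    case True
    then show ?thesis using x by (intro always_eventually allI) (auto intro: less_le_trans)
  next
    case False
    define w where "w = (y + z) / 2"
    have w: "0 < w" "w < y" "z < w" using \<open>z < y\<close> False by (auto simp: w_def)
    obtain q where q: "q \<ge> 1" "1 / y\<^sup>2 * w ^ q < y ^ q" using ex_power_gt[OF w(1,2)] by blast
    have "w ^ q < y ^ (q + 2)" using q w by (simp add: field_simps power2_eq_square)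
    also have "\<dots> \<le> L q" by (rule lower')
    finally have "\<forall>\<^sub>F k in sequentially. w ^ q < Q k q"
      using conv[OF q(1)] by (auto dest: order_tendstoD)
    then show ?thesis
    proof eventually_elim
      case (elim k)
      then have "w ^ q < x k ^ q" using upper[of k q] by linarith
      then show ?case using w x power_less_imp_less_base[of w q "x k"] by auto
    qed
  qed
qed

text \<open>Weight s is the largest of the tail starting at s. The power sums of that tail converge,
  because the full ones do and the s preceding weights converge by induction.\<close>

lemma power_sums_tendsto_imp_tendsto:
  fixes \<beta> :: "nat \<Rightarrow> nat \<Rightarrow> real" and b :: "nat \<Rightarrow> real"
  assumes \<beta>: "\<And>k. antimono (\<beta> k)" "\<And>k i. 0 \<le> \<beta> k i" "\<And>k i. i \<ge> m k \<Longrightarrow> \<beta> k i = 0"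
      "\<And>k. (\<Sum>i<m k. (\<beta> k i)\<^sup>2) \<le> 1"
    and b: "antimono b" "\<And>i. 0 \<le> b i" "\<And>i. i \<ge> r \<Longrightarrow> b i = 0" "(\<Sum>i<r. (b i)\<^sup>2) \<le> 1"
    and conv: "\<And>q. q \<ge> 1 \<Longrightarrow> (\<lambda>k. \<Sum>i<m k. \<beta> k i ^ (q + 2)) \<longlonglongrightarrow> (\<Sum>i<r. b i ^ (q + 2))"
  shows "(\<lambda>k. \<beta> k s) \<longlonglongrightarrow> b s"
proof (induction s rule: less_induct)
  case (less s)
  show ?case
  proof (rule tendsto_of_power_sandwich)
    show "(\<lambda>k. (\<Sum>i<m k. \<beta> k i ^ (q + 2)) - (\<Sum>i<s. \<beta> k i ^ (q + 2)))
        \<longlonglongrightarrow> (\<Sum>i<r. b i ^ (q + 2)) - (\<Sum>i<s. b i ^ (q + 2))" if "q \<ge> 1" for q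
      using less by (intro tendsto_diff conv that tendsto_sum tendsto_power) auto
  qed (use tail_power_sum_bounds[OF \<beta>] tail_power_sum_bounds[OF b] \<beta>(2) b(2) in auto)
qed

text \<open>Up to sign the remainder has derivative x^n / (1 + x), which lies between 0 and (n + 1)
  x^n; integrating from 0 gives both bounds. The estimate holds for all y >= 0, also where the
  Taylor series diverges, so u need not be restricted when it is used.\<close>

lemma ln_one_plus_taylor_bound:
  fixes y :: real
  assumes "0 \<le> y"
  shows "\<bar>ln (1 + y) - (\<Sum>j=1..n. (-1) ^ (j + 1) * y ^ j / real j)\<bar> \<le> y ^ (n + 1)"
proof -
  \<comment> \<open>The sign (-1)^n is built in so that the derivative is nonnegative for every
    n.\<close>
  define R where "R = (\<lambda>n y. (-1) ^ n * (ln (1 + y) - (\<Sum>j=1..n. (-1) ^ (j + 1) * y ^ j / real j)) :: real)"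
  have geo: "(\<Sum>j=1..n. (-1) ^ (j + 1) * x ^ (j - 1)) = (1 - (- x) ^ n) / (1 + x)" if "0 \<le> x" for x :: real and n
  proof (induction n)
    case (Suc n)
    then show ?case using that by (simp add: field_simps power_minus[of x])
  qed simp
  have der: "((R n) has_real_derivative (x ^ n / (1 + x))) (at x)" if "0 \<le> x" for x n
  proof -
    have "((R n) has_real_derivative ((-1) ^ n * (1 / (1 + x) - (\<Sum>j=1..n. (-1) ^ (j + 1) * x ^ (j - 1))))) (at x)"
      unfolding R_def using that
      by (auto intro!: derivative_eq_intros sum.cong simp: field_simps)
    also have "(-1) ^ n * (1 / (1 + x) - (\<Sum>j=1..n. (-1) ^ (j + 1) * x ^ (j - 1))) = x ^ n / (1 + x)"
      unfolding geo[OF that] using that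
      by (simp add: field_simps power_minus[of x])
    finally show ?thesis .
  qed
  have R0: "R n 0 = 0" for n by (auto simp: R_def intro!: sum.neutral)
  have "R n y \<ge> R n 0"
    by (rule DERIV_nonneg_imp_nondecreasing[OF assms]) (use der in force)
  moreover have "R n y - y ^ (n + 1) \<le> R n 0 - 0 ^ (n + 1)"
  proof (rule DERIV_nonpos_imp_nonincreasing[OF assms])
    fix x assume x: "0 \<le> x" "x \<le> y"
    have "((\<lambda>y. R n y - y ^ (n + 1)) has_real_derivative (x ^ n / (1 + x) - real (n + 1) * x ^ n)) (at x)"
      using der[OF x(1), of n] by (intro derivative_eq_intros | simp)+
    moreover have "x ^ n / (1 + x) \<le> real (n + 1) * x ^ n"
    proof -
      have "x ^ n / (1 + x) \<le> x ^ n" using x by (simp add: divide_le_eq mult_le_cancel_left1)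
      also have "\<dots> \<le> real (n + 1) * x ^ n" using x by (simp add: algebra_simps)
      finally show ?thesis .
    qed
    ultimately show "\<exists>z. ((\<lambda>y. R n y - y ^ (n + 1)) has_real_derivative z) (at x) \<and> z \<le> 0" by force
  qed
  ultimately have "\<bar>R n y\<bar> \<le> y ^ (n + 1)" using R0[of n] by simp
  moreover have "\<bar>R n y\<bar> = \<bar>ln (1 + y) - (\<Sum>j=1..n. (-1) ^ (j + 1) * y ^ j / real j)\<bar>"
    by (simp add: R_def abs_mult power_abs)
  ultimately show ?thesis by simp
qed

text \<open>The coefficients of the power series in u are recovered one after the other by letting u tend to 0.\<close>
lemma log_sums_tendsto_imp_power_sums_tendsto:
  fixes \<beta> :: "nat \<Rightarrow> nat \<Rightarrow> real" and b :: "nat \<Rightarrow> real"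
  defines "F \<equiv> \<lambda>y :: real. y\<^sup>2 / 2 - y + ln (1 + y)"
  assumes \<beta>: "\<And>k i. 0 \<le> \<beta> k i" "\<And>k. (\<Sum>i<m k. (\<beta> k i)\<^sup>2) \<le> 1"
    and b: "\<And>i. 0 \<le> b i" "(\<Sum>i<r. (b i)\<^sup>2) \<le> 1"
    and conv: "\<And>u. u > 0 \<Longrightarrow> (\<lambda>k. \<Sum>i<m k. F (u * \<beta> k i)) \<longlonglongrightarrow> (\<Sum>i<r. F (u * b i))"
  shows "q \<ge> 1 \<Longrightarrow> (\<lambda>k. \<Sum>i<m k. \<beta> k i ^ (q + 2)) \<longlonglongrightarrow> (\<Sum>i<r. b i ^ (q + 2))"
proof (induction q rule: less_induct)
  case (less q)
  define c where "c = (\<lambda>j. (-1) ^ (j + 1) / real j)"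
  \<comment> \<open>Taylor expansion in u up to order q + 2 with an error that depends neither on
    the number of weights nor on their size: since x i <= 1, the power x i ^ (q + 3) is at most (x
    i)^2, and the squares sum to at most 1.\<close>
  have expand: "\<bar>(\<Sum>i<n. F (u * x i)) - (\<Sum>j\<in>{3..<q+2}. c j * u ^ j * (\<Sum>i<n. x i ^ j))
       - c (q + 2) * u ^ (q + 2) * (\<Sum>i<n. x i ^ (q + 2))\<bar> \<le> u ^ (q + 3)"
    if u: "u > 0" and x: "\<And>i. 0 \<le> x i" "(\<Sum>i<n. (x i)\<^sup>2) \<le> 1" for n :: nat and x and u :: real
  proof -
    have x1: "x i \<le> 1" if "i < n" for i
    proof -
      have "(x i)\<^sup>2 \<le> (\<Sum>i<n. (x i)\<^sup>2)" using that by (intro member_le_sum) auto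
      then have "(x i)\<^sup>2 \<le> 1\<^sup>2" using x(2) by simp
      then show ?thesis by (rule power2_le_imp_le) simp
    qed
    have F: "\<bar>F y - (\<Sum>j\<in>{3..<q+3}. c j * y ^ j)\<bar> \<le> y ^ (q + 3)" if "0 \<le> y" for y
    proof -
      \<comment> \<open>The terms of order 1 and 2 are exactly those cancelled in F, so its
        expansion starts at order 3.\<close>
      have "{1..q+2} = insert 1 (insert 2 {3..<q+3})" by auto
      then have "(\<Sum>j=1..q+2. (-1) ^ (j + 1) * y ^ j / real j) = y - y\<^sup>2 / 2 + (\<Sum>j\<in>{3..<q+3}. c j * y ^ j)"
        by (simp add: c_def)
      moreover have "q + 2 + 1 = q + 3" by simp
      ultimately have "\<bar>ln (1 + y) - (y - y\<^sup>2 / 2 + (\<Sum>j\<in>{3..<q+3}. c j * y ^ j))\<bar> \<le> y ^ (q + 3)"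
        using ln_one_plus_taylor_bound[OF that, of "q + 2"] by metis
      then show ?thesis unfolding F_def by linarith
    qed
    have "(\<Sum>j\<in>{3..<q+2}. c j * u ^ j * (\<Sum>i<n. x i ^ j)) + c (q + 2) * u ^ (q + 2) * (\<Sum>i<n. x i ^ (q + 2))
      = (\<Sum>j\<in>{3..<q+3}. c j * u ^ j * (\<Sum>i<n. x i ^ j))"
    proof -
      have "{3..<q+3} = insert (q+2) {3..<q+2}" using less.prems by auto
      then show ?thesis by simp
    qed
    also have "\<dots> = (\<Sum>i<n. \<Sum>j\<in>{3..<q+3}. c j * (u * x i) ^ j)"
      by (subst sum.swap) (simp add: sum_distrib_left power_mult_distrib mult.assoc)
    finally have "(\<Sum>i<n. F (u * x i)) - (\<Sum>j\<in>{3..<q+2}. c j * u ^ j * (\<Sum>i<n. x i ^ j))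
       - c (q + 2) * u ^ (q + 2) * (\<Sum>i<n. x i ^ (q + 2))
       = (\<Sum>i<n. F (u * x i) - (\<Sum>j\<in>{3..<q+3}. c j * (u * x i) ^ j))"
      by (simp add: sum_subtractf)
    also have "\<bar>\<dots>\<bar> \<le> (\<Sum>i<n. (u * x i) ^ (q + 3))"
      by (rule order.trans[OF sum_abs]) (intro sum_mono F, use u x in auto)
    also have "\<dots> \<le> (\<Sum>i<n. u ^ (q + 3) * (x i)\<^sup>2)"
    proof (rule sum_mono)
      fix i assume i: "i \<in> {..<n}"
      have "x i ^ (q + 3) = (x i)\<^sup>2 * x i ^ (q + 1)" by (simp add: power_add power2_eq_square power3_eq_cube)
      also have "\<dots> \<le> (x i)\<^sup>2 * 1" using x1[of i] x(1)[of i] i by (intro mult_left_mono power_le_one) auto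
      finally show "(u * x i) ^ (q + 3) \<le> u ^ (q + 3) * (x i)\<^sup>2"
        using u by (simp add: power_mult_distrib)
    qed
    also have "\<dots> = u ^ (q + 3) * (\<Sum>i<n. (x i)\<^sup>2)" by (simp add: sum_distrib_left)
    also have "\<dots> \<le> u ^ (q + 3) * 1" using u x by (intro mult_left_mono) auto
    finally show ?thesis by simp
  qed
  define p where "p = (\<lambda>j k. \<Sum>i<m k. \<beta> k i ^ j)"
  define p' where "p' = (\<lambda>j. \<Sum>i<r. b i ^ j)"
  have c0: "\<bar>c (q + 2)\<bar> > 0" by (simp add: c_def)
  have "\<forall>\<^sub>F k in sequentially. \<bar>p (q + 2) k - p' (q + 2)\<bar> < e" if e: "e > 0" for e
  proof -
    \<comment> \<open>Three errors of size u^(q + 3) occur: two expansions and the distance at this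
      u. Dividing by |c| u^(q + 2) leaves 3 u / |c| = e.\<close>
    define u where "u = \<bar>c (q + 2)\<bar> * e / 3"
    have u: "u > 0" using c0 e by (simp add: u_def)
    define G where "G = (\<lambda>k. (\<Sum>i<m k. F (u * \<beta> k i)) - (\<Sum>j\<in>{3..<q+2}. c j * u ^ j * p j k))"
    define G' where "G' = (\<Sum>i<r. F (u * b i)) - (\<Sum>j\<in>{3..<q+2}. c j * u ^ j * p' j)"
    have pj: "p j \<longlonglongrightarrow> p' j" if "j \<in> {3..<q+2}" for j
    proof -
      from that have "j - 2 + 2 = j" "j - 2 < q" "j - 2 \<ge> 1" by auto
      then show ?thesis using less.IH[of "j - 2"] by (simp only: p_def p'_def)
    qed
    have "G \<longlonglongrightarrow> G'" unfolding G_def G'_def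
      by (intro tendsto_diff conv u tendsto_sum tendsto_mult tendsto_const pj)
    then have "\<forall>\<^sub>F k in sequentially. \<bar>G k - G'\<bar> < u ^ (q + 3)"
      using u by (auto simp: tendsto_iff dist_real_def)
    then show ?thesis
    proof eventually_elim
      case (elim k)
      have "\<bar>G k - c (q + 2) * u ^ (q + 2) * p (q + 2) k\<bar> \<le> u ^ (q + 3)"
        unfolding G_def p_def by (rule expand[OF u \<beta>])
      moreover have "\<bar>G' - c (q + 2) * u ^ (q + 2) * p' (q + 2)\<bar> \<le> u ^ (q + 3)"
        unfolding G'_def p'_def by (rule expand[OF u b])
      ultimately have "\<bar>c (q + 2) * u ^ (q + 2) * p (q + 2) k - c (q + 2) * u ^ (q + 2) * p' (q + 2)\<bar> < 3 * u ^ (q + 3)"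
        using elim by linarith
      moreover have "c (q + 2) * u ^ (q + 2) * p (q + 2) k - c (q + 2) * u ^ (q + 2) * p' (q + 2)
          = u ^ (q + 2) * (c (q + 2) * (p (q + 2) k - p' (q + 2)))"
        by (simp add: algebra_simps)
      moreover have "u ^ (q + 3) = u ^ (q + 2) * u" by (simp add: power_add eval_nat_numeral)
      ultimately have "u ^ (q + 2) * (\<bar>c (q + 2)\<bar> * \<bar>p (q + 2) k - p' (q + 2)\<bar>) < u ^ (q + 2) * (3 * u)"
        using u by (simp add: abs_mult mult_ac)
      then have "\<bar>c (q + 2)\<bar> * \<bar>p (q + 2) k - p' (q + 2)\<bar> < 3 * u"
        using u by (simp only: mult_less_cancel_left_pos zero_less_power)
      then show ?case using c0 by (simp add: u_def)
    qed
  qed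
  then show ?case
    unfolding p_def p'_def tendsto_iff dist_real_def by blast
qed

section \<open>Spectral decomposition of the design\<close>

lemma complex_eigenvalue_symmetric_real:
  fixes A :: "real mat"
  assumes A: "A \<in> carrier_mat n n" and sym: "transpose_mat A = A"
    and ev: "eigenvalue (map_mat complex_of_real A) e"
  shows "Im e = 0"
proof -
  let ?A = "map_mat complex_of_real A"
  from ev obtain v where v: "v \<in> carrier_vec n" "v \<noteq> 0\<^sub>v n" and eq: "?A *\<^sub>v v = e \<cdot>\<^sub>v v"
    using A by (auto simp: eigenvalue_def eigenvector_def)
  have Aij: "A $$ (i, j) = A $$ (j, i)" if "i < n" "j < n" for i j
    using sym A that by (metis carrier_matD index_transpose_mat(1))
  have row: "(\<Sum>j<n. complex_of_real (A $$ (i, j)) * v $ j) = e * v $ i" if "i < n" for i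
    using arg_cong[OF eq, of "\<lambda>w. w $ i"] that A v
    by (simp add: scalar_prod_def row_def lessThan_atLeast0)
  \<comment> \<open>The Hermitian form of the eigenvector: symmetry makes it equal to its conjugate,
    and it is e times the positive squared norm of v.\<close>
  define q where "q = (\<Sum>i<n. cnj (v $ i) * (\<Sum>j<n. complex_of_real (A $$ (i, j)) * v $ j))"
  have "cnj q = (\<Sum>i<n. \<Sum>j<n. complex_of_real (A $$ (i, j)) * v $ i * cnj (v $ j))"
    by (simp add: q_def sum_distrib_left mult_ac)
  also have "\<dots> = (\<Sum>j<n. \<Sum>i<n. complex_of_real (A $$ (j, i)) * v $ i * cnj (v $ j))"
    by (subst sum.swap) (auto intro!: sum.cong simp: Aij)
  also have "\<dots> = q"
    by (simp add: q_def sum_distrib_left mult_ac)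
  finally have "Im q = 0" by (metis complex_cnj_cancel_iff complex_eq_iff cnj.sel(2) neg_equal_zero)
  moreover have "q = (\<Sum>i<n. e * of_real ((cmod (v $ i))\<^sup>2))"
    unfolding q_def by (rule sum.cong) (auto simp: row complex_norm_square simp del: of_real_power)
  then have "q = e * of_real (\<Sum>i<n. (cmod (v $ i))\<^sup>2)" by (simp add: sum_distrib_left)
  moreover have "(\<Sum>i<n. (cmod (v $ i))\<^sup>2) > 0"
  proof -
    from v obtain i where "i < n" "v $ i \<noteq> 0" by (auto simp: vec_eq_iff)
    then show ?thesis by (intro sum_pos2[of _ i]) auto
  qed
  ultimately show ?thesis by auto
qed

text \<open>The factorization over the complex numbers descends to the reals: all roots are real,
  and the embedding of real into complex polynomials is injective.\<close>

lemma symmetric_char_poly_splits: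
  fixes A :: "real mat"
  assumes A: "A \<in> carrier_mat n n" and sym: "transpose_mat A = A"
  obtains es where "char_poly A = (\<Prod>e\<leftarrow>es. [:- e, 1:])" "length es = n" "sorted_wrt (\<ge>) es"
proof -
  let ?A = "map_mat complex_of_real A"
  have cA: "?A \<in> carrier_mat n n" using A by simp
  obtain as where as: "char_poly ?A = (\<Prod>a\<leftarrow>as. [:- a, 1:])" "length as = n"
    using char_poly_factorized[OF cA] by blast
  have "Im a = 0" if "a \<in> set as" for a
  proof -
    have "poly (char_poly ?A) a = 0" unfolding as using linear_poly_root[OF that] by simp
    then show ?thesis using complex_eigenvalue_symmetric_real[OF A sym] eigenvalue_root_char_poly[OF cA] by blast
  qed
  then have re: "as = map (complex_of_real \<circ> Re) as"
    by (induction as) (auto simp: complex_eq_iff)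
  interpret h: map_poly_inj_comm_ring_hom complex_of_real ..
  have "map_poly complex_of_real (char_poly A) = map_poly complex_of_real (\<Prod>e\<leftarrow>map Re as. [:- e, 1:])"
  proof -
    have "map_poly complex_of_real (char_poly A) = char_poly ?A"
      by (rule of_real_hom.char_poly_hom[OF A, symmetric])
    also have "\<dots> = (\<Prod>e\<leftarrow>map Re as. [:- complex_of_real e, 1:])"
      unfolding as by (subst re) (simp add: o_def)
    also have "\<dots> = map_poly complex_of_real (\<Prod>e\<leftarrow>map Re as. [:- e, 1:])"
      by (simp add: h.hom_prod_list o_def)
    finally show ?thesis .
  qed
  then have cp: "char_poly A = (\<Prod>e\<leftarrow>map Re as. [:- e, 1:])" by (rule h.injectivity)
  define es where "es = rev (sort (map Re as))"
  have "mset (map (\<lambda>e. [:- e, 1:]) es) = mset (map (\<lambda>e. [:- e, 1:]) (map Re as))"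
    unfolding es_def by (simp add: image_mset.compositionality)
  then have "(\<Prod>e\<leftarrow>es. [:- e, 1:]) = (\<Prod>e\<leftarrow>map Re as. [:- e, 1:])"
    by (metis prod_mset_prod_list)
  with cp as have "char_poly A = (\<Prod>e\<leftarrow>es. [:- e, 1:])" "length es = n" by (simp_all add: es_def)
  moreover have "sorted_wrt (\<ge>) es" by (simp add: es_def sorted_wrt_rev)
  ultimately show ?thesis using that by blast
qed

text \<open>Uniqueness for the definite description in \<open>eigs_desc\<close>: the multiset of
  roots with multiplicity is recovered from the product, and sorting then fixes the list.\<close>

lemma prod_linear_factors_unique:
  fixes es es' :: "real list"
  assumes "(\<Prod>e\<leftarrow>es. [:- e, 1:]) = (\<Prod>e\<leftarrow>es'. [:- e, 1:])"
  shows "mset es = mset es'"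
proof -
  have "proots (\<Prod>e\<leftarrow>es. [:- e, 1:]) = mset es" for es :: "real list"
  proof (induction es)
    case (Cons e es)
    have "(\<Prod>e\<leftarrow>es. [:- e, 1:]) \<noteq> 0" by (auto simp: prod_list_zero_iff)
    then show ?case using Cons by (simp add: proots_mult del: mult_pCons_left)
  qed simp
  then show ?thesis using assms by metis
qed

lemma eigs_desc_eqI:
  assumes "char_poly A = (\<Prod>e\<leftarrow>es. [:- e, 1:])" "sorted_wrt (\<ge>) es"
  shows "eigs_desc A = es"
  unfolding eigs_desc_def
proof (rule the_equality)
  fix ls :: "real list"
  assume ls: "sorted_wrt (\<ge>) ls \<and> char_poly A = prod_list (map (\<lambda>l. [:- l, 1:]) ls)"
  then have "mset ls = mset es" using assms by (intro prod_linear_factors_unique) simp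
  moreover have "sorted (rev ls)" "sorted (rev es)" using ls assms by (simp_all add: sorted_wrt_rev)
  ultimately have "rev ls = rev es"
    by (metis mset_rev properties_for_sort)
  then show "ls = es" by simp
qed (use assms in simp)

text \<open>Division by zero makes this the identity for w = 0, which is the desired value.\<close>
definition householder :: "nat \<Rightarrow> real vec \<Rightarrow> real mat" where
  "householder n w = mat n n (\<lambda>(i, j). (if i = j then 1 else 0) - 2 / (w \<bullet> w) * w $ i * w $ j)"

lemma householder_carrier [simp]: "householder n w \<in> carrier_mat n n"
  by (simp add: householder_def)

lemma householder_transpose: "transpose_mat (householder n w) = householder n w"
  by (rule eq_matI) (auto simp: householder_def)

lemma householder_involution:
  fixes w :: "real vec"
  assumes w: "w \<in> carrier_vec n"
  shows "householder n w * householder n w = 1\<^sub>m n"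
proof (rule eq_matI)
  fix i j assume "i < dim_row (1\<^sub>m n :: real mat)" "j < dim_col (1\<^sub>m n :: real mat)"
  then have ij: "i < n" "j < n" by auto
  define c where "c = 2 / (w \<bullet> w)"
  have ww: "w \<bullet> w = (\<Sum>k<n. w $ k * w $ k)" using w by (simp add: scalar_prod_def lessThan_atLeast0)
  \<comment> \<open>This also covers w = 0, where c = 0 by the convention for division by
    zero.\<close>
  have c2: "c * c * (w \<bullet> w) = 2 * c" by (simp add: c_def)
  have "(householder n w * householder n w) $$ (i, j)
      = (\<Sum>k<n. ((if i = k then 1 else 0) - c * w $ i * w $ k) * ((if k = j then 1 else 0) - c * w $ k * w $ j))"
    using ij by (simp add: householder_def scalar_prod_def lessThan_atLeast0 c_def)
  also have "\<dots> = (\<Sum>k<n. (if i = k then (if k = j then 1 else 0) else 0) - (if k = i then c * w $ k * w $ j else 0)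
        - (if k = j then c * w $ i * w $ k else 0) + c * c * w $ i * w $ j * (w $ k * w $ k))"
    by (rule sum.cong) (auto simp: algebra_simps)
  also have "\<dots> = (if i = j then 1 else 0) - c * w $ i * w $ j - c * w $ i * w $ j + (c * c * (w \<bullet> w)) * (w $ i * w $ j)"
    using ij by (simp add: sum.distrib sum_subtractf sum.delta sum_distrib_left sum_distrib_right ww mult_ac)
  also have "\<dots> = 1\<^sub>m n $$ (i, j)" using ij unfolding c2 by simp
  finally show "(householder n w * householder n w) $$ (i, j) = 1\<^sub>m n $$ (i, j)" .
qed (simp_all add: householder_def)

text \<open>The difference w of two unit vectors is normal to the hyperplane whose reflection
  exchanges them. The cancellation rests on w . w = 2 (1 - v $ 0) and w . v = 1 - v $ 0.\<close>

lemma householder_maps_to_unit: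
  fixes v :: "real vec"
  assumes v: "v \<in> carrier_vec n" and norm: "v \<bullet> v = 1" and n: "0 < n"
  shows "householder n (v - unit_vec n 0) *\<^sub>v v = unit_vec n 0"
proof (rule eq_vecI)
  fix i assume "i < dim_vec (unit_vec n 0 :: real vec)"
  then have i: "i < n" by simp
  let ?w = "v - unit_vec n 0 :: real vec"
  have w: "?w \<in> carrier_vec n" using v by simp
  have wi: "?w $ k = v $ k - (if k = 0 then 1 else 0)" if "k < n" for k using that v n by simp
  have vv: "(\<Sum>k<n. v $ k * v $ k) = 1" using norm v by (simp add: scalar_prod_def lessThan_atLeast0)
  have wv: "(\<Sum>k<n. ?w $ k * v $ k) = 1 - v $ 0"
  proof -
    have "(\<Sum>k<n. ?w $ k * v $ k) = (\<Sum>k<n. v $ k * v $ k - (if k = 0 then v $ k else 0))"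
      by (rule sum.cong) (auto simp: wi algebra_simps)
    then show ?thesis using n vv by (simp add: sum_subtractf sum.delta)
  qed
  have "?w \<bullet> ?w = (\<Sum>k<n. ?w $ k * ?w $ k)" using w by (simp add: scalar_prod_def lessThan_atLeast0)
  also have "\<dots> = (\<Sum>k<n. v $ k * v $ k + (if k = 0 then 1 - 2 * v $ k else 0))"
    by (rule sum.cong) (auto simp: wi algebra_simps)
  also have "\<dots> = 2 * (1 - v $ 0)" using n vv by (simp add: sum.distrib sum.delta)
  finally have ww: "?w \<bullet> ?w = 2 * (1 - v $ 0)" .
  have "(householder n ?w *\<^sub>v v) $ i = (\<Sum>k<n. ((if i = k then 1 else 0) - 2 / (?w \<bullet> ?w) * ?w $ i * ?w $ k) * v $ k)"
    using i v unfolding householder_def by (simp add: scalar_prod_def lessThan_atLeast0)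
  also have "\<dots> = (\<Sum>k<n. (if i = k then v $ k else 0) - (2 / (?w \<bullet> ?w) * ?w $ i) * (?w $ k * v $ k))"
    by (rule sum.cong) (auto simp: algebra_simps)
  also have "\<dots> = v $ i - 2 / (?w \<bullet> ?w) * ?w $ i * (1 - v $ 0)"
    using i by (simp only: sum_subtractf sum_distrib_left[symmetric] wv) (simp add: sum.delta)
  also have "\<dots> = unit_vec n 0 $ i"
  \<comment> \<open>If v $ 0 = 1 then w = 0 and the reflection is the identity, as it should be,
    because v is already the unit vector.\<close>
  proof (cases "v $ 0 = 1")
    case True
    then have "(\<Sum>k<n. ?w $ k * ?w $ k) = 0" using ww w by (simp add: scalar_prod_def lessThan_atLeast0)
    then have "?w $ i = 0" using i by (subst (asm) sum_nonneg_eq_0_iff) auto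
    then show ?thesis using True i wi[OF i] by (simp split: if_splits)
  next
    case False
    then have "2 / (?w \<bullet> ?w) * ?w $ i * (1 - v $ 0) = ?w $ i" by (simp add: ww field_simps)
    then show ?thesis using i wi[OF i] by simp
  qed
  finally show "(householder n ?w *\<^sub>v v) $ i = unit_vec n 0 $ i" .
qed (simp add: householder_def)

text \<open>Deflation: a reflection H sends a unit eigenvector to the first basis vector, and H A H
  splits off the eigenvalue as a 1 x 1 block. The induction runs over the list of roots, so that the
  diagonal lists them in the prescribed order; this later ties the eigenvectors to the sorted list
  \<open>eigs_desc\<close>.\<close>

lemma symmetric_diagonalization:
  fixes A :: "real mat"
  assumes "A \<in> carrier_mat n n" "transpose_mat A = A" "char_poly A = (\<Prod>e\<leftarrow>es. [:- e, 1:])"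
  shows "\<exists>U \<in> carrier_mat n n. U * transpose_mat U = 1\<^sub>m n \<and> transpose_mat U * U = 1\<^sub>m n \<and>
    A = U * mat n n (\<lambda>(i, j). if i = j then es ! i else 0) * transpose_mat U"
  using assms
proof (induction es arbitrary: n A)
  case Nil
  then have "n = 0" using degree_monic_char_poly[of A n] by simp
  then show ?case using Nil by (intro bexI[of _ "1\<^sub>m 0"]) auto
next
  case (Cons e es n A)
  have A: "A \<in> carrier_mat n n" and sym: "transpose_mat A = A"
    and cp: "char_poly A = [:- e, 1:] * (\<Prod>e\<leftarrow>es. [:- e, 1:])" using Cons.prems by auto
  have "poly (char_poly A) e = 0" unfolding cp by simp
  then have "eigenvalue A e" using eigenvalue_root_char_poly[OF A] by simp
  then obtain v0 where v0: "v0 \<in> carrier_vec n" "v0 \<noteq> 0\<^sub>v n" and ev0: "A *\<^sub>v v0 = e \<cdot>\<^sub>v v0"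
    using A by (auto simp: eigenvalue_def eigenvector_def)
  then have n: "0 < n" by (cases n) auto
  then obtain n' where n': "n = Suc n'" by (cases n) auto
  have pos: "scalar_prod v0 v0 > 0"
  proof -
    from v0 obtain i where "i < n" "v0 $ i \<noteq> 0" by (auto simp: vec_eq_iff)
    then show ?thesis using v0 unfolding scalar_prod_def by (intro sum_pos2[of _ i]) auto
  qed
  define v where "v = (1 / sqrt (scalar_prod v0 v0)) \<cdot>\<^sub>v v0"
  have v: "v \<in> carrier_vec n" using v0 by (simp add: v_def)
  have vn: "scalar_prod v v = 1" using v0 pos by (simp add: v_def)
  have ev: "A *\<^sub>v v = e \<cdot>\<^sub>v v" using v0 ev0 A
    by (simp add: v_def mult_mat_vec smult_smult_assoc mult.commute)
  define H where "H = householder n (v - unit_vec n 0)"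
  have H: "H \<in> carrier_mat n n" by (simp add: H_def)
  have HH: "H * H = 1\<^sub>m n" unfolding H_def using v by (intro householder_involution) auto
  have HT: "transpose_mat H = H" by (simp add: H_def householder_transpose)
  have Hv: "H *\<^sub>v v = unit_vec n 0" unfolding H_def by (rule householder_maps_to_unit[OF v vn n])
  define A' where "A' = H * A * H"
  have A': "A' \<in> carrier_mat n n" using H A by (simp add: A'_def)
  have A'T: "transpose_mat A' = A'"
    using H A by (simp add: A'_def transpose_mult[of _ n n _ n] HT sym assoc_mult_mat[of _ n n _ n _ n])
  have AA': "A = H * A' * H"
  proof -
    have "H * A' * H = (H * H) * A * (H * H)"
      using H A by (simp add: A'_def assoc_mult_mat[of _ n n _ n _ n])
    then show ?thesis using A by (simp add: HH)
  qed
  have col0: "A' *\<^sub>v unit_vec n 0 = e \<cdot>\<^sub>v unit_vec n 0"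
  proof -
    have He: "H *\<^sub>v unit_vec n 0 = v"
      unfolding Hv[symmetric] using H v by (simp add: assoc_mult_mat_vec[symmetric, of _ n n _ n] HH)
    have "A' *\<^sub>v unit_vec n 0 = H *\<^sub>v (A *\<^sub>v (H *\<^sub>v unit_vec n 0))"
      using H A by (simp add: A'_def assoc_mult_mat_vec[of _ n n _ n])
    also have "\<dots> = e \<cdot>\<^sub>v unit_vec n 0" unfolding He ev using H v Hv by (simp add: mult_mat_vec)
    finally show ?thesis .
  qed
  have A'i0: "A' $$ (i, 0) = (if i = 0 then e else 0)" if "i < n" for i
    using arg_cong[OF col0, of "\<lambda>w. w $ i"] that A' n by simp
  have A'0i: "A' $$ (0, i) = (if i = 0 then e else 0)" if "i < n" for i
    using A'i0[OF that] A'T A' that n by (metis carrier_matD index_transpose_mat(1))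
  define A3 where "A3 = mat n' n' (\<lambda>(i, j). A' $$ (Suc i, Suc j))"
  have A3: "A3 \<in> carrier_mat n' n'" by (simp add: A3_def)
  have A3T: "transpose_mat A3 = A3"
    using A'T A' by (intro eq_matI) (auto simp: A3_def n', metis Suc_less_eq carrier_matD index_transpose_mat(1))
  let ?E = "mat 1 1 (\<lambda>_. e)"
  \<comment> \<open>The first column vanishes below the corner by the eigenvector equation, and the
    first row does so by symmetry.\<close>
  have blk: "A' = four_block_mat ?E (0\<^sub>m 1 n') (0\<^sub>m n' 1) A3"
    using A' A'i0 A'0i by (intro eq_matI) (auto simp: A3_def n' less_Suc_eq_0_disj)
  have "char_poly A' = [:- e, 1:] * char_poly A3"
  proof -
    have "char_poly A' = char_poly ?E * char_poly A3"
      unfolding blk by (rule char_poly_four_block_zeros_col) (use A3 in auto)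
    also have "char_poly ?E = [:- e, 1:]"
      by (simp add: char_poly_defs det_def sign_def)
    finally show ?thesis .
  qed
  moreover have "char_poly A' = char_poly A"
    by (rule char_poly_similar, rule similar_matI[of _ _ H H n]) (use H A A' HH A'_def in auto)
  ultimately have "char_poly A3 = (\<Prod>e\<leftarrow>es. [:- e, 1:])"
    using cp by (metis mult_cancel_left pCons_eq_0_iff zero_neq_one)
  from Cons.IH[OF A3 A3T this] obtain U where U: "U \<in> carrier_mat n' n'"
    "U * transpose_mat U = 1\<^sub>m n'" "transpose_mat U * U = 1\<^sub>m n'"
    and A3U: "A3 = U * mat n' n' (\<lambda>(i, j). if i = j then es ! i else 0) * transpose_mat U" by blast
  let ?D' = "mat n' n' (\<lambda>(i, j). if i = j then es ! i else 0)"
  let ?D = "mat n n (\<lambda>(i, j). if i = j then (e # es) ! i else 0)"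
  define V where "V = four_block_mat (1\<^sub>m 1) (0\<^sub>m 1 n') (0\<^sub>m n' 1) U"
  have V: "V \<in> carrier_mat n n" using U four_block_carrier_mat[of "1\<^sub>m 1" 1 1 U n' n'] by (simp add: V_def n')
  have VT: "transpose_mat V = four_block_mat (1\<^sub>m 1) (0\<^sub>m 1 n') (0\<^sub>m n' 1) (transpose_mat U)"
    unfolding V_def by (subst transpose_four_block_mat[of _ 1 1 _ n' _ n']) (use U in auto)
  have D: "?D = four_block_mat ?E (0\<^sub>m 1 n') (0\<^sub>m n' 1) ?D'"
    by (rule eq_matI) (auto simp: n' less_Suc_eq_0_disj)
  have VV: "V * transpose_mat V = 1\<^sub>m n" "transpose_mat V * V = 1\<^sub>m n"
    unfolding VT unfolding V_def using U
    by (simp_all add: mult_four_block_mat[of _ 1 1 _ n' _ n' _ _ 1 _ n'] n')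
  have VDV: "A' = V * ?D * transpose_mat V"
  proof -
    have "U * ?D' * transpose_mat U \<in> carrier_mat n' n'" using A3 unfolding A3U .
    then show ?thesis
      unfolding blk VT D unfolding V_def A3U using U
      by (simp add: mult_four_block_mat[of _ 1 1 _ n' _ n' _ _ 1 _ n'] left_add_zero_mat[of _ n' n'])
  qed
  have VTc: "transpose_mat V \<in> carrier_mat n n" and Dc: "?D \<in> carrier_mat n n" using V by auto
  show ?case
  proof (intro bexI[of _ "H * V"] conjI)
    have T: "transpose_mat (H * V) = transpose_mat V * H"
      using H V by (simp add: transpose_mult[of _ n n _ n] HT)
    have "H * V * transpose_mat (H * V) = H * (V * transpose_mat V) * H"
      unfolding T using H V VTc by (simp add: assoc_mult_mat[of _ n n _ n _ n])
    then show "H * V * transpose_mat (H * V) = 1\<^sub>m n" using H by (simp add: VV HH)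
    have "transpose_mat (H * V) * (H * V) = transpose_mat V * (H * H) * V"
      unfolding T using H V VTc by (simp add: assoc_mult_mat[of _ n n _ n _ n])
    then show "transpose_mat (H * V) * (H * V) = 1\<^sub>m n" using VTc by (simp add: VV HH)
    have "H * (V * D * transpose_mat V) * H = H * V * D * (transpose_mat V * H)" if "D \<in> carrier_mat n n" for D
      using H V VTc that by (simp add: assoc_mult_mat[of _ n n _ n _ n])
    from this[OF Dc] show "A = H * V * ?D * transpose_mat (H * V)"
      unfolding T AA' VDV .
  qed (use H V in simp)
qed

text \<open>Orthonormality of the columns and completeness of the rows are both recorded: the former
  evaluates traces and quadratic forms, the latter yields Parseval's identity.\<close>

lemma symmetric_spectral_expansion:
  fixes A :: "real mat"
  assumes A: "A \<in> carrier_mat m m" and sym: "transpose_mat A = A"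
  obtains u :: "nat \<Rightarrow> nat \<Rightarrow> real" and l :: "nat \<Rightarrow> real"
  where "\<And>i j. i < m \<Longrightarrow> j < m \<Longrightarrow> (\<Sum>p<m. u i p * u j p) = (if i = j then 1 else 0)"
    and "\<And>p q. p < m \<Longrightarrow> q < m \<Longrightarrow> (\<Sum>i<m. u i p * u i q) = (if p = q then 1 else 0)"
    and "\<And>p q. p < m \<Longrightarrow> q < m \<Longrightarrow> A $$ (p, q) = (\<Sum>i<m. l i * u i p * u i q)"
    and "eigs_desc A = map l [0..<m]"
    and "\<And>i j. i \<le> j \<Longrightarrow> j < m \<Longrightarrow> l j \<le> l i"
proof -
  obtain es where es: "char_poly A = (\<Prod>e\<leftarrow>es. [:- e, 1:])" "length es = m" "sorted_wrt (\<ge>) es"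
    using symmetric_char_poly_splits[OF A sym] by blast
  obtain U where U: "U \<in> carrier_mat m m" "U * transpose_mat U = 1\<^sub>m m" "transpose_mat U * U = 1\<^sub>m m"
    and AU: "A = U * mat m m (\<lambda>(i, j). if i = j then es ! i else 0) * transpose_mat U"
    using symmetric_diagonalization[OF A sym es(1)] by blast
  let ?u = "\<lambda>i p. U $$ (p, i)"
  have 1: "(\<Sum>p<m. ?u i p * ?u j p) = (if i = j then 1 else 0)" if "i < m" "j < m" for i j
    using arg_cong[OF U(3), of "\<lambda>B. B $$ (i, j)"] U(1) that by (simp add: scalar_prod_def lessThan_atLeast0)
  have 2: "(\<Sum>i<m. ?u i p * ?u i q) = (if p = q then 1 else 0)" if "p < m" "q < m" for p q
    using arg_cong[OF U(2), of "\<lambda>B. B $$ (p, q)"] U(1) that by (simp add: scalar_prod_def lessThan_atLeast0)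
  have 3: "A $$ (p, q) = (\<Sum>i<m. es ! i * ?u i p * ?u i q)" if pq: "p < m" "q < m" for p q
  proof -
    have "A $$ (p, q) = (\<Sum>j<m. (\<Sum>i<m. ?u i p * (if i = j then es ! i else 0)) * ?u j q)"
      unfolding AU using U(1) pq by (simp add: scalar_prod_def lessThan_atLeast0)
    also have "\<dots> = (\<Sum>i<m. es ! i * ?u i p * ?u i q)"
      by (rule sum.cong) (auto simp: if_distrib[of "\<lambda>x. _ * x"] sum.delta mult_ac cong: if_cong)
    finally show ?thesis .
  qed
  have "eigs_desc A = map ((!) es) [0..<m]"
    using eigs_desc_eqI[OF es(1,3)] es(2) by (simp add: map_nth flip: es(2))
  moreover have "es ! j \<le> es ! i" if "i \<le> j" "j < m" for i j
    using that es(2,3) by (cases "i = j") (auto simp: sorted_wrt_iff_nth_less)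
  ultimately show ?thesis using that[of ?u "(!) es"] 1 2 3 by blast
qed

section \<open>Stacked indices, Kronecker products and traces\<close>

lemma div_mod_mult_add [simp]:
  fixes i s :: nat
  assumes "s < d"
  shows "(i * d + s) div d = i" "(i * d + s) mod d = s"
  using assms by auto

lemma mult_add_less:
  fixes i s :: nat
  assumes "i < a" "s < d"
  shows "i * d + s < a * d"
proof -
  have "i * d + s < (i + 1) * d" using assms by simp
  also have "\<dots> \<le> a * d" using assms by (intro mult_right_mono) auto
  finally show ?thesis .
qed

text \<open>An index p of a stacked vector encodes the pair of group \<open>p div d\<close> and
  coordinate \<open>p mod d\<close>. For d = 0 both sides are empty sums.\<close>

lemma sum_div_mod:
  fixes f :: "nat \<Rightarrow> nat \<Rightarrow> 'b :: comm_monoid_add"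
  shows "(\<Sum>p<a * d. f (p div d) (p mod d)) = (\<Sum>i<a. \<Sum>s<d. f i s)"
proof -
  have [simp]: "p mod d < d" if "p < a * d" for p
    using that by (cases "d = 0") auto
  have "(\<Sum>p<a * d. f (p div d) (p mod d)) = (\<Sum>(i, s)\<in>{..<a} \<times> {..<d}. f i s)"
    by (rule sum.reindex_bij_witness[of _ "\<lambda>(i, s). i * d + s" "\<lambda>p. (p div d, p mod d)"])
      (auto simp: mult_add_less less_mult_imp_div_less)
  then show ?thesis by (simp add: sum.cartesian_product)
qed

lemma kron_carrier [simp]:
  assumes "A \<in> carrier_mat a a" "B \<in> carrier_mat d d"
  shows "kron A B \<in> carrier_mat (a * d) (a * d)"
  using assms by (simp add: kron_def)

lemma kron_index:
  assumes "A \<in> carrier_mat a a" "B \<in> carrier_mat d d" "p < a * d" "q < a * d"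
  shows "kron A B $$ (p, q) = A $$ (p div d, q div d) * B $$ (p mod d, q mod d)"
  using assms by (simp add: kron_def)

lemma kron_mult:
  assumes "A \<in> carrier_mat a a" "A' \<in> carrier_mat a a" "B \<in> carrier_mat d d" "B' \<in> carrier_mat d d"
  shows "kron A B * kron A' B' = kron (A * A') (B * B')"
proof (rule eq_matI)
  fix p q assume "p < dim_row (kron (A * A') (B * B'))" "q < dim_col (kron (A * A') (B * B'))"
  then have pq: "p < a * d" "q < a * d" using assms by (auto simp: kron_def)
  then have d: "0 < d" by (auto intro: gr0I)
  have lt: "p div d < a" "q div d < a" "p mod d < d" "q mod d < d"
    using pq d by (auto simp: less_mult_imp_div_less)
  have "(kron A B * kron A' B') $$ (p, q) = (\<Sum>k<a * d. kron A B $$ (p, k) * kron A' B' $$ (k, q))"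
    using pq carrier_matD[OF kron_carrier[OF assms(1,3)]] carrier_matD[OF kron_carrier[OF assms(2,4)]]
    by (simp add: scalar_prod_def lessThan_atLeast0)
  also have "\<dots> = (\<Sum>k<a * d. (A $$ (p div d, k div d) * B $$ (p mod d, k mod d)) * (A' $$ (k div d, q div d) * B' $$ (k mod d, q mod d)))"
    by (rule sum.cong) (use pq assms in \<open>auto simp: kron_index[of _ a _ d]\<close>)
  also have "\<dots> = (\<Sum>i<a. \<Sum>s<d. (A $$ (p div d, i) * B $$ (p mod d, s)) * (A' $$ (i, q div d) * B' $$ (s, q mod d)))"
    by (rule sum_div_mod[of "\<lambda>i s. (A $$ (p div d, i) * B $$ (p mod d, s)) * (A' $$ (i, q div d) * B' $$ (s, q mod d))"])
  also have "\<dots> = (\<Sum>i<a. A $$ (p div d, i) * A' $$ (i, q div d)) * (\<Sum>s<d. B $$ (p mod d, s) * B' $$ (s, q mod d))"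
    by (simp add: sum_product mult_ac)
  also have "\<dots> = kron (A * A') (B * B') $$ (p, q)"
    using assms pq lt by (subst kron_index[of _ a _ d]) (auto simp: scalar_prod_def lessThan_atLeast0)
  finally show "(kron A B * kron A' B') $$ (p, q) = kron (A * A') (B * B') $$ (p, q)" .
qed (use assms in \<open>auto simp: kron_def\<close>)

lemma transpose_kron:
  assumes "A \<in> carrier_mat a a" "B \<in> carrier_mat d d"
  shows "transpose_mat (kron A B) = kron (transpose_mat A) (transpose_mat B)"
proof (rule eq_matI)
  fix p q assume "p < dim_row (kron (transpose_mat A) (transpose_mat B))" "q < dim_col (kron (transpose_mat A) (transpose_mat B))"
  then have pq: "p < a * d" "q < a * d" using assms by (auto simp: kron_def)
  then have "0 < d" by (auto intro: gr0I)
  then show "transpose_mat (kron A B) $$ (p, q) = kron (transpose_mat A) (transpose_mat B) $$ (p, q)"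
    using pq assms by (simp add: kron_def less_mult_imp_div_less)
qed (use assms in \<open>auto simp: kron_def\<close>)

lemma mtrace_kron:
  assumes "A \<in> carrier_mat a a" "B \<in> carrier_mat d d"
  shows "mtrace (kron A B) = mtrace A * mtrace B"
proof -
  have "mtrace (kron A B) = (\<Sum>p<a * d. A $$ (p div d, p div d) * B $$ (p mod d, p mod d))"
    using assms by (auto simp: mtrace_def kron_def)
  also have "\<dots> = mtrace A * mtrace B"
    using assms by (subst sum_div_mod[of "\<lambda>i s. A $$ (i, i) * B $$ (s, s)"]) (simp add: mtrace_def sum_product)
  finally show ?thesis .
qed

lemma mtrace_mult_comm:
  assumes "A \<in> carrier_mat n n" "B \<in> carrier_mat n n"
  shows "mtrace (A * B) = mtrace (B * A)"
proof -
  have "mtrace (A * B) = (\<Sum>i<n. \<Sum>j<n. A $$ (i, j) * B $$ (j, i))"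
    using assms by (simp add: mtrace_def scalar_prod_def lessThan_atLeast0)
  also have "\<dots> = (\<Sum>j<n. \<Sum>i<n. B $$ (j, i) * A $$ (i, j))"
    by (subst sum.swap) (simp add: mult.commute)
  also have "\<dots> = mtrace (B * A)"
    using assms by (simp add: mtrace_def scalar_prod_def lessThan_atLeast0)
  finally show ?thesis .
qed

text \<open>Cyclicity of the trace and P * P = P. The null mean and variance are written with
  one-sided products such as \<open>TS * S\<close>, whereas the eigenvalues belong to the symmetric
  two-sided product.\<close>

lemma mtrace_proj_sandwich:
  assumes P: "orth_proj n P" and A: "A \<in> carrier_mat n n"
  shows "mtrace (P * A * P) = mtrace (P * A)"
    and "mtrace ((P * A * P) * (P * A * P)) = mtrace ((P * A) * (P * A))"
proof -
  have Pc: "P \<in> carrier_mat n n" and PP: "P * P = P" using P by (auto simp: orth_proj_def)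
  note as = assoc_mult_mat[of _ n n _ n _ n]
  have "mtrace (P * A * P) = mtrace (P * (P * A))" using Pc A by (intro mtrace_mult_comm) auto
  also have "P * (P * A) = (P * P) * A" using Pc A by (simp add: as)
  finally show "mtrace (P * A * P) = mtrace (P * A)" by (simp add: PP)
  have "(P * A * P) * (P * A * P) = (P * A * (P * P) * A) * P" using Pc A by (simp add: as)
  then have "mtrace ((P * A * P) * (P * A * P)) = mtrace ((P * A * P * A) * P)" by (simp add: PP)
  also have "\<dots> = mtrace (P * (P * A * P * A))" using Pc A by (intro mtrace_mult_comm) auto
  also have "P * (P * A * P * A) = (P * P) * A * (P * A)" using Pc A by (simp add: as)
  finally show "mtrace ((P * A * P) * (P * A * P)) = mtrace ((P * A) * (P * A))" by (simp add: PP)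
qed

lemma orth_proj_kron:
  assumes "orth_proj a A" "orth_proj d B"
  shows "orth_proj (a * d) (kron A B)"
  using assms unfolding orth_proj_def by (auto simp: transpose_kron kron_mult)

text \<open>With V in Kronecker form, T V T is again a Kronecker product, and its traces factor into
  a part over groups and a part over coordinates.\<close>

lemma VN_eq_kron:
  assumes "S \<in> carrier_mat d d"
  shows "VN a d n S = kron (mat a a (\<lambda>(i, j). if i = j then real (totalN a n) / real (n i) else 0)) S"
proof (rule eq_matI)
  let ?D = "mat a a (\<lambda>(i, j). if i = j then real (totalN a n) / real (n i) else 0)"
  fix p q assume "p < dim_row (kron ?D S)" "q < dim_col (kron ?D S)"
  then have pq: "p < a * d" "q < a * d" using assms by (auto simp: kron_def)
  then show "VN a d n S $$ (p, q) = kron ?D S $$ (p, q)"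
    using assms by (simp add: VN_def kron_def less_mult_imp_div_less)
qed (use assms in \<open>auto simp: VN_def kron_def\<close>)

text \<open>This identifies the closed formulas for the null mean and variance with the first two
  spectral power sums, so that standardizing the form by them amounts to normalizing the
  eigenvalues.\<close>

lemma design_traces:
  fixes TW TS S :: "real mat" and n :: "nat \<Rightarrow> nat" and a d :: nat
  defines "A \<equiv> kron TW TS * VN a d n S * kron TW TS"
  assumes W: "orth_proj a TW" and TS: "orth_proj d TS" and S: "S \<in> carrier_mat d d"
  shows "EQ0 a n TW TS S = mtrace A" and "VarQ0 a n TW TS S = 2 * mtrace (A * A)"
proof -
  let ?D = "mat a a (\<lambda>(i, j). if i = j then real (totalN a n) / real (n i) else 0)"
  have c: "TW \<in> carrier_mat a a" "TS \<in> carrier_mat d d" "?D \<in> carrier_mat a a"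
    using W TS by (auto simp: orth_proj_def)
  have sym: "TW $$ (i, j) = TW $$ (j, i)" if "i < a" "j < a" for i j
    using W c(1) that unfolding orth_proj_def by (metis carrier_matD index_transpose_mat(1))
  have A: "A = kron (TW * ?D * TW) (TS * S * TS)"
    unfolding A_def VN_eq_kron[OF S] using c S by (simp add: kron_mult[of _ a _ _ d])
  have cc: "TW * ?D * TW \<in> carrier_mat a a" "TS * S * TS \<in> carrier_mat d d" using c S by auto
  have TD: "(TW * ?D) $$ (i, j) = TW $$ (i, j) * (real (totalN a n) / real (n j))" if "i < a" "j < a" for i j
  proof -
    have "(TW * ?D) $$ (i, j) = (\<Sum>k<a. if k = j then TW $$ (i, k) * (real (totalN a n) / real (n k)) else 0)"
      using that c by (simp add: scalar_prod_def lessThan_atLeast0 if_distrib[of "\<lambda>x. _ * x"] cong: if_cong)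
    then show ?thesis using that by (simp add: sum.delta)
  qed
  have "mtrace A = mtrace (TW * ?D) * mtrace (TS * S)"
    unfolding A mtrace_kron[OF cc] mtrace_proj_sandwich(1)[OF W c(3)] mtrace_proj_sandwich(1)[OF TS S] ..
  also have "mtrace (TW * ?D) = (\<Sum>i<a. real (totalN a n) / real (n i) * TW $$ (i, i))"
    using c TD by (simp add: mtrace_def mult.commute del: index_mult_mat(1))
  finally show "EQ0 a n TW TS S = mtrace A" by (simp add: EQ0_def)
  have "mtrace (A * A) = mtrace ((TW * ?D) * (TW * ?D)) * mtrace ((TS * S) * (TS * S))"
    unfolding A kron_mult[OF cc(1) cc(1) cc(2) cc(2)] 
    using cc by (simp add: mtrace_kron[of _ a _ d] mtrace_proj_sandwich(2)[OF W c(3)] mtrace_proj_sandwich(2)[OF TS S])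
  also have "mtrace ((TW * ?D) * (TW * ?D)) = (\<Sum>i<a. \<Sum>r<a. (TW * ?D) $$ (i, r) * (TW * ?D) $$ (r, i))"
    using c by (simp add: mtrace_def scalar_prod_def lessThan_atLeast0)
  also have "\<dots> = (\<Sum>i<a. \<Sum>r<a. (real (totalN a n))\<^sup>2 / (real (n i) * real (n r)) * (TW $$ (i, r))\<^sup>2)"
    by (intro sum.cong refl) (simp add: TD sym power2_eq_square mult_ac del: index_mult_mat(1))
  finally show "VarQ0 a n TW TS S = 2 * mtrace (A * A)" by (simp add: VarQ0_def)
qed

section \<open>Positivity of the covariance form and the eigensystem of the design\<close>

lemma VN_quadratic_form:
  fixes w :: "nat \<Rightarrow> real"
  shows "(\<Sum>p<a * d. \<Sum>q<a * d. w p * VN a d n S $$ (p, q) * w q)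
    = (\<Sum>i<a. real (totalN a n) / real (n i) * (\<Sum>s<d. \<Sum>t<d. w (i * d + s) * S $$ (s, t) * w (i * d + t)))"
proof -
  define c where "c = (\<lambda>i. real (totalN a n) / real (n i))"
  have "(\<Sum>p<a * d. \<Sum>q<a * d. w p * VN a d n S $$ (p, q) * w q)
      = (\<Sum>p<a * d. \<Sum>q<a * d. w (p div d * d + p mod d) * (if p div d = q div d then c (p div d) * S $$ (p mod d, q mod d) else 0) * w (q div d * d + q mod d))"
    by (intro sum.cong refl) (auto simp: VN_def c_def)
  also have "\<dots> = (\<Sum>i<a. \<Sum>s<d. \<Sum>q<a * d. w (i * d + s) * (if i = q div d then c i * S $$ (s, q mod d) else 0) * w (q div d * d + q mod d))"
    by (rule sum_div_mod[of "\<lambda>i s. \<Sum>q<a * d. w (i * d + s) * (if i = q div d then c i * S $$ (s, q mod d) else 0) * w (q div d * d + q mod d)"])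
  also have "\<dots> = (\<Sum>i<a. \<Sum>s<d. \<Sum>j<a. \<Sum>t<d. w (i * d + s) * (if i = j then c i * S $$ (s, t) else 0) * w (j * d + t))"
    by (intro sum.cong refl sum_div_mod[of "\<lambda>j t. w (_ * d + _) * (if _ = j then c _ * S $$ (_, t) else 0) * w (j * d + t)"])
  also have "\<dots> = (\<Sum>i<a. \<Sum>s<d. \<Sum>j<a. if i = j then \<Sum>t<d. w (i * d + s) * (c i * S $$ (s, t)) * w (j * d + t) else 0)"
    by (intro sum.cong refl) auto
  also have "\<dots> = (\<Sum>i<a. \<Sum>s<d. \<Sum>t<d. w (i * d + s) * (c i * S $$ (s, t)) * w (i * d + t))"
    by (simp add: sum.delta')
  finally show ?thesis by (simp add: c_def sum_distrib_left mult_ac)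
qed

lemma pos_def_quadratic:
  assumes S: "pos_def d S"
  shows "0 \<le> (\<Sum>s<d. \<Sum>t<d. w s * S $$ (s, t) * w t)"
    and "s < d \<Longrightarrow> w s \<noteq> 0 \<Longrightarrow> 0 < (\<Sum>s<d. \<Sum>t<d. w s * S $$ (s, t) * w t)"
proof -
  have c: "S \<in> carrier_mat d d" using S by (simp add: pos_def_def)
  have eq: "scalar_prod (vec d w) (S *\<^sub>v vec d w) = (\<Sum>s<d. \<Sum>t<d. w s * S $$ (s, t) * w t)"
    using c by (simp add: scalar_prod_def lessThan_atLeast0 sum_distrib_left mult_ac)
  have pos: "0 < (\<Sum>s<d. \<Sum>t<d. w s * S $$ (s, t) * w t)" if "vec d w \<noteq> 0\<^sub>v d"
    using S that unfolding eq[symmetric] pos_def_def by auto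
  show "0 < (\<Sum>s<d. \<Sum>t<d. w s * S $$ (s, t) * w t)" if "s < d" "w s \<noteq> 0"
  proof (rule pos)
    show "vec d w \<noteq> 0\<^sub>v d" using that by (metis index_vec index_zero_vec(1))
  qed
  show "0 \<le> (\<Sum>s<d. \<Sum>t<d. w s * S $$ (s, t) * w t)"
  proof (cases "vec d w = 0\<^sub>v d")
    case True
    then have "w s = 0" if "s < d" for s using that by (metis index_vec index_zero_vec(1))
    then show ?thesis by simp
  qed (use pos in force)
qed

lemma VN_quadratic_form_nonneg:
  fixes w :: "nat \<Rightarrow> real"
  assumes S: "pos_def d S"
  shows "0 \<le> (\<Sum>p<a * d. \<Sum>q<a * d. w p * VN a d n S $$ (p, q) * w q)"
  unfolding VN_quadratic_form by (intro sum_nonneg mult_nonneg_nonneg pos_def_quadratic[OF S]) auto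

text \<open>Strict positivity is what keeps the standardization from dividing by zero. Nonempty
  groups matter here: an empty one would give its block the coefficient 0.\<close>

lemma VN_quadratic_form_pos:
  fixes w :: "nat \<Rightarrow> real"
  assumes S: "pos_def d S" and n: "\<And>i. i < a \<Longrightarrow> n i \<ge> 1" and p: "p < a * d" "w p \<noteq> 0"
  shows "0 < (\<Sum>p<a * d. \<Sum>q<a * d. w p * VN a d n S $$ (p, q) * w q)"
proof -
  have d: "0 < d" using p by (auto intro: gr0I)
  have i: "p div d < a" using p by (simp add: less_mult_imp_div_less)
  have "n (p div d) \<le> totalN a n" unfolding totalN_def using i by (intro member_le_sum) auto
  then have N: "0 < totalN a n" using n[OF i] by simp
  have pos: "0 < (\<Sum>s<d. \<Sum>t<d. w (p div d * d + s) * S $$ (s, t) * w (p div d * d + t))"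
    by (rule pos_def_quadratic(2)[OF S, of "p mod d" "\<lambda>s. w (p div d * d + s)"]) (use p d in auto)
  show ?thesis
    unfolding VN_quadratic_form
  proof (rule sum_pos2[of _ "p div d"])
    show "0 < real (totalN a n) / real (n (p div d)) *
        (\<Sum>s<d. \<Sum>t<d. w (p div d * d + s) * S $$ (s, t) * w (p div d * d + t))"
      using pos N n[OF i] by (intro mult_pos_pos) auto
  qed (use i in \<open>auto intro!: mult_nonneg_nonneg divide_nonneg_nonneg pos_def_quadratic(1)[OF S]\<close>)
qed

text \<open>The u i form an orthonormal eigenbasis of T V T with eigenvalues l i, where T is the Kronecker product
  and V the block diagonal matrix VN; the second clause says that h = (SUM i. g i * u i) satisfies
  (T h) . V (T h) = (SUM i. l i * (g i)^2).\<close>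
definition design_eigensystem ::
    "nat \<Rightarrow> nat \<Rightarrow> (nat \<Rightarrow> nat) \<Rightarrow> real mat \<Rightarrow> real mat \<Rightarrow> real mat \<Rightarrow> (nat \<Rightarrow> nat \<Rightarrow> real) \<Rightarrow> (nat \<Rightarrow> real) \<Rightarrow> bool" where
  "design_eigensystem a d n TW TS S u l \<longleftrightarrow>
     (\<forall>p<a * d. \<forall>q<a * d. (\<Sum>i<a * d. u i p * u i q) = (if p = q then 1 else 0)) \<and>
     (\<forall>g w. (\<forall>p<a * d. w p = (\<Sum>q<a * d. kron TW TS $$ (p, q) * (\<Sum>i<a * d. g i * u i q))) \<longrightarrow>
        (\<Sum>p<a * d. \<Sum>q<a * d. w p * VN a d n S $$ (p, q) * w q) = (\<Sum>i<a * d. l i * (g i)\<^sup>2)) \<and>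
     (\<forall>i j. i \<le> j \<longrightarrow> j < a * d \<longrightarrow> l j \<le> l i) \<and>
     (\<forall>i<a * d. 0 \<le> l i) \<and>
     0 < (\<Sum>i<a * d. (l i)\<^sup>2) \<and>
     EQ0 a n TW TS S = (\<Sum>i<a * d. l i) \<and>
     VarQ0 a n TW TS S = 2 * (\<Sum>i<a * d. (l i)\<^sup>2) \<and>
     (\<forall>s. beta a d n TW TS S s = (if s < a * d then l s / sqrt (\<Sum>i<a * d. (l i)\<^sup>2) else 0))"

text \<open>Beyond linear algebra, the point is that some eigenvalue is positive: T has a nonzero
  entry, hence by completeness T does not annihilate every eigenvector, and V is positive definite
  on the image that remains.\<close>

lemma design_spectral:
  fixes TW TS S :: "real mat" and n :: "nat \<Rightarrow> nat" and a d :: nat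
  assumes W: "orth_proj a TW" "TW \<noteq> 0\<^sub>m a a" and TS: "orth_proj d TS" "TS \<noteq> 0\<^sub>m d d"
    and S: "pos_def d S" and n: "\<And>i. i < a \<Longrightarrow> n i \<ge> 1"
  obtains u l where "design_eigensystem a d n TW TS S u l"
proof -
  define T where "T = kron TW TS"
  define m where "m = a * d"
  have Sc: "S \<in> carrier_mat d d" "transpose_mat S = S" using S by (auto simp: pos_def_def)
  have T: "orth_proj m T" unfolding T_def m_def using W TS by (intro orth_proj_kron) auto
  then have Tc: "T \<in> carrier_mat m m" and TT: "transpose_mat T = T" by (auto simp: orth_proj_def)
  have Tsym: "T $$ (p, q) = T $$ (q, p)" if "p < m" "q < m" for p q
    using TT Tc that by (metis carrier_matD index_transpose_mat(1))
  define V where "V = VN a d n S"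
  have Vc: "V \<in> carrier_mat m m" by (simp add: V_def VN_def m_def)
  have VT: "transpose_mat V = V"
    unfolding V_def VN_eq_kron[OF Sc(1)]
    by (subst transpose_kron[of _ a _ d]) (use Sc in \<open>auto intro!: arg_cong2[of _ _ _ _ kron] eq_matI\<close>)
  define A where "A = T * V * T"
  have Ac: "A \<in> carrier_mat m m" using Tc Vc by (simp add: A_def)
  have AT: "transpose_mat A = A"
    using Tc Vc by (simp add: A_def transpose_mult[of _ m m _ m] TT VT assoc_mult_mat[of _ m m _ m _ m])
  obtain u l where on: "\<And>i j. i < m \<Longrightarrow> j < m \<Longrightarrow> (\<Sum>p<m. u i p * u j p) = (if i = j then 1 else 0)"
    and comp: "\<And>p q. p < m \<Longrightarrow> q < m \<Longrightarrow> (\<Sum>i<m. u i p * u i q) = (if p = q then 1 else 0)"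
    and Al: "\<And>p q. p < m \<Longrightarrow> q < m \<Longrightarrow> A $$ (p, q) = (\<Sum>i<m. l i * u i p * u i q)"
    and eigs: "eigs_desc A = map l [0..<m]"
    and anti: "\<And>i j. i \<le> j \<Longrightarrow> j < m \<Longrightarrow> l j \<le> l i"
    using symmetric_spectral_expansion[OF Ac AT] by blast
  have Aindex: "A $$ (p, q) = (\<Sum>r<m. \<Sum>r'<m. T $$ (r, p) * V $$ (r, r') * T $$ (r', q))" if "p < m" "q < m" for p q
  proof -
    have "A $$ (p, q) = (\<Sum>r<m. T $$ (p, r) * (\<Sum>r'<m. V $$ (r, r') * T $$ (r', q)))"
      using that Tc Vc by (simp add: A_def scalar_prod_def lessThan_atLeast0)
    also have "\<dots> = (\<Sum>r<m. \<Sum>r'<m. T $$ (r, p) * V $$ (r, r') * T $$ (r', q))"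
      by (simp add: sum_distrib_left Tsym[OF that(1)] mult.assoc)
    finally show ?thesis .
  qed
  have quad: "(\<Sum>p<m. \<Sum>q<m. w p * V $$ (p, q) * w q) = (\<Sum>i<m. l i * (g i)\<^sup>2)"
    if w: "\<And>p. p < m \<Longrightarrow> w p = (\<Sum>q<m. T $$ (p, q) * (\<Sum>i<m. g i * u i q))" for g w
  proof -
    define h where "h = (\<lambda>q. \<Sum>i<m. g i * u i q)"
    \<comment> \<open>The interchanges turn (T h) . V (T h) into h . A h. The spectral expansion of
      A reduces this to the squares of u i . h, and u i . h = g i by orthonormality.\<close>
    have "(\<Sum>p<m. \<Sum>q<m. w p * V $$ (p, q) * w q)
      = (\<Sum>p<m. \<Sum>q<m. (\<Sum>r<m. T $$ (p, r) * h r) * V $$ (p, q) * (\<Sum>r'<m. T $$ (q, r') * h r'))"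
      by (intro sum.cong refl) (simp add: w h_def)
    also have "\<dots> = (\<Sum>p<m. \<Sum>q<m. \<Sum>r<m. \<Sum>r'<m. h r * (T $$ (p, r) * V $$ (p, q) * T $$ (q, r')) * h r')"
      by (simp add: sum_distrib_left sum_distrib_right mult_ac)
    also have "\<dots> = (\<Sum>p<m. \<Sum>r<m. \<Sum>q<m. \<Sum>r'<m. h r * (T $$ (p, r) * V $$ (p, q) * T $$ (q, r')) * h r')"
      by (intro sum.cong refl sum.swap)
    also have "\<dots> = (\<Sum>r<m. \<Sum>p<m. \<Sum>q<m. \<Sum>r'<m. h r * (T $$ (p, r) * V $$ (p, q) * T $$ (q, r')) * h r')"
      by (rule sum.swap)
    also have "\<dots> = (\<Sum>r<m. \<Sum>p<m. \<Sum>r'<m. \<Sum>q<m. h r * (T $$ (p, r) * V $$ (p, q) * T $$ (q, r')) * h r')"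
      by (intro sum.cong refl sum.swap)
    also have "\<dots> = (\<Sum>r<m. \<Sum>r'<m. \<Sum>p<m. \<Sum>q<m. h r * (T $$ (p, r) * V $$ (p, q) * T $$ (q, r')) * h r')"
      by (intro sum.cong refl sum.swap)
    also have "\<dots> = (\<Sum>r<m. \<Sum>r'<m. h r * A $$ (r, r') * h r')"
      by (intro sum.cong refl) (simp add: Aindex sum_distrib_left sum_distrib_right)
    also have "\<dots> = (\<Sum>r<m. \<Sum>r'<m. \<Sum>i<m. l i * (u i r * h r) * (u i r' * h r'))"
      by (intro sum.cong refl) (simp add: Al sum_distrib_left sum_distrib_right mult_ac)
    also have "\<dots> = (\<Sum>r<m. \<Sum>i<m. \<Sum>r'<m. l i * (u i r * h r) * (u i r' * h r'))"
      by (intro sum.cong refl sum.swap)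
    also have "\<dots> = (\<Sum>i<m. \<Sum>r<m. \<Sum>r'<m. l i * (u i r * h r) * (u i r' * h r'))"
      by (rule sum.swap)
    also have "\<dots> = (\<Sum>i<m. l i * (\<Sum>r<m. u i r * h r)\<^sup>2)"
      by (simp add: power2_eq_square sum_product sum_distrib_left mult_ac)
    also have "\<dots> = (\<Sum>i<m. l i * (g i)\<^sup>2)"
    proof (intro sum.cong refl)
      fix i assume i: "i \<in> {..<m}"
      have "(\<Sum>r<m. u i r * h r) = (\<Sum>r<m. \<Sum>j<m. g j * (u i r * u j r))"
        by (simp add: h_def sum_distrib_left mult_ac)
      also have "\<dots> = (\<Sum>j<m. g j * (\<Sum>r<m. u i r * u j r))"
        by (subst sum.swap) (simp add: sum_distrib_left)
      also have "\<dots> = (\<Sum>j<m. if i = j then g j else 0)"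
        using i by (intro sum.cong refl) (simp add: on)
      also have "\<dots> = g i" using i by (simp add: sum.delta')
      finally show "l i * (\<Sum>r<m. u i r * h r)\<^sup>2 = l i * (g i)\<^sup>2" by simp
    qed
    finally show ?thesis .
  qed
  \<comment> \<open>Taking for g the indicator of i exhibits the eigenvalue as the V-form of T
    applied to u i, from which its sign can be read off.\<close>
  have li: "(\<Sum>p<m. \<Sum>q<m. (\<Sum>r<m. T $$ (p, r) * u i r) * V $$ (p, q) * (\<Sum>r<m. T $$ (q, r) * u i r)) = l i"
    if i: "i < m" for i
  proof -
    have ui: "u i q = (\<Sum>j<m. (if j = i then 1 else 0) * u j q)" for q
      using i by (simp add: if_distrib[of "\<lambda>x. x * _"] sum.delta cong: if_cong)
    have "(\<Sum>p<m. \<Sum>q<m. (\<Sum>r<m. T $$ (p, r) * u i r) * V $$ (p, q) * (\<Sum>r<m. T $$ (q, r) * u i r))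
       = (\<Sum>j<m. l j * (if j = i then 1 else 0)\<^sup>2)"
      by (rule quad) (subst ui, rule refl)
    also have "\<dots> = (\<Sum>j<m. if j = i then l j else 0)" by (intro sum.cong) auto
    also have "\<dots> = l i" using i by (simp add: sum.delta)
    finally show ?thesis .
  qed
  have lpos: "0 \<le> l i" if "i < m" for i
    unfolding li[OF that, symmetric] V_def m_def by (rule VN_quadratic_form_nonneg[OF S])
  obtain p q where pq: "p < m" "q < m" "T $$ (p, q) \<noteq> 0"
  proof -
    have "\<exists>i j. i < k \<and> j < k \<and> B $$ (i, j) \<noteq> 0" if "orth_proj k B" "B \<noteq> 0\<^sub>m k k" for k and B :: "real mat"
    proof (rule ccontr)
      assume "\<not> ?thesis"
      then have "B = 0\<^sub>m k k" using that(1) unfolding orth_proj_def by (intro eq_matI) auto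
      then show False using that by simp
    qed
    from this[OF W] this[OF TS] obtain i j s t where ij: "i < a" "j < a" "TW $$ (i, j) \<noteq> 0"
      "s < d" "t < d" "TS $$ (s, t) \<noteq> 0" by blast
    have "T $$ (i * d + s, j * d + t) = TW $$ (i, j) * TS $$ (s, t)"
      unfolding T_def using W TS ij by (subst kron_index[of _ a _ d]) (auto simp: orth_proj_def mult_add_less)
    then show ?thesis using that[of "i * d + s" "j * d + t"] ij by (simp add: m_def mult_add_less)
  qed
  have "\<exists>i<m. (\<Sum>r<m. T $$ (p, r) * u i r) \<noteq> 0"
  proof (rule ccontr)
    assume no: "\<not> ?thesis"
    \<comment> \<open>Inserting the completeness relation writes this entry in terms of the p-th
      coordinates of all T u i, which are assumed to vanish.\<close>
    have "T $$ (p, q) = (\<Sum>r<m. T $$ (p, r) * (\<Sum>i<m. u i r * u i q))"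
      using pq by (simp add: comp if_distrib[of "\<lambda>x. _ * x"] sum.delta cong: if_cong)
    also have "\<dots> = (\<Sum>r<m. \<Sum>i<m. T $$ (p, r) * u i r * u i q)"
      by (simp add: sum_distrib_left mult_ac)
    also have "\<dots> = (\<Sum>i<m. (\<Sum>r<m. T $$ (p, r) * u i r) * u i q)"
      by (subst sum.swap) (simp add: sum_distrib_right)
    also have "\<dots> = 0" using no by simp
    finally show False using pq by simp
  qed
  then obtain i where i: "i < m" "(\<Sum>r<m. T $$ (p, r) * u i r) \<noteq> 0" by blast
  have "0 < l i" unfolding li[OF i(1), symmetric] V_def unfolding m_def
    by (rule VN_quadratic_form_pos[OF S n, where p = p]) (use pq i in \<open>auto simp: m_def\<close>)
  then have l2: "0 < (\<Sum>i<m. (l i)\<^sup>2)" using i by (intro sum_pos2[of _ i]) auto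
  have tr1: "mtrace A = (\<Sum>i<m. l i)"
  proof -
    have "mtrace A = (\<Sum>p<m. \<Sum>i<m. l i * (u i p * u i p))" using Ac by (simp add: mtrace_def Al mult_ac)
    also have "\<dots> = (\<Sum>i<m. l i * (\<Sum>p<m. u i p * u i p))" by (subst sum.swap) (simp add: sum_distrib_left)
    also have "\<dots> = (\<Sum>i<m. l i)" by (intro sum.cong) (auto simp: on)
    finally show ?thesis .
  qed
  have tr2: "mtrace (A * A) = (\<Sum>i<m. (l i)\<^sup>2)"
  proof -
    have Au: "(\<Sum>q<m. A $$ (p, q) * u i q) = l i * u i p" if "p < m" "i < m" for p i
    proof -
      have "(\<Sum>q<m. A $$ (p, q) * u i q) = (\<Sum>q<m. \<Sum>j<m. l j * u j p * (u j q * u i q))"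
        using that by (simp add: Al sum_distrib_left sum_distrib_right mult_ac)
      also have "\<dots> = (\<Sum>j<m. l j * u j p * (\<Sum>q<m. u j q * u i q))"
        by (subst sum.swap) (simp add: sum_distrib_left)
      also have "\<dots> = (\<Sum>j<m. if j = i then l j * u j p else 0)"
        using that by (intro sum.cong refl) (simp add: on)
      finally show ?thesis using that by (simp add: sum.delta)
    qed
    have "mtrace (A * A) = (\<Sum>p<m. \<Sum>q<m. A $$ (p, q) * A $$ (q, p))"
      using Ac by (simp add: mtrace_def scalar_prod_def lessThan_atLeast0)
    also have "\<dots> = (\<Sum>p<m. \<Sum>q<m. \<Sum>i<m. l i * u i p * (A $$ (p, q) * u i q))"
    proof (intro sum.cong refl)
      fix p q assume "p \<in> {..<m}" "q \<in> {..<m}"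
      then show "A $$ (p, q) * A $$ (q, p) = (\<Sum>i<m. l i * u i p * (A $$ (p, q) * u i q))"
        by (subst (2) Al) (simp_all add: sum_distrib_left mult_ac)
    qed
    also have "\<dots> = (\<Sum>p<m. \<Sum>i<m. \<Sum>q<m. l i * u i p * (A $$ (p, q) * u i q))"
      by (intro sum.cong refl sum.swap)
    also have "\<dots> = (\<Sum>p<m. \<Sum>i<m. l i * u i p * (l i * u i p))"
      by (intro sum.cong refl) (simp add: Au flip: sum_distrib_left)
    also have "\<dots> = (\<Sum>i<m. (l i)\<^sup>2 * (\<Sum>p<m. u i p * u i p))"
      by (subst sum.swap) (simp add: sum_distrib_left power2_eq_square mult_ac)
    also have "\<dots> = (\<Sum>i<m. (l i)\<^sup>2)" by (intro sum.cong) (auto simp: on)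
    finally show ?thesis .
  qed
  have E: "EQ0 a n TW TS S = (\<Sum>i<m. l i)" "VarQ0 a n TW TS S = 2 * (\<Sum>i<m. (l i)\<^sup>2)"
    using design_traces[OF W(1) TS(1) Sc(1), of n] tr1 tr2 by (simp_all add: A_def T_def V_def)
  have beta: "beta a d n TW TS S s = (if s < m then l s / sqrt (\<Sum>i<m. (l i)\<^sup>2) else 0)" for s
  proof -
    have "(\<Sum>x\<leftarrow>map l [0..<m]. x\<^sup>2) = (\<Sum>i<m. (l i)\<^sup>2)"
      by (simp add: sum_list_distinct_conv_sum_set o_def lessThan_atLeast0)
    then show ?thesis
      unfolding beta_def Let_def using eigs by (simp add: A_def T_def V_def)
  qed
  have "design_eigensystem a d n TW TS S u l"
    unfolding design_eigensystem_def m_def[symmetric] T_def[symmetric] V_def[symmetric]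
    using comp anti lpos l2 E beta by (intro conjI allI impI quad) simp_all
  then show ?thesis by (rule that)
qed

section \<open>Laplace transforms of Gaussian quadratic forms\<close>

text \<open>Induction on j by u^k (1 - u)^(j + 1) = u^k (1 - u)^j - u^(k + 1) (1 - u)^j. These
  products are the Bernstein basis, so moments determine the expectations of Bernstein
  polynomials.\<close>

lemma (in prob_space) bernstein_monomial_expectation_eq:
  assumes N: "prob_space N" and [measurable]: "U \<in> borel_measurable M" "V \<in> borel_measurable N"
    and U: "\<And>x. U x \<in> {0..1::real}" and V: "\<And>x. V x \<in> {0..1::real}"
    and mom: "\<And>n :: nat. expectation (\<lambda>x. U x ^ n) = (LINT x|N. V x ^ n)"
  shows "expectation (\<lambda>x. U x ^ k * (1 - U x) ^ j) = (LINT x|N. V x ^ k * (1 - V x) ^ j)"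
proof (induction j arbitrary: k)
  case 0
  then show ?case by (simp add: mom)
next
  case (Suc j)
  interpret N: prob_space N by fact
  have iU: "integrable M (\<lambda>x. U x ^ k * (1 - U x) ^ j)" for k j
    using U by (intro integrable_const_bound[of _ 1]) (auto intro!: mult_le_one power_le_one simp: abs_mult power_abs)
  have iV: "integrable N (\<lambda>x. V x ^ k * (1 - V x) ^ j)" for k j
    using V by (intro N.integrable_const_bound[of _ 1]) (auto intro!: mult_le_one power_le_one simp: abs_mult power_abs)
  have "expectation (\<lambda>x. U x ^ k * (1 - U x) ^ Suc j)
      = expectation (\<lambda>x. U x ^ k * (1 - U x) ^ j - U x ^ Suc k * (1 - U x) ^ j)"
    by (intro Bochner_Integration.integral_cong) (auto simp: algebra_simps)
  also have "\<dots> = (LINT x|N. V x ^ k * (1 - V x) ^ j - V x ^ Suc k * (1 - V x) ^ j)"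
    unfolding Bochner_Integration.integral_diff[OF iU iU] Bochner_Integration.integral_diff[OF iV iV] Suc ..
  also have "\<dots> = (LINT x|N. V x ^ k * (1 - V x) ^ Suc j)"
    by (intro Bochner_Integration.integral_cong) (auto simp: algebra_simps)
  finally show ?case .
qed

text \<open>Uniqueness in the Hausdorff moment problem. Bernstein approximation is uniform on [0, 1]
  and passes from moments to continuous functions; cosine and sine then give the characteristic
  function.\<close>

lemma (in prob_space) distr_eqI_moments_unit_interval:
  assumes N: "prob_space N" and U [measurable]: "U \<in> borel_measurable M" and V [measurable]: "V \<in> borel_measurable N"
    and U01: "\<And>x. U x \<in> {0..1::real}" and V01: "\<And>x. V x \<in> {0..1::real}"
    and mom: "\<And>n :: nat. expectation (\<lambda>x. U x ^ n) = (LINT x|N. V x ^ n)"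
  shows "distr M borel U = distr N borel V"
proof -
  interpret N: prob_space N by fact
  have cont: "expectation (\<lambda>x. f (U x)) = (LINT x|N. f (V x))"
    if f: "continuous_on UNIV f" for f :: "real \<Rightarrow> real"
  proof -
    have [measurable]: "f \<in> borel_measurable borel" by (rule borel_measurable_continuous_onI[OF f])
    have "compact (f ` {0..1})" by (intro compact_continuous_image continuous_on_subset[OF f]) auto
    then obtain K where K: "\<And>x. x \<in> {0..1} \<Longrightarrow> norm (f x) \<le> K"
      by (meson compact_imp_bounded bounded_iff imageI)
    have iU: "integrable M (\<lambda>x. f (U x))" using K U01 by (intro integrable_const_bound[of _ K]) auto
    have iV: "integrable N (\<lambda>x. f (V x))" using K V01 by (intro N.integrable_const_bound[of _ K]) auto
    have close: "\<bar>expectation (\<lambda>x. f (U x)) - (LINT x|N. f (V x))\<bar> \<le> 2 * e" if e: "e > 0" for e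
    proof -
      obtain n where n: "\<And>x. x \<in> {0..1} \<Longrightarrow> \<bar>f x - (\<Sum>k\<le>n. f (k / n) * Bernstein n k x)\<bar> < e"
        using Bernstein_Weierstrass[OF continuous_on_subset[OF f] e] by blast
      define B where "B = (\<lambda>x. \<Sum>k\<le>n. (f (k / n) * real (n choose k)) * (x ^ k * (1 - x) ^ (n - k)))"
      have Bf: "\<bar>f x - B x\<bar> \<le> e" if "x \<in> {0..1}" for x
        using n[OF that] by (simp add: B_def Bernstein_def mult.assoc)
      have [measurable]: "B \<in> borel_measurable borel" unfolding B_def by measurable
      have pU: "integrable M (\<lambda>x. U x ^ k * (1 - U x) ^ j)" for k j
        using U01 by (intro integrable_const_bound[of _ 1]) (auto intro!: mult_le_one power_le_one simp: abs_mult power_abs)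
      have pV: "integrable N (\<lambda>x. V x ^ k * (1 - V x) ^ j)" for k j
        using V01 by (intro N.integrable_const_bound[of _ 1]) (auto intro!: mult_le_one power_le_one simp: abs_mult power_abs)
      have BU: "integrable M (\<lambda>x. B (U x))" and BV: "integrable N (\<lambda>x. B (V x))"
        unfolding B_def using pU pV by auto
      have eq: "expectation (\<lambda>x. B (U x)) = (LINT x|N. B (V x))"
        unfolding B_def using pU pV
        by (simp add: Bochner_Integration.integral_sum bernstein_monomial_expectation_eq[OF N U V U01 V01 mom])
      have "\<bar>expectation (\<lambda>x. f (U x)) - expectation (\<lambda>x. B (U x))\<bar> \<le> expectation (\<lambda>x. \<bar>f (U x) - B (U x)\<bar>)"
        unfolding Bochner_Integration.integral_diff[OF iU BU, symmetric] by (rule integral_abs_bound)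
      also have "\<dots> \<le> e"
        using Bf U01 iU BU by (intro integral_le_const) auto
      finally have 1: "\<bar>expectation (\<lambda>x. f (U x)) - expectation (\<lambda>x. B (U x))\<bar> \<le> e" .
      have "\<bar>(LINT x|N. f (V x)) - (LINT x|N. B (V x))\<bar> \<le> (LINT x|N. \<bar>f (V x) - B (V x)\<bar>)"
        unfolding Bochner_Integration.integral_diff[OF iV BV, symmetric] by (rule integral_abs_bound)
      also have "\<dots> \<le> e"
        using Bf V01 iV BV by (intro N.integral_le_const) auto
      finally show ?thesis using 1 eq by linarith
    qed
    have "\<bar>expectation (\<lambda>x. f (U x)) - (LINT x|N. f (V x))\<bar> \<le> 0"
    proof (rule field_le_epsilon)
      fix e :: real assume "e > 0"
      then show "\<bar>expectation (\<lambda>x. f (U x)) - (LINT x|N. f (V x))\<bar> \<le> 0 + e" using close[of "e / 2"] by simp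
    qed
    then show ?thesis by simp
  qed
  have charU: "char (distr M borel U) t = Complex (expectation (\<lambda>x. cos (t * U x))) (expectation (\<lambda>x. sin (t * U x)))" for t
  proof -
    have i: "integrable M (\<lambda>x. iexp (t * U x))" by (intro integrable_iexp) auto
    have "char (distr M borel U) t = (CLINT x|M. iexp (t * U x))" by (simp add: char_def integral_distr)
    then show ?thesis using integral_Re[OF i] integral_Im[OF i] by (simp add: complex_eq_iff Re_exp Im_exp)
  qed
  have charV: "char (distr N borel V) t = Complex (LINT x|N. cos (t * V x)) (LINT x|N. sin (t * V x))" for t
  proof -
    have i: "integrable N (\<lambda>x. iexp (t * V x))" by (intro N.integrable_iexp) auto
    have "char (distr N borel V) t = (CLINT x|N. iexp (t * V x))" by (simp add: char_def integral_distr)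
    then show ?thesis using integral_Re[OF i] integral_Im[OF i] by (simp add: complex_eq_iff Re_exp Im_exp)
  qed
  have "char (distr M borel U) = char (distr N borel V)"
    by (rule ext) (simp add: charU charV cont[of "\<lambda>x. cos (_ * x)"] cont[of "\<lambda>x. sin (_ * x)"] continuous_intros)
  then show ?thesis
    by (intro Levy_uniqueness real_distribution_distr N.real_distribution_distr) auto
qed

text \<open>The variable exp (- X) takes values in the unit interval, and its n-th moment is the
  Laplace transform of X at n. Its law determines that of X through - ln.\<close>

lemma (in prob_space) distr_eqI_laplace:
  assumes N: "prob_space N" and X [measurable]: "X \<in> borel_measurable M" and Y [measurable]: "Y \<in> borel_measurable N"
    and X0: "\<And>x. 0 \<le> X x" and Y0: "\<And>x. 0 \<le> (Y x :: real)"
    and eq: "\<And>s :: real. 0 \<le> s \<Longrightarrow> expectation (\<lambda>x. exp (- s * X x)) = (LINT x|N. exp (- s * Y x))"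
  shows "distr M borel X = distr N borel Y"
proof -
  have "distr M borel (\<lambda>x. exp (- X x)) = distr N borel (\<lambda>x. exp (- Y x))"
  proof (rule distr_eqI_moments_unit_interval[OF N])
    show "expectation (\<lambda>x. exp (- X x) ^ n) = (LINT x|N. exp (- Y x) ^ n)" for n
      using eq[of "real n"] by (simp add: exp_of_nat_mult[symmetric])
  qed (use X0 Y0 in auto)
  then have "distr (distr M borel (\<lambda>x. exp (- X x))) borel (\<lambda>u. - ln u) = distr (distr N borel (\<lambda>x. exp (- Y x))) borel (\<lambda>u. - ln u)"
    by simp
  then show ?thesis by (subst (asm) (1 2) distr_distr) (auto simp: o_def)
qed

text \<open>Multiplying the standard normal density by exp (- c x^2) gives 1 / r times a centred
  normal density of standard deviation 1 / r, where r^2 = 1 + 2 c.\<close>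

lemma std_normal_laplace_square:
  assumes c: "0 \<le> c"
  shows "has_bochner_integral std_normal_distribution (\<lambda>x. exp (- c * x\<^sup>2)) (1 / sqrt (1 + 2 * c))"
proof -
  define r where "r = sqrt (1 + 2 * c)"
  have r: "r > 0" "r\<^sup>2 = 1 + 2 * c" using c by (auto simp: r_def)
  have eq: "std_normal_density x * exp (- c * x\<^sup>2) = normal_density 0 (1 / r) x * (1 / r)" for x
  proof -
    have "std_normal_density x * exp (- c * x\<^sup>2) = 1 / sqrt (2 * pi) * exp (- x\<^sup>2 / 2 + - c * x\<^sup>2)"
      unfolding std_normal_density_def exp_add by simp
    also have "- x\<^sup>2 / 2 + - c * x\<^sup>2 = - r\<^sup>2 * x\<^sup>2 / 2" by (simp add: r field_simps)
    finally show ?thesis using r(1)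
      by (simp add: normal_density_def power_divide real_sqrt_divide field_simps)
  qed
  have "has_bochner_integral lborel (\<lambda>x. normal_density 0 (1 / r) x * (1 / r)) (1 * (1 / r))"
    using r(1) by (intro has_bochner_integral_mult_left) (simp add: has_bochner_integral_iff)
  then show ?thesis unfolding r_def[symmetric]
    by (intro has_bochner_integral_density) (auto simp only: real_scaleR_def eq mult_1 borel_measurable_normal_density normal_density_nonneg AE_I2, measurable)
qed

text \<open>Each square is linearised by an auxiliary Gaussian variable, exp (- s y^2) = E exp (i sqrt (2 s) g y);
  hence the Laplace transform of the sum of squares only involves linear combinations of the Y i, and no
  multivariate uniqueness theorem is needed.\<close>
lemma (in prob_space) laplace_sum_squares:
  fixes Y :: "nat \<Rightarrow> 'a \<Rightarrow> real"
  assumes Y [measurable]: "\<And>i. i < m \<Longrightarrow> Y i \<in> borel_measurable M"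
    and char: "\<And>g. (CLINT x|M. iexp (\<Sum>i<m. g i * Y i x)) = exp (- (\<Sum>i<m. l i * (g i)\<^sup>2) / 2)"
    and l: "\<And>i. i < m \<Longrightarrow> 0 \<le> l i" and s: "0 \<le> s"
  shows "expectation (\<lambda>x. exp (- s * (\<Sum>i<m. (Y i x)\<^sup>2)))
    = (\<Prod>i<m. LINT x|std_normal_distribution. exp (- (s * l i) * x\<^sup>2))"
proof -
  interpret g: prob_space std_normal_distribution
    using real_dist_normal_dist by (simp add: real_distribution_def)
  interpret G: product_prob_space "\<lambda>_. std_normal_distribution" "{..<m}" ..
  let ?G = "PiM {..<m} (\<lambda>_. std_normal_distribution)"
  have sG: "sets ?G = sets (PiM {..<m} (\<lambda>_. borel))" by (intro sets_PiM_cong) auto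
  interpret pair: pair_prob_space M ?G ..
  define r where "r = sqrt (2 * s)"
  have r2: "r\<^sup>2 = 2 * s" using s by (simp add: r_def)
  have comp [measurable]: "(\<lambda>h. h i) \<in> borel_measurable ?G" if "i < m" for i
    using that by (subst measurable_cong_sets[OF sG refl]) measurable
  have lin: "of_real (exp (- s * (\<Sum>i<m. (y i)\<^sup>2))) = (CLINT h|?G. iexp (\<Sum>i<m. (r * h i) * y i))" for y :: "nat \<Rightarrow> real"
  proof -
    have "(CLINT h|?G. iexp (\<Sum>i<m. (r * h i) * y i)) = (CLINT h|?G. (\<Prod>i<m. iexp ((r * y i) * h i)))"
      by (intro Bochner_Integration.integral_cong)
        (simp_all add: exp_sum[symmetric] sum_distrib_left mult_ac)
    also have "\<dots> = (\<Prod>i<m. CLINT x|std_normal_distribution. iexp ((r * y i) * x))"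
      by (rule G.product_integral_prod) (auto intro!: g.integrable_iexp)
    also have "\<dots> = (\<Prod>i<m. complex_of_real (exp (- (s * (y i)\<^sup>2))))"
    proof (intro prod.cong refl)
      fix i
      show "(CLINT x|std_normal_distribution. iexp ((r * y i) * x)) = complex_of_real (exp (- (s * (y i)\<^sup>2)))"
        using fun_cong[OF char_std_normal_distribution, of "r * y i"]
        by (simp add: char_def power_mult_distrib r2)
    qed
    also have "\<dots> = of_real (exp (- s * (\<Sum>i<m. (y i)\<^sup>2)))"
      by (simp add: exp_sum[symmetric] sum_distrib_left sum_negf flip: of_real_prod)
    finally show ?thesis by simp
  qed
  have "complex_of_real (expectation (\<lambda>x. exp (- s * (\<Sum>i<m. (Y i x)\<^sup>2))))
      = (CLINT x|M. of_real (exp (- s * (\<Sum>i<m. (Y i x)\<^sup>2))))" by simp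
  also have "\<dots> = (CLINT x|M. CLINT h|?G. iexp (\<Sum>i<m. (r * h i) * Y i x))"
    by (simp only: lin)
  also have "\<dots> = (CLINT h|?G. CLINT x|M. iexp (\<Sum>i<m. (r * h i) * Y i x))"
  proof (rule pair.Fubini_integral[symmetric])
    show "integrable (M \<Otimes>\<^sub>M ?G) (\<lambda>(x, h). iexp (\<Sum>i<m. (r * h i) * Y i x))"
      unfolding split_beta' by (rule pair.P.integrable_iexp) auto
  qed
  \<comment> \<open>The variables Y i are gone at this point; what remains is an integral over
    independent Gaussian h i that factorizes.\<close>
  also have "\<dots> = (CLINT h|?G. of_real (exp (- s * (\<Sum>i<m. l i * (h i)\<^sup>2))))"
    unfolding char by (simp add: power_mult_distrib r2 sum_distrib_left mult_ac sum_negf sum_divide_distrib)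
  also have "\<dots> = of_real (LINT h|?G. exp (- s * (\<Sum>i<m. l i * (h i)\<^sup>2)))" by simp
  also have "(LINT h|?G. exp (- s * (\<Sum>i<m. l i * (h i)\<^sup>2))) = (LINT h|?G. (\<Prod>i<m. exp (- (s * l i) * (h i)\<^sup>2)))"
    by (intro Bochner_Integration.integral_cong) (simp_all add: exp_sum[symmetric] sum_distrib_left mult_ac sum_negf)
  also have "\<dots> = (\<Prod>i<m. LINT x|std_normal_distribution. exp (- (s * l i) * x\<^sup>2))"
  proof (rule G.product_integral_prod)
    show "integrable std_normal_distribution (\<lambda>x. exp (- (s * l i) * x\<^sup>2))" if "i \<in> {..<m}" for i
      using std_normal_laplace_square[of "s * l i"] l[of i] s that by (auto simp: has_bochner_integral_iff)
  qed simp
  finally show ?thesis by (simp only: of_real_eq_iff)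
qed

section \<open>Weighted sums of independent chi-squares\<close>

lemma (in prob_space) chi2_integral:
  fixes f :: "real \<Rightarrow> 'b :: {banach, second_countable_topology}"
  assumes C [measurable]: "C \<in> borel_measurable M" and chi: "distr M borel C = chi2_1"
    and [measurable]: "f \<in> borel_measurable borel"
  shows "integrable M (\<lambda>x. f (C x)) \<longleftrightarrow> integrable std_normal_distribution (\<lambda>x. f (x\<^sup>2))"
    and "(\<integral>x. f (C x) \<partial>M) = (\<integral>x. f (x\<^sup>2) \<partial>std_normal_distribution)"
proof -
  have "integrable M (\<lambda>x. f (C x)) \<longleftrightarrow> integrable (distr M borel C) f" by (simp add: integrable_distr_eq)
  also have "\<dots> \<longleftrightarrow> integrable std_normal_distribution (\<lambda>x. f (x\<^sup>2))"
    unfolding chi chi2_1_def by (rule integrable_distr_eq) auto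
  finally show "integrable M (\<lambda>x. f (C x)) \<longleftrightarrow> integrable std_normal_distribution (\<lambda>x. f (x\<^sup>2))" .
  have "(\<integral>x. f (C x) \<partial>M) = integral\<^sup>L (distr M borel C) f" by (simp add: integral_distr)
  also have "\<dots> = (\<integral>x. f (x\<^sup>2) \<partial>std_normal_distribution)"
    unfolding chi chi2_1_def by (rule integral_distr) auto
  finally show "(\<integral>x. f (C x) \<partial>M) = (\<integral>x. f (x\<^sup>2) \<partial>std_normal_distribution)" .
qed

lemma (in prob_space) chi2_laplace:
  assumes C [measurable]: "C \<in> borel_measurable M" and chi: "distr M borel C = chi2_1" and c: "0 \<le> c"
  shows "has_bochner_integral M (\<lambda>x. exp (- c * C x)) (1 / sqrt (1 + 2 * c))"
  using chi2_integral[OF C chi, of "\<lambda>x. exp (- c * x)"] std_normal_laplace_square[OF c]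
  by (simp add: has_bochner_integral_iff)

lemma (in prob_space) chi2_nonneg:
  assumes C [measurable]: "C \<in> borel_measurable M" and chi: "distr M borel C = chi2_1"
  shows "AE x in M. 0 \<le> C x"
proof -
  have "AE x in distr M borel C. 0 \<le> x"
    unfolding chi chi2_1_def by (subst AE_distr_iff) auto
  then show ?thesis by (subst (asm) AE_distr_iff) auto
qed

lemma (in prob_space) laplace_weighted_chi2_sum:
  fixes C :: "nat \<Rightarrow> 'a \<Rightarrow> real"
  assumes ind: "indep_vars (\<lambda>_. borel) C UNIV" and chi: "\<And>i. distr M borel (C i) = chi2_1"
    and l: "\<And>i. i < m \<Longrightarrow> 0 \<le> l i"
  shows "has_bochner_integral M (\<lambda>x. exp (- (\<Sum>i<m. l i * C i x))) (\<Prod>i<m. 1 / sqrt (1 + 2 * l i))"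
proof -
  have C [measurable]: "C i \<in> borel_measurable M" for i
    using ind unfolding indep_vars_def by auto
  have i: "indep_vars (\<lambda>_. borel) (\<lambda>i x. exp (- l i * C i x)) {..<m}"
    by (rule indep_vars_compose2[OF indep_vars_subset[OF ind]]) auto
  have int: "has_bochner_integral M (\<lambda>x. exp (- l i * C i x)) (1 / sqrt (1 + 2 * l i))" if "i \<in> {..<m}" for i
    using chi2_laplace[OF C chi] l that by auto
  have eq: "exp (- (\<Sum>i<m. l i * C i x)) = (\<Prod>i<m. exp (- l i * C i x))" for x
    by (simp add: exp_sum[symmetric] sum_negf)
  show ?thesis
    unfolding has_bochner_integral_iff eq
    using indep_vars_lebesgue_integral[OF _ i] indep_vars_integrable[OF _ i] int
    by (auto simp: has_bochner_integral_iff intro!: prod.cong)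
qed

text \<open>Both sides have the same Laplace transform. The independence of the Gaussian coordinates
  enters only through their joint characteristic function, in the form of the diagonal exponent in
  \<open>char\<close>.\<close>

lemma (in prob_space) distr_sum_squares_eq:
  fixes Y :: "nat \<Rightarrow> 'a \<Rightarrow> real" and C :: "nat \<Rightarrow> 'p \<Rightarrow> real"
  assumes Y [measurable]: "\<And>i. i < m \<Longrightarrow> Y i \<in> borel_measurable M"
    and char: "\<And>g. (CLINT x|M. iexp (\<Sum>i<m. g i * Y i x)) = exp (- (\<Sum>i<m. l i * (g i)\<^sup>2) / 2)"
    and l: "\<And>i. i < m \<Longrightarrow> 0 \<le> l i"
    and P: "prob_space P" and ind: "prob_space.indep_vars P (\<lambda>_. borel) C UNIV"
    and chi: "\<And>i. distr P borel (C i) = chi2_1"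
  shows "distr M borel (\<lambda>x. \<Sum>i<m. (Y i x)\<^sup>2) = distr P borel (\<lambda>x. \<Sum>i<m. l i * C i x)"
proof -
  interpret P: prob_space P by fact
  have C [measurable]: "C i \<in> borel_measurable P" for i
    using ind unfolding P.indep_vars_def by auto
  have nn: "AE x in P. \<forall>i. 0 \<le> C i x"
    unfolding AE_all_countable using P.chi2_nonneg[OF C chi] by auto
  \<comment> \<open>The Laplace criterion asks for nonnegativity everywhere, but the C i are
    nonnegative only almost surely; hence the \<open>max 0\<close>, removed again at the
    end.\<close>
  have "distr M borel (\<lambda>x. \<Sum>i<m. (Y i x)\<^sup>2) = distr P borel (\<lambda>x. \<Sum>i<m. l i * max 0 (C i x))"
  proof (rule distr_eqI_laplace[OF P])
    fix s :: real assume s: "0 \<le> s"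
    have "(LINT x|P. exp (- s * (\<Sum>i<m. l i * max 0 (C i x)))) = (LINT x|P. exp (- (\<Sum>i<m. (s * l i) * C i x)))"
      by (rule integral_cong_AE) (use nn in \<open>auto simp: sum_distrib_left mult.assoc sum_negf elim!: eventually_mono\<close>)
    also have "\<dots> = (\<Prod>i<m. 1 / sqrt (1 + 2 * (s * l i)))"
      using P.laplace_weighted_chi2_sum[OF ind chi, of m "\<lambda>i. s * l i"] s l by (auto simp: has_bochner_integral_iff)
    also have "\<dots> = (\<Prod>i<m. LINT x|std_normal_distribution. exp (- (s * l i) * x\<^sup>2))"
      by (intro prod.cong refl) (use std_normal_laplace_square s l in \<open>force simp: has_bochner_integral_iff\<close>)
    finally show "expectation (\<lambda>x. exp (- s * (\<Sum>i<m. (Y i x)\<^sup>2)))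
        = (LINT x|P. exp (- s * (\<Sum>i<m. l i * max 0 (C i x))))"
      using laplace_sum_squares[OF Y char l s] by simp
  qed (auto intro!: sum_nonneg mult_nonneg_nonneg l)
  also have "\<dots> = distr P borel (\<lambda>x. \<Sum>i<m. l i * C i x)"
    by (rule distr_cong_AE) (use nn in \<open>auto elim!: eventually_mono\<close>)
  finally show ?thesis .
qed

section \<open>Series of independent variables and products of characteristic functions\<close>

text \<open>Whether increment n is added is decided by the value before it. The stopped sum at n is
  thus a function of the first n coordinates alone, which makes it independent of the next
  increment.\<close>

fun stopped_sum :: "real \<Rightarrow> nat \<Rightarrow> (nat \<Rightarrow> real) \<Rightarrow> real" where
  "stopped_sum e 0 y = 0"
| "stopped_sum e (Suc n) y = stopped_sum e n y + (if \<bar>stopped_sum e n y\<bar> < e then y n else 0)"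

lemma stopped_sum_measurable:
  "k \<le> n \<Longrightarrow> stopped_sum e k \<in> borel_measurable (PiM {..<n} (\<lambda>_. borel))"
proof (induction k)
  case (Suc k)
  then have [measurable]: "stopped_sum e k \<in> borel_measurable (PiM {..<n} (\<lambda>_. borel))" by simp
  have [measurable]: "(\<lambda>y. y k) \<in> borel_measurable (PiM {..<n} (\<lambda>_. borel))"
    using Suc.prems by (intro measurable_component_singleton) auto
  have "(\<lambda>y. stopped_sum e k y + (if \<bar>stopped_sum e k y\<bar> < e then y k else 0))
      \<in> borel_measurable (PiM {..<n} (\<lambda>_. borel))" by measurable
  then show ?case by (simp add: fun_eq_iff cong: measurable_cong)
next
  case 0
  have "stopped_sum e 0 = (\<lambda>_. 0)" by auto
  then show ?case by simp
qed

lemma stopped_sum_restrict: "k \<le> n \<Longrightarrow> stopped_sum e k (restrict y {..<n}) = stopped_sum e k y"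
  by (induction k) auto

text \<open>Once outside the interval, the stopped sum never moves again; a final value inside it
  shows that no partial sum ever left. The contrapositive is used in the maximal inequality.\<close>

lemma stopped_sum_less:
  "\<bar>stopped_sum e n y\<bar> < e \<Longrightarrow> stopped_sum e n y = (\<Sum>i<n. y i) \<and> (\<forall>j\<le>n. \<bar>\<Sum>i<j. y i\<bar> < e)"
proof (induction n)
  case (Suc n)
  have "\<bar>stopped_sum e n y\<bar> < e" using Suc.prems by (auto split: if_splits)
  with Suc show ?case by (auto simp: le_Suc_eq)
qed simp

text \<open>Stopping the partial sums at their first exit from (-e, e) does not increase the second moment,
  and Chebyshev's inequality for the stopped sum controls the maximum.\<close>
lemma (in prob_space) kolmogorov_maximal_inequality:
  fixes X :: "nat \<Rightarrow> 'a \<Rightarrow> real"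
  assumes ind: "indep_vars (\<lambda>_. borel) X UNIV" and mean: "\<And>i. expectation (X i) = 0"
    and sq: "\<And>i. integrable M (\<lambda>x. (X i x)\<^sup>2)" and e: "e > 0"
  shows "prob {x \<in> space M. \<exists>j\<le>n. e \<le> \<bar>\<Sum>i<j. X i x\<bar>} \<le> (\<Sum>i<n. expectation (\<lambda>x. (X i x)\<^sup>2)) / e\<^sup>2"
proof -
  have X [measurable]: "X i \<in> borel_measurable M" for i using ind unfolding indep_vars_def by auto
  define R where "R = (\<lambda>n x. stopped_sum e n (\<lambda>i. X i x))"
  have R_meas [measurable]: "R n \<in> borel_measurable M" for n
  proof -
    have "(\<lambda>x. stopped_sum e n (restrict (\<lambda>i. X i x) {..<n})) \<in> borel_measurable M"
      by (rule measurable_compose[OF _ stopped_sum_measurable[of n n]]) (auto intro!: measurable_restrict)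
    then show ?thesis by (simp add: R_def stopped_sum_restrict)
  qed
  have R: "integrable M (\<lambda>x. (R n x)\<^sup>2) \<and> expectation (\<lambda>x. (R n x)\<^sup>2) \<le> (\<Sum>i<n. expectation (\<lambda>x. (X i x)\<^sup>2))" for n
  proof (induction n)
    case 0
    show ?case by (simp add: R_def)
  next
    case (Suc n)
    \<comment> \<open>The cross term of the squared increment contains \<open>f (R n x)\<close>,
      which is bounded by e, hence integrable, and independent of the centred X n, so its
      expectation vanishes. The indicator h only decreases the square term.\<close>
    define f where "f = (\<lambda>r. if \<bar>r\<bar> < e then r else 0)"
    define h where "h = (\<lambda>r. if \<bar>r\<bar> < e then 1 else 0 :: real)"
    have [measurable]: "f \<in> borel_measurable borel" "h \<in> borel_measurable borel" unfolding f_def h_def by measurable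
    have indep: "indep_var borel (\<lambda>x. f (R n x)) borel (X n)"
    proof -
      have "indep_var (PiM {..<n} (\<lambda>_. borel)) (\<lambda>x. restrict (\<lambda>i. X i x) {..<n}) (PiM {n} (\<lambda>_. borel)) (\<lambda>x. restrict (\<lambda>i. X i x) {n})"
        by (rule indep_var_restrict[OF ind]) auto
      then have "indep_var borel ((\<lambda>y. f (stopped_sum e n y)) \<circ> (\<lambda>x. restrict (\<lambda>i. X i x) {..<n}))
          borel ((\<lambda>y. y n) \<circ> (\<lambda>x. restrict (\<lambda>i. X i x) {n}))"
        by (rule indep_var_compose) (auto intro!: measurable_component_singleton measurable_compose[OF stopped_sum_measurable])
      then show ?thesis by (simp add: o_def R_def stopped_sum_restrict)
    qed
    have fi: "integrable M (\<lambda>x. f (R n x))"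
      using e by (intro integrable_const_bound[of _ e]) (auto simp: f_def)
    have Xi: "integrable M (X n)" by (rule square_integrable_imp_integrable[OF X sq])
    have cross: "integrable M (\<lambda>x. f (R n x) * X n x)" "expectation (\<lambda>x. f (R n x) * X n x) = 0"
      using indep_var_integrable[OF indep fi Xi] indep_var_lebesgue_integral[OF indep fi Xi] mean by auto
    have hi: "integrable M (\<lambda>x. h (R n x) * (X n x)\<^sup>2)"
      by (rule Bochner_Integration.integrable_bound[OF sq[of n]]) (auto simp: h_def)
    have eq: "(R (Suc n) x)\<^sup>2 = (R n x)\<^sup>2 + 2 * (f (R n x) * X n x) + h (R n x) * (X n x)\<^sup>2" for x
      by (simp add: R_def f_def h_def power2_eq_square algebra_simps)
    have "expectation (\<lambda>x. (R (Suc n) x)\<^sup>2) = expectation (\<lambda>x. (R n x)\<^sup>2) + expectation (\<lambda>x. h (R n x) * (X n x)\<^sup>2)"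
      unfolding eq using Suc cross hi by (subst Bochner_Integration.integral_add, simp, simp)+ simp
    also have "expectation (\<lambda>x. h (R n x) * (X n x)\<^sup>2) \<le> expectation (\<lambda>x. (X n x)\<^sup>2)"
      by (rule integral_mono[OF hi sq]) (auto simp: h_def)
    finally have "expectation (\<lambda>x. (R (Suc n) x)\<^sup>2) \<le> (\<Sum>i<Suc n. expectation (\<lambda>x. (X i x)\<^sup>2))"
      using Suc by simp
    moreover have "integrable M (\<lambda>x. (R (Suc n) x)\<^sup>2)"
      unfolding eq using Suc cross hi by auto
    ultimately show ?case by blast
  qed
  have "prob {x \<in> space M. \<exists>j\<le>n. e \<le> \<bar>\<Sum>i<j. X i x\<bar>} \<le> prob {x \<in> space M. (R n x)\<^sup>2 \<ge> e\<^sup>2}"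
  proof (rule finite_measure_mono, safe)
    fix x j assume "j \<le> n" "e \<le> \<bar>\<Sum>i<j. X i x\<bar>"
    then have "\<not> \<bar>R n x\<bar> < e" unfolding R_def using stopped_sum_less[of e n "\<lambda>i. X i x"] by force
    then have "e \<le> \<bar>R n x\<bar>" by simp
    then show "e\<^sup>2 \<le> (R n x)\<^sup>2" using e by (metis abs_le_square_iff abs_of_pos)
  qed measurable
  also have "\<dots> \<le> expectation (\<lambda>x. (R n x)\<^sup>2) / e\<^sup>2"
    using integral_Markov_inequality_measure[of M "\<lambda>x. (R n x)\<^sup>2" "{}" "e\<^sup>2"] R e by auto
  also have "\<dots> \<le> (\<Sum>i<n. expectation (\<lambda>x. (X i x)\<^sup>2)) / e\<^sup>2"
    using R e by (intro divide_right_mono) auto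
  finally show ?thesis .
qed

text \<open>Kolmogorov's convergence criterion. The probability that the partial sums after m ever
  move by e is at most the variance tail divided by e^2, which tends to 0; almost surely the partial
  sums are therefore Cauchy.\<close>

lemma (in prob_space) AE_summable_of_summable_variance:
  fixes X :: "nat \<Rightarrow> 'a \<Rightarrow> real"
  assumes ind: "indep_vars (\<lambda>_. borel) X UNIV" and mean: "\<And>i. expectation (X i) = 0"
    and sq: "\<And>i. integrable M (\<lambda>x. (X i x)\<^sup>2)" and summ: "summable (\<lambda>i. expectation (\<lambda>x. (X i x)\<^sup>2))"
  shows "AE x in M. summable (\<lambda>i. X i x)"
proof -
  have X [measurable]: "X i \<in> borel_measurable M" for i using ind unfolding indep_vars_def by auto
  define S where "S = (\<lambda>n x. \<Sum>i<n. X i x)"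
  have S [measurable]: "S n \<in> borel_measurable M" for n unfolding S_def by measurable
  define v where "v = (\<lambda>i. expectation (\<lambda>x. (X i x)\<^sup>2))"
  have v0: "0 \<le> v i" for i by (simp add: v_def)
  have tail: "prob {x \<in> space M. \<exists>n\<ge>m. e \<le> \<bar>S n x - S m x\<bar>} \<le> (\<Sum>i. v (i + m)) / e\<^sup>2" if e: "e > 0" for e m
  proof -
    \<comment> \<open>Deleting the first m terms lets the maximal inequality, which speaks of sums
      started at 0, control the differences \<open>S n x - S m x\<close>.\<close>
    define X' where "X' = (\<lambda>i x. if i < m then 0 else X i x)"
    have S': "(\<Sum>i<j. X' i x) = (if j < m then 0 else S j x - S m x)" for j x
    proof (cases "j < m")
      case False
      then have "(\<Sum>i<j. X' i x) = (\<Sum>i\<in>{m..<j}. X i x)"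
        by (intro sum.mono_neutral_cong_right) (auto simp: X'_def)
      also have "\<dots> = S j x - S m x" using False by (simp add: S_def lessThan_atLeast0 sum_diff_nat_ivl)
      finally show ?thesis using False by simp
    qed (simp add: X'_def)
    have ind': "indep_vars (\<lambda>_. borel) X' UNIV"
      unfolding X'_def by (rule indep_vars_compose2[OF ind, of "\<lambda>i y. if i < m then 0 else y"]) auto
    have bound: "prob {x \<in> space M. \<exists>j\<le>n. e \<le> \<bar>\<Sum>i<j. X' i x\<bar>} \<le> (\<Sum>i. v (i + m)) / e\<^sup>2" for n
    proof -
      have "prob {x \<in> space M. \<exists>j\<le>n. e \<le> \<bar>\<Sum>i<j. X' i x\<bar>} \<le> (\<Sum>i<n. expectation (\<lambda>x. (X' i x)\<^sup>2)) / e\<^sup>2"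
      proof (rule kolmogorov_maximal_inequality[OF ind' _ _ e])
        show "expectation (X' i) = 0" "integrable M (\<lambda>x. (X' i x)\<^sup>2)" for i
          by (cases "i < m"; simp add: X'_def mean sq)+
      qed
      also have "(\<Sum>i<n. expectation (\<lambda>x. (X' i x)\<^sup>2)) \<le> (\<Sum>i<m + n. expectation (\<lambda>x. (X' i x)\<^sup>2))"
        by (rule sum_mono2) auto
      also have "(\<Sum>i<m + n. expectation (\<lambda>x. (X' i x)\<^sup>2)) = (\<Sum>i\<in>{m..<m + n}. v i)"
        by (intro sum.mono_neutral_cong_right) (auto simp: X'_def v_def)
      also have "\<dots> = (\<Sum>i<n. v (i + m))"
        by (subst add.commute, subst sum.atLeastLessThan_shift_0) (simp add: lessThan_atLeast0)
      also have "\<dots> \<le> (\<Sum>i. v (i + m))"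
        using summ v0 by (intro sum_le_suminf) (auto simp: v_def[symmetric] intro: summable_ignore_initial_segment)
      finally show ?thesis using e by (simp add: divide_right_mono)
    qed
    \<comment> \<open>Continuity from below removes the finite horizon n, since the bound does not
      depend on it.\<close>
    have "(\<lambda>n. prob {x \<in> space M. \<exists>j\<le>n. e \<le> \<bar>\<Sum>i<j. X' i x\<bar>}) \<longlonglongrightarrow> prob (\<Union>n. {x \<in> space M. \<exists>j\<le>n. e \<le> \<bar>\<Sum>i<j. X' i x\<bar>})"
      unfolding S' by (rule finite_Lim_measure_incseq) (auto simp: incseq_def intro: order.trans)
    then have "prob (\<Union>n. {x \<in> space M. \<exists>j\<le>n. e \<le> \<bar>\<Sum>i<j. X' i x\<bar>}) \<le> (\<Sum>i. v (i + m)) / e\<^sup>2"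
      by (rule LIMSEQ_le_const2) (use bound in auto)
    also have "(\<Union>n. {x \<in> space M. \<exists>j\<le>n. e \<le> \<bar>\<Sum>i<j. X' i x\<bar>}) = {x \<in> space M. \<exists>n\<ge>m. e \<le> \<bar>S n x - S m x\<bar>}"
    proof -
      have "(\<exists>n. \<exists>j\<le>n. e \<le> \<bar>if j < m then 0 else S j x - S m x\<bar>) \<longleftrightarrow> (\<exists>n\<ge>m. e \<le> \<bar>S n x - S m x\<bar>)" for x
      proof
        assume "\<exists>n. \<exists>j\<le>n. e \<le> \<bar>if j < m then 0 else S j x - S m x\<bar>"
        then obtain j where "e \<le> \<bar>if j < m then 0 else S j x - S m x\<bar>" by blast
        then show "\<exists>n\<ge>m. e \<le> \<bar>S n x - S m x\<bar>" using e by (intro exI[of _ j]) (auto split: if_splits)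
      next
        assume "\<exists>n\<ge>m. e \<le> \<bar>S n x - S m x\<bar>"
        then obtain n where "n \<ge> m" "e \<le> \<bar>S n x - S m x\<bar>" by blast
        then show "\<exists>n. \<exists>j\<le>n. e \<le> \<bar>if j < m then 0 else S j x - S m x\<bar>" by (intro exI[of _ n]) auto
      qed
      then show ?thesis unfolding S' by blast
    qed
    finally show ?thesis .
  qed
  have null: "AE x in M. \<exists>m. \<forall>n\<ge>m. \<bar>S n x - S m x\<bar> < e" if e: "e > 0" for e
  proof -
    define A where "A = {x \<in> space M. \<forall>m. \<exists>n\<ge>m. e \<le> \<bar>S n x - S m x\<bar>}"
    have [measurable]: "A \<in> sets M" unfolding A_def by measurable
    \<comment> \<open>The exceptional set A lies in the tail event for every m, so the bound may be
      taken to its limit 0.\<close>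
    have "prob A \<le> (\<Sum>i. v (i + m)) / e\<^sup>2" for m
    proof -
      have "prob A \<le> prob {x \<in> space M. \<exists>n\<ge>m. e \<le> \<bar>S n x - S m x\<bar>}"
        by (rule finite_measure_mono) (auto simp: A_def)
      then show ?thesis using tail[OF e] by (rule order.trans)
    qed
    moreover have "(\<lambda>m. (\<Sum>i. v (i + m)) / e\<^sup>2) \<longlonglongrightarrow> 0 / e\<^sup>2"
      using summ e by (intro tendsto_divide suminf_exist_split2) (auto simp: v_def)
    ultimately have "prob A \<le> 0 / e\<^sup>2" by (intro LIMSEQ_le_const) auto
    then have "prob A = 0" by (simp add: measure_le_0_iff)
    then have "AE x in M. x \<notin> A" by (subst AE_iff_measurable[of A]) (auto simp: emeasure_eq_measure A_def sets.sets_into_space)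
    then show ?thesis by (rule AE_mp) (auto simp: A_def not_le intro!: AE_I2 dest: leD)
  qed
  have "AE x in M. \<forall>k. \<exists>m. \<forall>n\<ge>m. \<bar>S n x - S m x\<bar> < 1 / real (Suc k)"
    unfolding AE_all_countable by (intro allI null) auto
  then show ?thesis
  proof eventually_elim
    case (elim x)
    have "Cauchy (\<lambda>n. S n x)"
    proof (rule CauchyI')
      fix e :: real assume "e > 0"
      then obtain k where k: "1 / real (Suc k) < e / 2" using nat_approx_posE[of "e / 2"] by auto
      from elim obtain m where m: "\<And>n. n \<ge> m \<Longrightarrow> \<bar>S n x - S m x\<bar> < 1 / real (Suc k)" by blast
      have "\<bar>S n x - S n' x\<bar> < e" if "n \<ge> m" "n' > n" for n n'
        using m[of n] m[of n'] that k by linarith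
      then show "\<exists>m. \<forall>n\<ge>m. \<forall>n'>n. dist (S n x) (S n' x) < e" by (auto simp: dist_real_def)
    qed
    then have "convergent (\<lambda>n. S n x)" by (rule Cauchy_convergent)
    then show ?case by (simp add: summable_iff_convergent S_def)
  qed
qed

section \<open>Limits of products of characteristic functions\<close>

lemma norm_exp_minus_one_minus_le:
  fixes u :: real
  assumes "0 \<le> u"
  shows "\<bar>exp (- u) - (1 - u)\<bar> \<le> u\<^sup>2"
proof -
  have "1 - u \<le> exp (- u)" using exp_ge_add_one_self[of "- u"] by simp
  moreover have "exp (- u) * (1 + u) \<le> exp (- u) * exp u" by (intro mult_left_mono) auto
  then have "exp (- u) * (1 + u) \<le> 1" by (simp add: exp_minus)
  then have "exp (- u) \<le> 1 / (1 + u)" using assms by (simp add: field_simps)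
  moreover have "1 / (1 + u) \<le> 1 - u + u\<^sup>2"
    using assms by (simp add: field_simps power2_eq_square)
  ultimately show ?thesis by linarith
qed

text \<open>The Taylor error is controlled by the expectation of a minimum. Its first argument gives
  the quadratic bound, its second the cubic one; the term t^4 is the price for replacing 1 - t^2 / 2
  by the Gaussian value.\<close>

lemma (in real_distribution) char_standardized_bounds:
  assumes int: "integrable M (\<lambda>x. x)" "integrable M (\<lambda>x. x\<^sup>2)" "integrable M (\<lambda>x. \<bar>x\<bar> ^ 3)"
    and mean: "expectation (\<lambda>x. x) = 0" and var: "expectation (\<lambda>x. x\<^sup>2) = 1"
  shows "norm (char M t - 1) \<le> 2 * t\<^sup>2"
    and "norm (char M t - exp (- (t\<^sup>2 / 2))) \<le> (1 + expectation (\<lambda>x. \<bar>x\<bar> ^ 3)) * (\<bar>t\<bar> ^ 3 + t ^ 4)"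
proof -
  define I where "I = expectation (\<lambda>x. min (6 * x\<^sup>2) (\<bar>t\<bar> * \<bar>x\<bar> ^ 3))"
  have mi: "integrable M (\<lambda>x. min (6 * x\<^sup>2) (\<bar>t\<bar> * \<bar>x\<bar> ^ 3))" using int by auto
  have A: "norm (char M t - (1 - t\<^sup>2 / 2)) \<le> t\<^sup>2 / 6 * I"
    using char_approx3[OF int(1) mean int(2), of 1 t] var mean by (simp add: I_def)
  have "I \<le> expectation (\<lambda>x. 6 * x\<^sup>2)" unfolding I_def using int by (intro integral_mono[OF mi]) auto
  then have I1: "I \<le> 6" using int var by simp
  have "I \<le> expectation (\<lambda>x. \<bar>t\<bar> * \<bar>x\<bar> ^ 3)" unfolding I_def using int by (intro integral_mono[OF mi]) auto
  then have I2: "I \<le> \<bar>t\<bar> * expectation (\<lambda>x. \<bar>x\<bar> ^ 3)" by simp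
  have "norm (char M t - 1) \<le> norm (char M t - (1 - t\<^sup>2 / 2)) + norm (complex_of_real (- (t\<^sup>2 / 2)))"
    by (rule order.trans[OF _ norm_triangle_ineq]) simp
  also have "\<dots> \<le> t\<^sup>2 / 6 * I + t\<^sup>2 / 2" using A unfolding norm_of_real by simp
  also have "\<dots> \<le> t\<^sup>2 / 6 * 6 + t\<^sup>2 / 2" using I1 by (intro add_mono mult_left_mono) auto
  also have "\<dots> \<le> 2 * t\<^sup>2" using zero_le_power2[of t] by linarith
  finally show "norm (char M t - 1) \<le> 2 * t\<^sup>2" .
  have "norm (char M t - exp (- (t\<^sup>2 / 2))) \<le> norm (char M t - (1 - t\<^sup>2 / 2)) + norm (complex_of_real ((1 - t\<^sup>2 / 2) - exp (- (t\<^sup>2 / 2))))"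
    by (rule order.trans[OF _ norm_triangle_ineq]) simp
  also have "norm (complex_of_real ((1 - t\<^sup>2 / 2) - exp (- (t\<^sup>2 / 2)))) \<le> (t\<^sup>2 / 2)\<^sup>2"
    unfolding norm_of_real using norm_exp_minus_one_minus_le[of "t\<^sup>2 / 2"] by (simp add: abs_minus_commute)
  also have "(t\<^sup>2 / 2)\<^sup>2 = t ^ 4 / 4" by (simp add: power_divide flip: power_mult)
  also have "norm (char M t - (1 - t\<^sup>2 / 2)) \<le> t\<^sup>2 / 6 * (\<bar>t\<bar> * expectation (\<lambda>x. \<bar>x\<bar> ^ 3))"
    using I2 by (intro order.trans[OF A] mult_left_mono) auto
  also have "\<dots> = \<bar>t\<bar> ^ 3 * expectation (\<lambda>x. \<bar>x\<bar> ^ 3) / 6"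
    by (simp add: power3_eq_cube power2_eq_square)
  also have "\<bar>t\<bar> ^ 3 * expectation (\<lambda>x. \<bar>x\<bar> ^ 3) / 6 + t ^ 4 / 4 \<le> (1 + expectation (\<lambda>x. \<bar>x\<bar> ^ 3)) * (\<bar>t\<bar> ^ 3 + t ^ 4)"
  proof -
    have E: "0 \<le> expectation (\<lambda>x. \<bar>x\<bar> ^ 3)" by simp
    have "0 \<le> \<bar>t\<bar> ^ 3 * expectation (\<lambda>x. \<bar>x\<bar> ^ 3)" "0 \<le> t ^ 4" "0 \<le> \<bar>t\<bar> ^ 3" "0 \<le> t ^ 4 * expectation (\<lambda>x. \<bar>x\<bar> ^ 3)"
      using E by auto
    moreover have "(1 + expectation (\<lambda>x. \<bar>x\<bar> ^ 3)) * (\<bar>t\<bar> ^ 3 + t ^ 4)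
        = \<bar>t\<bar> ^ 3 + t ^ 4 + \<bar>t\<bar> ^ 3 * expectation (\<lambda>x. \<bar>x\<bar> ^ 3) + t ^ 4 * expectation (\<lambda>x. \<bar>x\<bar> ^ 3)"
      by (simp add: algebra_simps)
    ultimately show ?thesis by linarith
  qed
  finally show "norm (char M t - exp (- (t\<^sup>2 / 2))) \<le> (1 + expectation (\<lambda>x. \<bar>x\<bar> ^ 3)) * (\<bar>t\<bar> ^ 3 + t ^ 4)"
    by simp
qed

lemma prod_lessThan_split_tail:
  fixes f :: "nat \<Rightarrow> 'a :: comm_monoid_mult"
  assumes "\<And>i. i \<ge> m \<Longrightarrow> f i = 1"
  shows "(\<Prod>i<m. f i) = (\<Prod>i<r. f i) * (\<Prod>i\<in>{r..<max r m}. f i)"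
proof -
  have "(\<Prod>i<m. f i) = (\<Prod>i<max r m. f i)"
    by (rule prod.mono_neutral_left) (use assms in auto)
  also have "{..<max r m} = {..<r} \<union> {r..<max r m}" by auto
  also have "(\<Prod>i\<in>{..<r} \<union> {r..<max r m}. f i) = (\<Prod>i<r. f i) * (\<Prod>i\<in>{r..<max r m}. f i)"
    by (rule prod.union_disjoint) auto
  finally show ?thesis .
qed

lemma sum_lessThan_split_tail:
  fixes f :: "nat \<Rightarrow> 'a :: comm_monoid_add"
  assumes "\<And>i. i \<ge> m \<Longrightarrow> f i = 0"
  shows "(\<Sum>i<m. f i) = (\<Sum>i<r. f i) + (\<Sum>i\<in>{r..<max r m}. f i)"
proof -
  have "(\<Sum>i<m. f i) = (\<Sum>i<max r m. f i)"
    by (rule sum.mono_neutral_left) (use assms in auto)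
  also have "{..<max r m} = {..<r} \<union> {r..<max r m}" by auto
  also have "(\<Sum>i\<in>{..<r} \<union> {r..<max r m}. f i) = (\<Sum>i<r. f i) + (\<Sum>i\<in>{r..<max r m}. f i)"
    by (rule sum.union_disjoint) auto
  finally show ?thesis .
qed

text \<open>Each tail factor is exchanged for its Gaussian counterpart. The cubic error is at most a
  constant times \<open>\<beta> k r\<close> times the square of the weight; the squares sum to at
  most 1, and the largest tail weight \<open>\<beta> k r\<close> tends to b r = 0.\<close>

lemma prod_char_tendsto_finite_support:
  fixes \<phi> :: "real \<Rightarrow> complex" and \<beta> :: "nat \<Rightarrow> nat \<Rightarrow> real" and b :: "nat \<Rightarrow> real"
  assumes \<phi>: "\<And>u. norm (\<phi> u) \<le> 1" "\<And>u. isCont \<phi> u" "\<phi> 0 = 1"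
      "\<And>u. norm (\<phi> u - exp (- (u\<^sup>2 / 2))) \<le> K * (\<bar>u\<bar> ^ 3 + u ^ 4)" and K: "0 \<le> K"
    and \<beta>: "\<And>k. antimono (\<beta> k)" "\<And>k i. 0 \<le> \<beta> k i" "\<And>k i. i \<ge> m k \<Longrightarrow> \<beta> k i = 0"
      "\<And>k. (\<Sum>i<m k. (\<beta> k i)\<^sup>2) = 1"
    and b: "\<And>i. i \<ge> r \<Longrightarrow> b i = 0" and conv: "\<And>i. (\<lambda>k. \<beta> k i) \<longlonglongrightarrow> b i"
  shows "(\<lambda>k. \<Prod>i<m k. \<phi> (t * \<beta> k i)) \<longlonglongrightarrow> (\<Prod>i<r. \<phi> (t * b i)) * exp (- (t\<^sup>2 / 2 * (1 - (\<Sum>i<r. (b i)\<^sup>2))))"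
proof -
  let ?T = "\<lambda>k. {r..<max r (m k)}"
  have split: "(\<Prod>i<m k. \<phi> (t * \<beta> k i)) = (\<Prod>i<r. \<phi> (t * \<beta> k i)) * (\<Prod>i\<in>?T k. \<phi> (t * \<beta> k i))" for k
    by (rule prod_lessThan_split_tail) (simp add: \<beta> \<phi>)
  have sq: "(\<Sum>i\<in>?T k. (\<beta> k i)\<^sup>2) = 1 - (\<Sum>i<r. (\<beta> k i)\<^sup>2)" for k
    using sum_lessThan_split_tail[of "m k" "\<lambda>i. (\<beta> k i)\<^sup>2" r] \<beta>(3,4) by simp
  have le1: "\<beta> k i \<le> 1" for k i
  proof (cases "i < m k")
    case True
    then have "(\<beta> k i)\<^sup>2 \<le> (\<Sum>i<m k. (\<beta> k i)\<^sup>2)" by (intro member_le_sum) auto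
    then have "(\<beta> k i)\<^sup>2 \<le> 1\<^sup>2" by (simp add: \<beta>)
    then show ?thesis by (rule power2_le_imp_le) simp
  qed (simp add: \<beta>)
  \<comment> \<open>Since the squares sum to exactly 1, the Gaussian tail product is an explicit
    function of the first r weights and its limit is immediate.\<close>
  have gauss: "(\<Prod>i\<in>?T k. complex_of_real (exp (- ((t * \<beta> k i)\<^sup>2 / 2)))) = exp (- (t\<^sup>2 / 2 * (1 - (\<Sum>i<r. (\<beta> k i)\<^sup>2))))" for k
    unfolding sq[symmetric]
    by (simp add: exp_sum[symmetric] sum_negf sum_distrib_left power_mult_distrib flip: of_real_prod)
  have bound: "norm ((\<Prod>i\<in>?T k. \<phi> (t * \<beta> k i)) - exp (- (t\<^sup>2 / 2 * (1 - (\<Sum>i<r. (\<beta> k i)\<^sup>2)))))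
      \<le> K * (\<bar>t\<bar> ^ 3 + t ^ 4) * \<beta> k r" for k
  proof -
    have "norm ((\<Prod>i\<in>?T k. \<phi> (t * \<beta> k i)) - exp (- (t\<^sup>2 / 2 * (1 - (\<Sum>i<r. (\<beta> k i)\<^sup>2)))))
      \<le> (\<Sum>i\<in>?T k. norm (\<phi> (t * \<beta> k i) - exp (- ((t * \<beta> k i)\<^sup>2 / 2))))"
      unfolding gauss[symmetric] by (rule norm_prod_diff) (auto simp: \<phi>)
    also have "\<dots> \<le> (\<Sum>i\<in>?T k. K * (\<bar>t\<bar> ^ 3 + t ^ 4) * \<beta> k r * (\<beta> k i)\<^sup>2)"
    proof (rule sum_mono)
      fix i assume i: "i \<in> ?T k"
      have ir: "\<beta> k i \<le> \<beta> k r" using i by (intro antimonoD[OF \<beta>(1)]) auto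
      have 3: "\<beta> k i ^ 3 \<le> \<beta> k r * (\<beta> k i)\<^sup>2"
        using mult_right_mono[OF ir, of "(\<beta> k i)\<^sup>2"] by (simp add: power3_eq_cube power2_eq_square mult.assoc)
      have "\<beta> k i ^ 4 = \<beta> k i ^ 3 * \<beta> k i" by (simp add: eval_nat_numeral)
      also have "\<dots> \<le> \<beta> k i ^ 3 * 1" using le1 \<beta>(2) by (intro mult_left_mono) auto
      finally have 4: "\<beta> k i ^ 4 \<le> \<beta> k r * (\<beta> k i)\<^sup>2" using 3 by simp
      have "norm (\<phi> (t * \<beta> k i) - exp (- ((t * \<beta> k i)\<^sup>2 / 2))) \<le> K * (\<bar>t\<bar> ^ 3 * \<beta> k i ^ 3 + t ^ 4 * \<beta> k i ^ 4)"
        using \<phi>(4)[of "t * \<beta> k i"] \<beta>(2)[of k i] by (simp add: abs_mult power_mult_distrib)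
      also have "\<dots> \<le> K * (\<bar>t\<bar> ^ 3 * (\<beta> k r * (\<beta> k i)\<^sup>2) + t ^ 4 * (\<beta> k r * (\<beta> k i)\<^sup>2))"
        using 3 4 K by (intro mult_left_mono add_mono) auto
      also have "\<dots> = K * (\<bar>t\<bar> ^ 3 + t ^ 4) * \<beta> k r * (\<beta> k i)\<^sup>2" by (simp add: algebra_simps)
      finally show "norm (\<phi> (t * \<beta> k i) - exp (- ((t * \<beta> k i)\<^sup>2 / 2))) \<le> K * (\<bar>t\<bar> ^ 3 + t ^ 4) * \<beta> k r * (\<beta> k i)\<^sup>2" .
    qed
    also have "\<dots> = K * (\<bar>t\<bar> ^ 3 + t ^ 4) * \<beta> k r * (1 - (\<Sum>i<r. (\<beta> k i)\<^sup>2))"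
      by (simp add: sum_distrib_left[symmetric] sq)
    also have "\<dots> \<le> K * (\<bar>t\<bar> ^ 3 + t ^ 4) * \<beta> k r * 1"
      using K \<beta>(2) by (intro mult_left_mono mult_nonneg_nonneg) (auto simp: sum_nonneg)
    finally show ?thesis by simp
  qed
  have br: "(\<lambda>k. K * (\<bar>t\<bar> ^ 3 + t ^ 4) * \<beta> k r) \<longlonglongrightarrow> K * (\<bar>t\<bar> ^ 3 + t ^ 4) * 0"
    using conv[of r] b[of r] by (intro tendsto_mult tendsto_const) simp
  have "(\<lambda>k. (\<Prod>i\<in>?T k. \<phi> (t * \<beta> k i)) - exp (- (t\<^sup>2 / 2 * (1 - (\<Sum>i<r. (\<beta> k i)\<^sup>2))))) \<longlonglongrightarrow> 0"
    by (rule Lim_null_comparison[OF always_eventually br[simplified]]) (use bound in auto)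
  moreover have "(\<lambda>k. complex_of_real (exp (- (t\<^sup>2 / 2 * (1 - (\<Sum>i<r. (\<beta> k i)\<^sup>2))))))
      \<longlonglongrightarrow> complex_of_real (exp (- (t\<^sup>2 / 2 * (1 - (\<Sum>i<r. (b i)\<^sup>2)))))"
    by (intro tendsto_intros conv)
  ultimately have tail: "(\<lambda>k. \<Prod>i\<in>?T k. \<phi> (t * \<beta> k i)) \<longlonglongrightarrow> complex_of_real (exp (- (t\<^sup>2 / 2 * (1 - (\<Sum>i<r. (b i)\<^sup>2)))))"
    by (rule Lim_transform[rotated])
  show ?thesis
    unfolding split
    by (intro tendsto_mult tail tendsto_prod isCont_tendsto_compose[OF \<phi>(2)] tendsto_const conv)
qed

text \<open>No mass escapes: finitely many limit weights carry almost the whole square sum 1, so for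
  large k the same number of weights of \<beta> does too. The quadratic bound then keeps the tail
  product close to 1.\<close>

lemma prod_char_tendsto_unit_square_sum:
  fixes \<phi> :: "real \<Rightarrow> complex" and \<beta> :: "nat \<Rightarrow> nat \<Rightarrow> real" and b :: "nat \<Rightarrow> real"
  assumes \<phi>: "\<And>u. norm (\<phi> u) \<le> 1" "\<And>u. isCont \<phi> u" "\<And>u. norm (\<phi> u - 1) \<le> 2 * u\<^sup>2"
    and \<beta>: "\<And>k i. i \<ge> m k \<Longrightarrow> \<beta> k i = 0" "\<And>k. (\<Sum>i<m k. (\<beta> k i)\<^sup>2) = 1"
    and b: "(\<lambda>i. (b i)\<^sup>2) sums 1" and conv: "\<And>i. (\<lambda>k. \<beta> k i) \<longlonglongrightarrow> b i"
    and L: "(\<lambda>n. \<Prod>i<n. \<phi> (t * b i)) \<longlonglongrightarrow> L"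
  shows "(\<lambda>k. \<Prod>i<m k. \<phi> (t * \<beta> k i)) \<longlonglongrightarrow> L"
proof (rule tendstoI)
  fix e :: real assume e: "e > 0"
  have \<phi>0: "\<phi> 0 = 1" using \<phi>(3)[of 0] by simp
  have "(\<lambda>n. 2 * t\<^sup>2 * (1 - (\<Sum>i<n. (b i)\<^sup>2))) \<longlonglongrightarrow> 2 * t\<^sup>2 * (1 - 1)"
    using b unfolding sums_def by (intro tendsto_intros)
  then have "\<forall>\<^sub>F n in sequentially. 2 * t\<^sup>2 * (1 - (\<Sum>i<n. (b i)\<^sup>2)) < e / 3"
    using e by (intro order_tendstoD(2)) auto
  moreover have "\<forall>\<^sub>F n in sequentially. dist (\<Prod>i<n. \<phi> (t * b i)) L < e / 3"
    using tendstoD[OF L, of "e / 3"] e by simp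
  ultimately have "\<forall>\<^sub>F n in sequentially. 2 * t\<^sup>2 * (1 - (\<Sum>i<n. (b i)\<^sup>2)) < e / 3 \<and> dist (\<Prod>i<n. \<phi> (t * b i)) L < e / 3"
    by (rule eventually_conj)
  then obtain n where n: "2 * t\<^sup>2 * (1 - (\<Sum>i<n. (b i)\<^sup>2)) < e / 3" "dist (\<Prod>i<n. \<phi> (t * b i)) L < e / 3"
    by (auto simp: eventually_sequentially)
  have "(\<lambda>k. 2 * t\<^sup>2 * (1 - (\<Sum>i<n. (\<beta> k i)\<^sup>2))) \<longlonglongrightarrow> 2 * t\<^sup>2 * (1 - (\<Sum>i<n. (b i)\<^sup>2))"
    by (intro tendsto_intros conv)
  then have ev1: "\<forall>\<^sub>F k in sequentially. 2 * t\<^sup>2 * (1 - (\<Sum>i<n. (\<beta> k i)\<^sup>2)) < e / 3"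
    using n(1) by (rule order_tendstoD(2))
  have "(\<lambda>k. \<Prod>i<n. \<phi> (t * \<beta> k i)) \<longlonglongrightarrow> (\<Prod>i<n. \<phi> (t * b i))"
    by (intro tendsto_prod isCont_tendsto_compose[OF \<phi>(2)] tendsto_mult tendsto_const conv)
  then have ev2: "\<forall>\<^sub>F k in sequentially. dist (\<Prod>i<n. \<phi> (t * \<beta> k i)) (\<Prod>i<n. \<phi> (t * b i)) < e / 3"
    using e by (intro tendstoD) auto
  from ev1 ev2 show "\<forall>\<^sub>F k in sequentially. dist (\<Prod>i<m k. \<phi> (t * \<beta> k i)) L < e"
  proof eventually_elim
    case (elim k)
    let ?T = "{n..<max n (m k)}"
    have split: "(\<Prod>i<m k. \<phi> (t * \<beta> k i)) = (\<Prod>i<n. \<phi> (t * \<beta> k i)) * (\<Prod>i\<in>?T. \<phi> (t * \<beta> k i))"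
      by (rule prod_lessThan_split_tail) (simp add: \<beta> \<phi>0)
    have sq: "(\<Sum>i\<in>?T. (\<beta> k i)\<^sup>2) = 1 - (\<Sum>i<n. (\<beta> k i)\<^sup>2)"
      using sum_lessThan_split_tail[of "m k" "\<lambda>i. (\<beta> k i)\<^sup>2" n] \<beta> by simp
    have "norm ((\<Prod>i\<in>?T. \<phi> (t * \<beta> k i)) - (\<Prod>i\<in>?T. 1)) \<le> (\<Sum>i\<in>?T. norm (\<phi> (t * \<beta> k i) - 1))"
      by (rule norm_prod_diff) (auto simp: \<phi>)
    also have "\<dots> \<le> (\<Sum>i\<in>?T. 2 * t\<^sup>2 * (\<beta> k i)\<^sup>2)"
      using \<phi>(3) by (intro sum_mono) (metis mult.assoc power_mult_distrib)
    also have "\<dots> = 2 * t\<^sup>2 * (1 - (\<Sum>i<n. (\<beta> k i)\<^sup>2))" by (simp add: sum_distrib_left[symmetric] sq)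
    finally have T: "norm ((\<Prod>i\<in>?T. \<phi> (t * \<beta> k i)) - 1) < e / 3" using elim by simp
    have "dist (\<Prod>i<m k. \<phi> (t * \<beta> k i)) (\<Prod>i<n. \<phi> (t * \<beta> k i))
        = norm (\<Prod>i<n. \<phi> (t * \<beta> k i)) * norm ((\<Prod>i\<in>?T. \<phi> (t * \<beta> k i)) - 1)"
      unfolding split dist_norm norm_mult[symmetric] by (simp add: algebra_simps)
    also have "\<dots> \<le> 1 * norm ((\<Prod>i\<in>?T. \<phi> (t * \<beta> k i)) - 1)"
      by (intro mult_right_mono) (auto simp: prod_norm[symmetric] \<phi> intro!: prod_le_1)
    finally have "dist (\<Prod>i<m k. \<phi> (t * \<beta> k i)) (\<Prod>i<n. \<phi> (t * \<beta> k i)) < e / 3" using T by simp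
    then show ?case using elim n(2) dist_triangle[of "\<Prod>i<m k. \<phi> (t * \<beta> k i)" L "\<Prod>i<n. \<phi> (t * \<beta> k i)"]
        dist_triangle[of "\<Prod>i<n. \<phi> (t * \<beta> k i)" L "\<Prod>i<n. \<phi> (t * b i)"] by linarith
  qed
qed

section \<open>Weighted sums of centred chi-squares\<close>

lemma std_normal_exponential_moment:
  "has_bochner_integral std_normal_distribution (\<lambda>x. exp (- u * x)) (exp (u\<^sup>2 / 2))"
proof -
  have eq: "std_normal_density x * exp (- u * x) = exp (u\<^sup>2 / 2) * normal_density (- u) 1 x" for x
  proof -
    have "- x\<^sup>2 / 2 + - u * x = u\<^sup>2 / 2 + - (x + u)\<^sup>2 / 2" by (simp add: power2_eq_square field_simps)
    then have "exp (- x\<^sup>2 / 2) * exp (- u * x) = exp (u\<^sup>2 / 2) * exp (- (x + u)\<^sup>2 / 2)"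
      unfolding exp_add[symmetric] by simp
    then show ?thesis by (simp add: normal_density_def)
  qed
  have "has_bochner_integral lborel (\<lambda>x. exp (u\<^sup>2 / 2) * normal_density (- u) 1 x) (exp (u\<^sup>2 / 2) * 1)"
    by (intro has_bochner_integral_mult_right) (simp add: has_bochner_integral_iff)
  then have "has_bochner_integral lborel (\<lambda>x. std_normal_density x *\<^sub>R exp (- u * x)) (exp (u\<^sup>2 / 2))"
    unfolding real_scaleR_def eq by simp
  then show ?thesis by (intro has_bochner_integral_density) auto
qed

text \<open>Half of this, at sqrt 2 * u, is the amount by which the logarithm of the Laplace
  transform of a standardized chi-square falls below the Gaussian value u^2 / 2.\<close>

definition log_remainder :: "real \<Rightarrow> real" where
  "log_remainder y = y\<^sup>2 / 2 - y + ln (1 + y)"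

text \<open>The derivative is x^2 / (1 + x). Nonnegativity is the source of the bound exp (u^2 / 2),
  uniform over all weight sequences.\<close>

lemma log_remainder_nonneg:
  assumes "0 \<le> y"
  shows "0 \<le> log_remainder y"
proof -
  have "log_remainder 0 \<le> log_remainder y"
  proof (rule DERIV_nonneg_imp_nondecreasing[OF assms])
    fix x :: real assume x: "0 \<le> x"
    have "(log_remainder has_real_derivative (x - 1 + 1 / (1 + x))) (at x)"
      unfolding log_remainder_def[abs_def] using x by (auto intro!: derivative_eq_intros)
    moreover have "x - 1 + 1 / (1 + x) = x\<^sup>2 / (1 + x)" using x by (simp add: field_simps power2_eq_square)
    ultimately show "\<exists>d. (log_remainder has_real_derivative d) (at x) \<and> 0 \<le> d"
      using x by (intro exI[of _ "x\<^sup>2 / (1 + x)"]) auto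
  qed
  then show ?thesis by (simp add: log_remainder_def)
qed

text \<open>Where the exponential exceeds K it is at most its own square divided by K, and that
  square is the exponential at 2 u.\<close>

lemma min_exp_moment_bound:
  assumes \<mu>: "real_distribution \<mu>" and int: "integrable \<mu> (\<lambda>x. exp (- u * x))" "integrable \<mu> (\<lambda>x. exp (- (2 * u) * x))"
    and B: "(LINT x|\<mu>. exp (- (2 * u) * x)) \<le> B" and K: "K > 0"
  shows "\<bar>(LINT x|\<mu>. exp (- u * x)) - (LINT x|\<mu>. min (exp (- u * x)) K)\<bar> \<le> B / K"
proof -
  interpret real_distribution \<mu> by fact
  have i: "integrable \<mu> (\<lambda>x. min (exp (- u * x)) K)" using int by (intro integrable_min) auto
  have le: "\<bar>exp (- u * x) - min (exp (- u * x)) K\<bar> \<le> exp (- (2 * u) * x) / K" for x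
  proof (cases "exp (- u * x) \<le> K")
    case False
    have "exp (- u * x) * K \<le> exp (- u * x) * exp (- u * x)" using False by (intro mult_left_mono) auto
    also have "\<dots> = exp (- (2 * u) * x)" by (simp flip: exp_add)
    finally have "exp (- u * x) \<le> exp (- (2 * u) * x) / K" using K by (simp add: field_simps)
    then show ?thesis using False K by (simp add: min_def)
  qed (use K in auto)
  have "\<bar>(LINT x|\<mu>. exp (- u * x)) - (LINT x|\<mu>. min (exp (- u * x)) K)\<bar> \<le> (LINT x|\<mu>. \<bar>exp (- u * x) - min (exp (- u * x)) K\<bar>)"
    unfolding Bochner_Integration.integral_diff[OF int(1) i, symmetric] by (rule integral_abs_bound)
  also have "\<dots> \<le> (LINT x|\<mu>. exp (- (2 * u) * x) / K)"
    using int i le by (intro integral_mono) auto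
  also have "\<dots> \<le> B / K" using B K by (simp add: divide_right_mono)
  finally show ?thesis .
qed

lemma weak_conv_exponential_moment:
  assumes \<mu>: "\<And>k. real_distribution (\<mu> k)" and \<nu>: "real_distribution \<nu>" and conv: "weak_conv_m \<mu> \<nu>"
    and int: "\<And>k. integrable (\<mu> k) (\<lambda>x. exp (- u * x))" "\<And>k. integrable (\<mu> k) (\<lambda>x. exp (- (2 * u) * x))"
      "integrable \<nu> (\<lambda>x. exp (- u * x))" "integrable \<nu> (\<lambda>x. exp (- (2 * u) * x))"
    and B: "\<And>k. (LINT x|\<mu> k. exp (- (2 * u) * x)) \<le> B" "(LINT x|\<nu>. exp (- (2 * u) * x)) \<le> B"
  shows "(\<lambda>k. LINT x|\<mu> k. exp (- u * x)) \<longlonglongrightarrow> (LINT x|\<nu>. exp (- u * x))"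
proof (rule tendstoI)
  fix e :: real assume e: "e > 0"
  have B0: "0 \<le> B" using B(2) by (rule order.trans[rotated]) simp
  \<comment> \<open>The summand 1 keeps K positive when B = 0 and makes B / K strictly smaller than
    e / 3.\<close>
  define K where "K = 3 * (B + 1) / e"
  have K: "K > 0" "B / K < e / 3" using e B0 by (auto simp: K_def field_simps)
  have "(\<lambda>k. LINT x|\<mu> k. min (exp (- u * x)) K) \<longlonglongrightarrow> (LINT x|\<nu>. min (exp (- u * x)) K)"
  proof (rule weak_conv_imp_integral_bdd_continuous_conv[OF \<mu> \<nu> conv])
    show "norm (min (exp (- u * x)) K) \<le> K" for x using K by (simp add: abs_if min_def)
  qed (auto intro!: continuous_intros)
  then have "\<forall>\<^sub>F k in sequentially. dist (LINT x|\<mu> k. min (exp (- u * x)) K) (LINT x|\<nu>. min (exp (- u * x)) K) < e / 3"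
    using e by (intro tendstoD) auto
  then show "\<forall>\<^sub>F k in sequentially. dist (LINT x|\<mu> k. exp (- u * x)) (LINT x|\<nu>. exp (- u * x)) < e"
  proof eventually_elim
    case (elim k)
    show ?case
      using elim K(2) min_exp_moment_bound[OF \<mu> int(1,2) B(1) K(1), of k] min_exp_moment_bound[OF \<nu> int(3,4) B(2) K(1)]
      unfolding dist_real_def by linarith
  qed
qed

text \<open>This serves to pass from the family indexed by \<open>nat option\<close>, where
  \<open>None\<close> carries the normal variable, to the sequence of chi-squares alone.\<close>

lemma (in prob_space) indep_vars_reindex:
  assumes f: "inj_on f I" and X: "indep_vars M' X (f ` I)"
  shows "indep_vars (\<lambda>i. M' (f i)) (\<lambda>i. X (f i)) I"
  unfolding indep_vars_def2
proof (intro conjI ballI indep_setsI)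
  fix i assume i: "i \<in> I"
  show "random_variable (M' (f i)) (X (f i))" using X i by (auto simp: indep_vars_def2)
  then show "{X (f i) -` A \<inter> space M |A. A \<in> sets (M' (f i))} \<subseteq> events" by (auto simp: measurable_sets)
next
  fix A J assume J: "J \<noteq> {}" "J \<subseteq> I" "finite J"
    and A: "\<forall>j\<in>J. A j \<in> {X (f j) -` A \<inter> space M |A. A \<in> sets (M' (f j))}"
  have inj: "inj_on f J" using f J inj_on_subset by blast
  have "indep_sets (\<lambda>i. {X i -` A \<inter> space M |A. A \<in> sets (M' i)}) (f ` I)"
    using X by (simp add: indep_vars_def2)
  then have "prob (\<Inter>t\<in>f ` J. A (the_inv_into J f t)) = (\<Prod>t\<in>f ` J. prob (A (the_inv_into J f t)))"
    using J A by (intro indep_setsD) (auto simp: the_inv_into_f_f[OF inj])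
  then show "prob (\<Inter>j\<in>J. A j) = (\<Prod>j\<in>J. prob (A j))"
    by (simp add: prod.reindex[OF inj] the_inv_into_f_f[OF inj])
qed

text \<open>The common reference space: each statistic is matched in law with a variable built from
  this one family.\<close>

locale chi2_normal_sequence = prob_space P for P :: "'p measure" +
  fixes C :: "nat \<Rightarrow> 'p \<Rightarrow> real" and Z :: "'p \<Rightarrow> real"
  assumes C_chi2: "\<And>s. distr P borel (C s) = chi2_1"
    and Z_norm: "distributed P lborel Z std_normal_density"
    and CZ_indep: "indep_vars (\<lambda>_. borel) (\<lambda>t. case t of None \<Rightarrow> Z | Some s \<Rightarrow> C s) UNIV"
begin

lemma C_measurable [measurable]: "C s \<in> borel_measurable P"
  using CZ_indep unfolding indep_vars_def by (auto dest: spec[of _ "Some s"])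

lemma Z_measurable [measurable]: "Z \<in> borel_measurable P"
  using Z_norm by (auto simp: distributed_def)

lemma C_indep: "indep_vars (\<lambda>_. borel) C UNIV"
proof -
  have "indep_vars (\<lambda>_. borel) (\<lambda>s. case Some s of None \<Rightarrow> Z | Some s \<Rightarrow> C s) UNIV"
    by (rule indep_vars_reindex) (auto intro: indep_vars_subset[OF CZ_indep])
  then show ?thesis by simp
qed

definition D :: "nat \<Rightarrow> 'p \<Rightarrow> real" where
  "D s x = (C s x - 1) / sqrt 2"

lemma D_measurable [measurable]: "D s \<in> borel_measurable P"
  unfolding D_def[abs_def] by measurable

definition D_law :: "real measure" where
  "D_law = distr chi2_1 borel (\<lambda>c. (c - 1) / sqrt 2)"

lemma distr_D: "distr P borel (D s) = D_law"
  unfolding D_law_def C_chi2[of s, symmetric] by (subst distr_distr) (auto simp: o_def D_def[abs_def])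

lemma D_indep: "indep_vars (\<lambda>_. borel) D UNIV"
  unfolding D_def[abs_def] by (rule indep_vars_compose2[OF C_indep, of "\<lambda>_ c. (c - 1) / sqrt 2"]) auto

lemma real_distribution_D_law: "real_distribution D_law"
  unfolding distr_D[of 0, symmetric] by (rule real_distribution_distr) simp

lemma D_moments:
  shows "integrable P (D s)" "expectation (D s) = 0"
    "integrable P (\<lambda>x. (D s x)\<^sup>2)" "expectation (\<lambda>x. (D s x)\<^sup>2) = 1"
    "integrable P (\<lambda>x. \<bar>D s x\<bar> ^ 3)"
proof -
  interpret g: real_distribution std_normal_distribution by (rule real_dist_normal_dist)
  note I = integrable_std_normal_distribution_moment
  note chi = chi2_integral[OF C_measurable C_chi2, of _ s]
  \<comment> \<open>The fourth moment 3 gives g^2 the variance 3 - 1 = 2 for a standard normal g,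
    hence the normalization by sqrt 2.\<close>
  have m2: "(LINT x|std_normal_distribution. x\<^sup>2) = 1" and m4: "(LINT x|std_normal_distribution. x ^ 4) = 3"
    using std_normal_distribution_even_moments(1)[of 1] std_normal_distribution_even_moments(1)[of 2]
    by (simp_all add: fact_numeral)
  show "integrable P (D s)"
    unfolding D_def[abs_def] chi(1)[of "\<lambda>c. (c - 1) / sqrt 2", simplified] using I[of 2] by auto
  show "expectation (D s) = 0"
  proof -
    have "expectation (\<lambda>x. (C s x - 1) / sqrt 2) = (LINT x|std_normal_distribution. (x\<^sup>2 - 1) / sqrt 2)"
      by (rule chi(2)[of "\<lambda>c. (c - 1) / sqrt 2"]) simp
    also have "\<dots> = 0" using I[of 2] m2 g.prob_space by simp
    finally show ?thesis by (simp only: D_def[abs_def])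
  qed
  have sq: "((x\<^sup>2 - 1) / sqrt 2)\<^sup>2 = x ^ 4 / 2 - x\<^sup>2 + 1 / 2" for x :: real
    by (simp add: power_divide power2_eq_square eval_nat_numeral field_simps)
  show "integrable P (\<lambda>x. (D s x)\<^sup>2)"
    unfolding D_def chi(1)[of "\<lambda>c. ((c - 1) / sqrt 2)\<^sup>2", simplified] unfolding sq using I[of 2] I[of 4] by auto
  show "expectation (\<lambda>x. (D s x)\<^sup>2) = 1"
    unfolding D_def chi(2)[of "\<lambda>c. ((c - 1) / sqrt 2)\<^sup>2", simplified] unfolding sq using I[of 2] I[of 4] m2 m4 g.prob_space
    by simp
  have "integrable std_normal_distribution (\<lambda>x. \<bar>(x\<^sup>2 - 1) / sqrt 2\<bar> ^ 3)"
  proof (rule Bochner_Integration.integrable_bound)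
    show "integrable std_normal_distribution (\<lambda>x. x ^ 6 + 3 * x ^ 4 + 3 * x\<^sup>2 + 1)"
      using I[of 6] I[of 4] I[of 2] by auto
    have "\<bar>(x\<^sup>2 - 1) / sqrt 2\<bar> ^ 3 \<le> x ^ 6 + 3 * x ^ 4 + 3 * x\<^sup>2 + 1" for x :: real
    proof -
      have "\<bar>(x\<^sup>2 - 1) / sqrt 2\<bar> \<le> \<bar>x\<^sup>2 - 1\<bar> / 1" unfolding abs_divide by (intro divide_left_mono) auto
      also have "\<dots> \<le> x\<^sup>2 + 1" using zero_le_power2[of x] by (auto simp: abs_if)
      finally have "\<bar>(x\<^sup>2 - 1) / sqrt 2\<bar> ^ 3 \<le> (x\<^sup>2 + 1) ^ 3" by (rule power_mono) simp
      also have "\<dots> = x ^ 6 + 3 * x ^ 4 + 3 * x\<^sup>2 + 1" by (simp add: eval_nat_numeral algebra_simps)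
      finally show ?thesis .
    qed
    then show "AE x in std_normal_distribution. norm (\<bar>(x\<^sup>2 - 1) / sqrt 2\<bar> ^ 3) \<le> norm (x ^ 6 + 3 * x ^ 4 + 3 * x\<^sup>2 + 1)"
      by (intro AE_I2) (fastforce intro: order.trans[OF _ abs_ge_self])
  qed auto
  then show "integrable P (\<lambda>x. \<bar>D s x\<bar> ^ 3)"
    unfolding D_def by (subst chi(1)[of "\<lambda>c. \<bar>(c - 1) / sqrt 2\<bar> ^ 3"]) simp_all
qed

lemma D_law_char_bounds:
  obtains K where "0 \<le> K" "\<And>t. norm (char D_law t - 1) \<le> 2 * t\<^sup>2"
    "\<And>t. norm (char D_law t - exp (- (t\<^sup>2 / 2))) \<le> K * (\<bar>t\<bar> ^ 3 + t ^ 4)"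
proof -
  interpret L: real_distribution D_law by (rule real_distribution_D_law)
  note m = D_moments[of 0]
  have i: "integrable D_law (\<lambda>x. x)" "integrable D_law (\<lambda>x. x\<^sup>2)" "integrable D_law (\<lambda>x. \<bar>x\<bar> ^ 3)"
    "L.expectation (\<lambda>x. x) = 0" "L.expectation (\<lambda>x. x\<^sup>2) = 1"
    unfolding distr_D[of 0, symmetric] using m by (simp_all add: integrable_distr_eq integral_distr)
  show ?thesis
    using that[of "1 + L.expectation (\<lambda>x. \<bar>x\<bar> ^ 3)"] L.char_standardized_bounds[OF i] by simp
qed

text \<open>The chi-square transform contributes 1 / sqrt (1 + sqrt 2 * u) and the centring
  contributes exp (u / sqrt 2); the Gaussian part u^2 / 2 is then split off from the
  logarithm.\<close>

lemma D_exponential_moment: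
  assumes u: "0 \<le> u"
  shows "has_bochner_integral P (\<lambda>x. exp (- u * D s x)) (exp (u\<^sup>2 / 2 - log_remainder (sqrt 2 * u) / 2))"
proof -
  have "has_bochner_integral P (\<lambda>x. exp (u / sqrt 2) * exp (- (u / sqrt 2) * C s x)) (exp (u / sqrt 2) * (1 / sqrt (1 + 2 * (u / sqrt 2))))"
    using chi2_laplace[OF C_measurable C_chi2, of "u / sqrt 2" s] u by (intro has_bochner_integral_mult_right) auto
  also have "(\<lambda>x. exp (u / sqrt 2) * exp (- (u / sqrt 2) * C s x)) = (\<lambda>x. exp (- u * D s x))"
    unfolding exp_add[symmetric] by (simp add: D_def fun_eq_iff field_simps)
  also have "exp (u / sqrt 2) * (1 / sqrt (1 + 2 * (u / sqrt 2))) = exp (u\<^sup>2 / 2 - log_remainder (sqrt 2 * u) / 2)"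
  proof -
    have y: "2 * (u / sqrt 2) = sqrt 2 * u" by (simp add: field_simps)
    have pos: "1 + sqrt 2 * u > 0" using u by (simp add: add_pos_nonneg)
    have "1 / sqrt (1 + sqrt 2 * u) = exp (- (ln (1 + sqrt 2 * u) / 2))"
      using pos by (simp add: exp_minus ln_sqrt[symmetric] inverse_eq_divide)
    then have "exp (u / sqrt 2) * (1 / sqrt (1 + 2 * (u / sqrt 2))) = exp (u / sqrt 2 - ln (1 + sqrt 2 * u) / 2)"
      unfolding y by (simp flip: exp_add)
    also have "u / sqrt 2 - ln (1 + sqrt 2 * u) / 2 = u\<^sup>2 / 2 - log_remainder (sqrt 2 * u) / 2"
    proof -
      have "u / sqrt 2 = sqrt 2 * u / 2" by (simp add: field_simps)
      then show ?thesis by (simp add: log_remainder_def power_mult_distrib field_simps)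
    qed
    finally show ?thesis .
  qed
  finally show ?thesis .
qed

lemma Z_law: "distr P borel Z = std_normal_distribution"
proof -
  have "distr P borel Z = distr P lborel Z" by (rule distr_cong) auto
  then show ?thesis using Z_norm by (simp add: distributed_def)
qed

lemma Z_exponential_moment: "has_bochner_integral P (\<lambda>x. exp (- u * Z x)) (exp (u\<^sup>2 / 2))"
  using std_normal_exponential_moment[of u] unfolding Z_law[symmetric]
  by (simp add: has_bochner_integral_iff integrable_distr_eq integral_distr)

text \<open>If the squares of the weights sum to 1, the Gaussian part vanishes; the standardized quadratic form
  has a law of this shape as well.\<close>
definition chi2_mix :: "(nat \<Rightarrow> real) \<Rightarrow> nat \<Rightarrow> 'p \<Rightarrow> real" where
  "chi2_mix b r x = (\<Sum>s<r. b s * (C s x - 1) / sqrt 2) + sqrt (1 - (\<Sum>s<r. (b s)\<^sup>2)) * Z x"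

lemma chi2_mix_measurable [measurable]: "chi2_mix b r \<in> borel_measurable P"
  unfolding chi2_mix_def[abs_def] by measurable

lemma chi2_mix_eq_sum:
  "chi2_mix b r x = (\<Sum>t\<in>insert None (Some ` {..<r}). case t of None \<Rightarrow> sqrt (1 - (\<Sum>s<r. (b s)\<^sup>2)) * Z x | Some s \<Rightarrow> b s * D s x)"
  by (simp add: chi2_mix_def D_def sum.reindex)

lemma mix_indep:
  assumes [measurable]: "f \<in> borel_measurable borel" "\<And>s. g s \<in> borel_measurable borel"
  shows "indep_vars (\<lambda>_. borel) (\<lambda>t x. case t of None \<Rightarrow> f (Z x) | Some s \<Rightarrow> g s (D s x)) I"
proof -
  have "indep_vars (\<lambda>_. borel) (\<lambda>t x. (case t of None \<Rightarrow> f | Some s \<Rightarrow> (\<lambda>c. g s ((c - 1) / sqrt 2))) ((case t of None \<Rightarrow> Z | Some s \<Rightarrow> C s) x)) I"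
    by (rule indep_vars_compose2[OF indep_vars_subset[OF CZ_indep]]) (auto split: option.split)
  also have "(\<lambda>t x. (case t of None \<Rightarrow> f | Some s \<Rightarrow> (\<lambda>c. g s ((c - 1) / sqrt 2))) ((case t of None \<Rightarrow> Z | Some s \<Rightarrow> C s) x))
      = (\<lambda>t x. case t of None \<Rightarrow> f (Z x) | Some s \<Rightarrow> g s (D s x))"
    by (auto simp: fun_eq_iff D_def split: option.split)
  finally show ?thesis .
qed

lemma char_chi2_mix:
  assumes "(\<Sum>s<r. (b s)\<^sup>2) \<le> 1"
  shows "char (distr P borel (chi2_mix b r)) t = (\<Prod>s<r. char D_law (t * b s)) * exp (- (t\<^sup>2 / 2 * (1 - (\<Sum>s<r. (b s)\<^sup>2))))"
proof -
  define c where "c = sqrt (1 - (\<Sum>s<r. (b s)\<^sup>2))"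
  have c2: "c\<^sup>2 = 1 - (\<Sum>s<r. (b s)\<^sup>2)" using assms by (simp add: c_def)
  define X where "X = (\<lambda>t x. case t of None \<Rightarrow> c * Z x | Some s \<Rightarrow> b s * D s x)"
  have "indep_vars (\<lambda>_. borel) X (insert None (Some ` {..<r}))"
    unfolding X_def using mix_indep[of "\<lambda>z. c * z" "\<lambda>s z. b s * z"] by simp
  then have "char (distr P borel (\<lambda>x. \<Sum>t\<in>insert None (Some ` {..<r}). X t x)) t
      = (\<Prod>t'\<in>insert None (Some ` {..<r}). char (distr P borel (X t')) t)"
    by (rule char_distr_sum)
  also have "\<dots> = char (distr P borel (X None)) t * (\<Prod>s<r. char (distr P borel (X (Some s))) t)"
    by (subst prod.insert) (auto simp: prod.reindex)
  also have "char (distr P borel (X None)) t = char (distr P borel Z) (t * c)"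
    by (simp add: X_def char_def integral_distr mult_ac)
  also have "\<dots> = exp (- (t\<^sup>2 / 2 * (1 - (\<Sum>s<r. (b s)\<^sup>2))))"
    unfolding Z_law char_std_normal_distribution by (simp add: power_mult_distrib c2)
  also have "(\<Prod>s<r. char (distr P borel (X (Some s))) t) = (\<Prod>s<r. char D_law (t * b s))"
  proof (intro prod.cong refl)
    fix s
    show "char (distr P borel (X (Some s))) t = char D_law (t * b s)"
      unfolding distr_D[of s, symmetric] by (simp add: X_def char_def integral_distr mult_ac)
  qed
  finally have "char (distr P borel (\<lambda>x. \<Sum>t\<in>insert None (Some ` {..<r}). X t x)) t
      = exp (- (t\<^sup>2 / 2 * (1 - (\<Sum>s<r. (b s)\<^sup>2)))) * (\<Prod>s<r. char D_law (t * b s))" .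
  moreover have "chi2_mix b r = (\<lambda>x. \<Sum>t\<in>insert None (Some ` {..<r}). X t x)"
    by (rule ext) (unfold chi2_mix_eq_sum X_def c_def, rule refl)
  ultimately show ?thesis by (simp add: mult.commute)
qed

text \<open>The squares of all coefficients, that of Z included, sum to 1, so the Gaussian parts of
  the exponents combine to u^2 / 2. Only the logarithmic remainders still see the weights.\<close>

lemma chi2_mix_exponential_moment:
  assumes b: "\<And>s. 0 \<le> b s" and sq: "(\<Sum>s<r. (b s)\<^sup>2) \<le> 1" and u: "0 \<le> u"
  shows "has_bochner_integral P (\<lambda>x. exp (- u * chi2_mix b r x))
    (exp (u\<^sup>2 / 2 - (\<Sum>s<r. log_remainder (sqrt 2 * u * b s)) / 2))"
proof -
  define c where "c = sqrt (1 - (\<Sum>s<r. (b s)\<^sup>2))"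
  have c2: "c\<^sup>2 = 1 - (\<Sum>s<r. (b s)\<^sup>2)" using sq by (simp add: c_def)
  define X where "X = (\<lambda>t x. case t of None \<Rightarrow> exp (- (u * c) * Z x) | Some s \<Rightarrow> exp (- (u * b s) * D s x))"
  let ?I = "insert None (Some ` {..<r})"
  have ind: "indep_vars (\<lambda>_. borel) X ?I"
    unfolding X_def using mix_indep[of "\<lambda>z. exp (- (u * c) * z)" "\<lambda>s z. exp (- (u * b s) * z)"] by simp
  define E where "E = (\<lambda>t. case t of None \<Rightarrow> exp ((u * c)\<^sup>2 / 2) | Some s \<Rightarrow> exp ((u * b s)\<^sup>2 / 2 - log_remainder (sqrt 2 * (u * b s)) / 2))"
  have int: "has_bochner_integral P (X t) (E t)" for t
    unfolding X_def E_def using Z_exponential_moment[of "u * c"] D_exponential_moment[of "u * b _"] b u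
    by (auto split: option.split)
  have eq: "exp (- u * chi2_mix b r x) = (\<Prod>t\<in>?I. X t x)" for x
    by (simp add: chi2_mix_eq_sum X_def prod.reindex sum.reindex exp_sum[symmetric] exp_add[symmetric] c_def[symmetric]
        sum_negf sum_distrib_left algebra_simps)
  have "has_bochner_integral P (\<lambda>x. \<Prod>t\<in>?I. X t x) (\<Prod>t\<in>?I. E t)"
    using indep_vars_lebesgue_integral[OF _ ind] indep_vars_integrable[OF _ ind] int
    by (auto simp: has_bochner_integral_iff)
  also have "(\<Prod>t\<in>?I. E t) = exp ((u * c)\<^sup>2 / 2 + (\<Sum>s<r. (u * b s)\<^sup>2 / 2 - log_remainder (sqrt 2 * (u * b s)) / 2))"
    by (simp add: E_def prod.reindex exp_sum exp_add)
  also have "(u * c)\<^sup>2 / 2 + (\<Sum>s<r. (u * b s)\<^sup>2 / 2 - log_remainder (sqrt 2 * (u * b s)) / 2)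
     = u\<^sup>2 / 2 - (\<Sum>s<r. log_remainder (sqrt 2 * u * b s)) / 2"
  proof -
    define B where "B = (\<Sum>s<r. (b s)\<^sup>2)"
    have "(\<Sum>s<r. (u * b s)\<^sup>2 / 2 - log_remainder (sqrt 2 * (u * b s)) / 2)
        = u\<^sup>2 / 2 * B - (\<Sum>s<r. log_remainder (sqrt 2 * u * b s)) / 2"
      by (simp add: B_def sum_subtractf power_mult_distrib sum_distrib_left sum_divide_distrib mult.assoc)
    then show ?thesis unfolding power_mult_distrib c2 B_def[symmetric] by (simp add: field_simps)
  qed
  finally show ?thesis unfolding eq .
qed

lemma weak_conv_chi2_mix:
  fixes \<beta> :: "nat \<Rightarrow> nat \<Rightarrow> real" and b :: "nat \<Rightarrow> real"
  assumes \<beta>: "\<And>k. antimono (\<beta> k)" "\<And>k i. 0 \<le> \<beta> k i" "\<And>k i. i \<ge> m k \<Longrightarrow> \<beta> k i = 0"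
      "\<And>k. (\<Sum>i<m k. (\<beta> k i)\<^sup>2) = 1"
    and b: "\<And>i. i \<ge> r \<Longrightarrow> b i = 0" "(\<Sum>i<r. (b i)\<^sup>2) \<le> 1" and conv: "\<And>i. (\<lambda>k. \<beta> k i) \<longlonglongrightarrow> b i"
  shows "weak_conv_m (\<lambda>k. distr P borel (chi2_mix (\<beta> k) (m k))) (distr P borel (chi2_mix b r))"
proof (rule levy_continuity)
  fix t
  interpret L: real_distribution D_law by (rule real_distribution_D_law)
  obtain K where K: "0 \<le> K" "\<And>t. norm (char D_law t - exp (- (t\<^sup>2 / 2))) \<le> K * (\<bar>t\<bar> ^ 3 + t ^ 4)"
    using D_law_char_bounds by metis
  have "char (distr P borel (chi2_mix (\<beta> k) (m k))) t = (\<Prod>i<m k. char D_law (t * \<beta> k i))" for k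
    by (simp add: char_chi2_mix \<beta>)
  moreover have "(\<lambda>k. \<Prod>i<m k. char D_law (t * \<beta> k i))
      \<longlonglongrightarrow> (\<Prod>i<r. char D_law (t * b i)) * exp (- (t\<^sup>2 / 2 * (1 - (\<Sum>i<r. (b i)\<^sup>2))))"
    by (rule prod_char_tendsto_finite_support[OF L.cmod_char_le_1 L.isCont_char L.char_zero K(2,1) \<beta> b(1) conv])
  ultimately show "(\<lambda>k. char (distr P borel (chi2_mix (\<beta> k) (m k))) t) \<longlonglongrightarrow> char (distr P borel (chi2_mix b r)) t"
    by (simp add: char_chi2_mix b)
qed (auto intro!: real_distribution_distr)

text \<open>Weak convergence gives convergence of the exponential moments, because those at 2 u are
  uniformly bounded. The moments are positive, so taking logarithms isolates the sums of
  remainders.\<close>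

lemma weak_conv_chi2_mix_imp_tendsto:
  fixes \<beta> :: "nat \<Rightarrow> nat \<Rightarrow> real" and b :: "nat \<Rightarrow> real"
  assumes \<beta>: "\<And>k. antimono (\<beta> k)" "\<And>k i. 0 \<le> \<beta> k i" "\<And>k i. i \<ge> m k \<Longrightarrow> \<beta> k i = 0"
      "\<And>k. (\<Sum>i<m k. (\<beta> k i)\<^sup>2) = 1"
    and b: "antimono b" "\<And>i. 0 \<le> b i" "\<And>i. i \<ge> r \<Longrightarrow> b i = 0" "(\<Sum>i<r. (b i)\<^sup>2) \<le> 1"
    and conv: "weak_conv_m (\<lambda>k. distr P borel (chi2_mix (\<beta> k) (m k))) (distr P borel (chi2_mix b r))"
  shows "(\<lambda>k. \<beta> k s) \<longlonglongrightarrow> b s"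
proof -
  have \<beta>1: "(\<Sum>i<m k. (\<beta> k i)\<^sup>2) \<le> 1" for k using \<beta>(4)[of k] by simp
  have mom: "integrable (distr P borel (chi2_mix c n)) (\<lambda>x. exp (- u * x))"
      "(LINT x|distr P borel (chi2_mix c n). exp (- u * x)) = exp (u\<^sup>2 / 2 - (\<Sum>s<n. log_remainder (sqrt 2 * u * c s)) / 2)"
    if "\<And>s. 0 \<le> c s" "(\<Sum>s<n. (c s)\<^sup>2) \<le> 1" "0 \<le> u" for c n u
    using chi2_mix_exponential_moment[OF that] by (simp_all add: has_bochner_integral_iff integrable_distr_eq integral_distr)
  have bound: "(LINT x|distr P borel (chi2_mix c n). exp (- u * x)) \<le> exp (u\<^sup>2 / 2)"
    if "\<And>s. 0 \<le> c s" "(\<Sum>s<n. (c s)\<^sup>2) \<le> 1" "0 \<le> u" for c n u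
    unfolding mom(2)[OF that] using that by (auto intro!: sum_nonneg log_remainder_nonneg)
  have log_conv: "(\<lambda>k. \<Sum>i<m k. log_remainder (v * \<beta> k i)) \<longlonglongrightarrow> (\<Sum>i<r. log_remainder (v * b i))" if v: "v > 0" for v
  proof -
    \<comment> \<open>This choice compensates the factor sqrt 2 in the argument of
      \<open>log_remainder\<close>.\<close>
    define u where "u = v / sqrt 2"
    have u: "0 \<le> u" "sqrt 2 * u = v" using v by (auto simp: u_def)
    have u2: "0 \<le> 2 * u" using u by simp
    have "(\<lambda>k. LINT x|distr P borel (chi2_mix (\<beta> k) (m k)). exp (- u * x)) \<longlonglongrightarrow> (LINT x|distr P borel (chi2_mix b r). exp (- u * x))"
      by (rule weak_conv_exponential_moment[OF _ _ conv mom(1)[OF \<beta>(2) \<beta>1 u(1)] mom(1)[OF \<beta>(2) \<beta>1 u2] mom(1)[OF b(2,4) u(1)] mom(1)[OF b(2,4) u2]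
            bound[OF \<beta>(2) \<beta>1 u2] bound[OF b(2,4) u2]]) (auto intro!: real_distribution_distr)
    then have "(\<lambda>k. exp (u\<^sup>2 / 2 - (\<Sum>i<m k. log_remainder (v * \<beta> k i)) / 2)) \<longlonglongrightarrow> exp (u\<^sup>2 / 2 - (\<Sum>i<r. log_remainder (v * b i)) / 2)"
      by (simp only: mom(2)[OF \<beta>(2) \<beta>1 u(1)] mom(2)[OF b(2,4) u(1)] u(2))
    from tendsto_ln[OF this]
    have "(\<lambda>k. u\<^sup>2 / 2 - (\<Sum>i<m k. log_remainder (v * \<beta> k i)) / 2) \<longlonglongrightarrow> u\<^sup>2 / 2 - (\<Sum>i<r. log_remainder (v * b i)) / 2"
      by simp
    from tendsto_mult_left[OF tendsto_diff[OF tendsto_const this], of 2 "u\<^sup>2 / 2"]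
    show ?thesis by simp
  qed
  show ?thesis
    by (rule power_sums_tendsto_imp_tendsto[OF \<beta>(1,2,3) \<beta>1 b
          log_sums_tendsto_imp_power_sums_tendsto[OF \<beta>(2) \<beta>1 b(2,4) log_conv[unfolded log_remainder_def]]])
qed

text \<open>The characteristic function of the infinite series is the limit of the partial products,
  by almost sure convergence and dominated convergence; the product limit for square sum 1 then
  applies.\<close>

lemma weak_conv_chi2_series:
  fixes \<beta> :: "nat \<Rightarrow> nat \<Rightarrow> real" and b :: "nat \<Rightarrow> real"
  assumes \<beta>: "\<And>k i. i \<ge> m k \<Longrightarrow> \<beta> k i = 0" "\<And>k. (\<Sum>i<m k. (\<beta> k i)\<^sup>2) = 1"
    and b: "(\<lambda>i. (b i)\<^sup>2) sums 1" and conv: "\<And>i. (\<lambda>k. \<beta> k i) \<longlonglongrightarrow> b i"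
  shows "weak_conv_m (\<lambda>k. distr P borel (chi2_mix (\<beta> k) (m k))) (distr P borel (\<lambda>x. \<Sum>s. b s * (C s x - 1) / sqrt 2))"
proof (rule levy_continuity)
  fix t
  interpret L: real_distribution D_law by (rule real_distribution_D_law)
  have sum_eq: "(\<lambda>x. \<Sum>s. b s * (C s x - 1) / sqrt 2) = (\<lambda>x. \<Sum>s. b s * D s x)" by (simp add: D_def)
  have ind: "indep_vars (\<lambda>_. borel) (\<lambda>s x. b s * D s x) UNIV"
    by (rule indep_vars_compose2[OF D_indep, of "\<lambda>s y. b s * y"]) auto
  have "AE x in P. summable (\<lambda>s. b s * D s x)"
  proof (rule AE_summable_of_summable_variance[OF ind])
    show "expectation (\<lambda>x. b s * D s x) = 0" "integrable P (\<lambda>x. (b s * D s x)\<^sup>2)" for s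
      using D_moments[of s] by (auto simp: power_mult_distrib)
    show "summable (\<lambda>s. expectation (\<lambda>x. (b s * D s x)\<^sup>2))"
      using D_moments(4) b by (simp add: power_mult_distrib sums_iff)
  qed
  then have ae: "AE x in P. (\<lambda>n. iexp (t * (\<Sum>s<n. b s * D s x))) \<longlonglongrightarrow> iexp (t * (\<Sum>s. b s * D s x))"
  proof eventually_elim
    case (elim x)
    show ?case by (intro tendsto_intros summable_LIMSEQ elim)
  qed
  have "(\<lambda>n. CLINT x|P. iexp (t * (\<Sum>s<n. b s * D s x))) \<longlonglongrightarrow> (CLINT x|P. iexp (t * (\<Sum>s. b s * D s x)))"
    by (rule integral_dominated_convergence[where w = "\<lambda>_. 1", OF _ _ _ ae]) auto
  moreover have "(CLINT x|P. iexp (t * (\<Sum>s<n. b s * D s x))) = (\<Prod>s<n. char D_law (t * b s))" for n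
  proof -
    have "(CLINT x|P. iexp (t * (\<Sum>s<n. b s * D s x))) = char (distr P borel (\<lambda>x. \<Sum>s<n. b s * D s x)) t"
      by (simp add: char_def integral_distr)
    also have "\<dots> = (\<Prod>s<n. char (distr P borel (\<lambda>x. b s * D s x)) t)"
      by (rule char_distr_sum, rule indep_vars_subset[OF ind]) auto
    also have "\<dots> = (\<Prod>s<n. char D_law (t * b s))"
    proof (intro prod.cong refl)
      fix s
      show "char (distr P borel (\<lambda>x. b s * D s x)) t = char D_law (t * b s)"
        unfolding distr_D[of s, symmetric] by (simp add: char_def integral_distr mult_ac)
    qed
    finally show ?thesis .
  qed
  ultimately have L: "(\<lambda>n. \<Prod>s<n. char D_law (t * b s)) \<longlonglongrightarrow> char (distr P borel (\<lambda>x. \<Sum>s. b s * D s x)) t"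
    by (simp add: char_def integral_distr)
  have le2: "norm (char D_law t - 1) \<le> 2 * t\<^sup>2" for t
    using D_law_char_bounds by metis
  have "char (distr P borel (chi2_mix (\<beta> k) (m k))) t = (\<Prod>i<m k. char D_law (t * \<beta> k i))" for k
    by (simp add: char_chi2_mix \<beta>)
  moreover have "(\<lambda>k. \<Prod>i<m k. char D_law (t * \<beta> k i)) \<longlonglongrightarrow> char (distr P borel (\<lambda>x. \<Sum>s. b s * D s x)) t"
    by (rule prod_char_tendsto_unit_square_sum[OF L.cmod_char_le_1 L.isCont_char le2 \<beta> b conv L])
  ultimately show "(\<lambda>k. char (distr P borel (chi2_mix (\<beta> k) (m k))) t)
      \<longlonglongrightarrow> char (distr P borel (\<lambda>x. \<Sum>s. b s * (C s x - 1) / sqrt 2)) t"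
    unfolding sum_eq by simp
qed (auto intro!: real_distribution_distr)

end

section \<open>The law of the standardized statistic\<close>

lemma (in prob_space) normal_iexp_integral:
  assumes U: "distributed M lborel U (normal_density \<mu> \<sigma>)" and \<sigma>: "\<sigma> > 0"
  shows "(CLINT x|M. iexp (t * U x)) = iexp (t * \<mu>) * exp (- (t\<^sup>2 * \<sigma>\<^sup>2 / 2))"
proof -
  define V where "V = (\<lambda>x. (U x - \<mu>) / \<sigma>)"
  have V: "distributed M lborel V std_normal_density"
    unfolding V_def using U normal_standard_normal_convert[OF \<sigma>] by blast
  then have [measurable]: "V \<in> borel_measurable M" by (auto simp: distributed_def)
  have "distr M borel V = distr M lborel V" by (rule distr_cong) auto
  then have law: "distr M borel V = std_normal_distribution" using V by (simp add: distributed_def)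
  have "(CLINT x|M. iexp (t * U x)) = (CLINT x|M. iexp (t * \<mu>) * iexp ((t * \<sigma>) * V x))"
    using \<sigma> by (intro Bochner_Integration.integral_cong) (simp_all add: V_def field_simps flip: exp_add)
  also have "\<dots> = iexp (t * \<mu>) * (CLINT x|M. iexp ((t * \<sigma>) * V x))" by simp
  also have "(CLINT x|M. iexp ((t * \<sigma>) * V x)) = char (distr M borel V) (t * \<sigma>)"
    by (simp add: char_def integral_distr)
  also have "\<dots> = exp (- (t\<^sup>2 * \<sigma>\<^sup>2 / 2))"
    unfolding law char_std_normal_distribution by (simp add: power_mult_distrib)
  finally show ?thesis .
qed

text \<open>The zero combination needs its own case: \<open>mvnormal\<close> constrains only nonzero
  ones, and the degenerate normal law has no density.\<close>

lemma (in prob_space) mvnormal_iexp_integral: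
  assumes Y: "mvnormal M Y d m S" and S: "pos_def d S" and m: "dim_vec m = d"
  shows "(CLINT x|M. iexp (t * (\<Sum>s<d. v s * Y x s)))
    = iexp (t * (\<Sum>s<d. v s * m $ s)) * exp (- (t\<^sup>2 * (\<Sum>s<d. \<Sum>s'<d. v s * S $$ (s, s') * v s') / 2))"
proof (cases "\<exists>s<d. v s \<noteq> 0")
  case True
  let ?v = "vec d v :: real vec"
  have Sc: "S \<in> carrier_mat d d" using S by (simp add: pos_def_def)
  have v0: "?v \<noteq> 0\<^sub>v d" using True by (metis index_vec index_zero_vec(1))
  have q: "scalar_prod ?v (S *\<^sub>v ?v) = (\<Sum>s<d. \<Sum>s'<d. v s * S $$ (s, s') * v s')"
    using Sc by (simp add: scalar_prod_def lessThan_atLeast0 sum_distrib_left mult_ac)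
  have qpos: "0 < (\<Sum>s<d. \<Sum>s'<d. v s * S $$ (s, s') * v s')"
    using True pos_def_quadratic(2)[OF S] by blast
  have "distributed M lborel (\<lambda>\<omega>. \<Sum>s<d. ?v $ s * Y \<omega> s)
      (normal_density (scalar_prod ?v m) (sqrt (scalar_prod ?v (S *\<^sub>v ?v))))"
    using Y v0 unfolding mvnormal_def by auto
  then have "distributed M lborel (\<lambda>\<omega>. \<Sum>s<d. v s * Y \<omega> s)
      (normal_density (\<Sum>s<d. v s * m $ s) (sqrt (\<Sum>s<d. \<Sum>s'<d. v s * S $$ (s, s') * v s')))"
    unfolding q using m by (simp add: scalar_prod_def lessThan_atLeast0)
  from normal_iexp_integral[OF this, of t] qpos show ?thesis by simp
next
  case False
  then show ?thesis by (simp add: prob_space)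
qed

text \<open>A linear functional of the scaled means is a sum over independent observations, so its
  characteristic function is a product. Within a group all n i factors coincide, and their n i-th
  power produces the block coefficient N / n i of V.\<close>

lemma (in prob_space) group_means_iexp_integral:
  fixes X :: "nat \<Rightarrow> nat \<Rightarrow> 'a \<Rightarrow> nat \<Rightarrow> real" and w :: "nat \<Rightarrow> real"
  assumes n: "\<And>i. i < a \<Longrightarrow> n i \<ge> 1" and S: "pos_def d S" and mu: "\<And>i. i < a \<Longrightarrow> dim_vec (mu i) = d"
    and normal: "\<And>i j. i < a \<Longrightarrow> j < n i \<Longrightarrow> mvnormal M (X i j) d (mu i) S"
    and indep: "indep_vars (\<lambda>_. PiM {..<d} (\<lambda>_. borel)) (\<lambda>(i, j) \<omega>. restrict (X i j \<omega>) {..<d}) {(i, j). i < a \<and> j < n i}"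
  shows "(CLINT \<omega>|M. iexp (\<Sum>p<a * d. w p * (sqrt (totalN a n) * group_means a d n (\<lambda>i j. X i j \<omega>) $ p)))
    = iexp (sqrt (totalN a n) * (\<Sum>p<a * d. w p * stack a d mu $ p))
      * exp (- (\<Sum>p<a * d. \<Sum>q<a * d. w p * VN a d n S $$ (p, q) * w q) / 2)"
proof -
  define c where "c = (\<lambda>i. sqrt (totalN a n) / real (n i))"
  define I where "I = (SIGMA i:{..<a}. {..<n i})"
  have I: "{(i, j). i < a \<and> j < n i} = I" by (auto simp: I_def)
  define L where "L = (\<lambda>(i, j) \<omega>. \<Sum>s<d. w (i * d + s) * X i j \<omega> s)"
  define q where "q = (\<lambda>i. \<Sum>s<d. \<Sum>t<d. w (i * d + s) * S $$ (s, t) * w (i * d + t))"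
  define e where "e = (\<lambda>i. \<Sum>s<d. w (i * d + s) * mu i $ s)"
  have lin: "(\<Sum>p<a * d. w p * (sqrt (totalN a n) * group_means a d n (\<lambda>i j. X i j \<omega>) $ p)) = (\<Sum>t\<in>I. c (fst t) * L t \<omega>)" for \<omega>
  proof -
    have "(\<Sum>p<a * d. w p * (sqrt (totalN a n) * group_means a d n (\<lambda>i j. X i j \<omega>) $ p))
      = (\<Sum>p<a * d. c (p div d) * (w (p div d * d + p mod d) * (\<Sum>j<n (p div d). X (p div d) j \<omega> (p mod d))))"
      by (intro sum.cong refl) (simp add: group_means_def c_def)
    also have "\<dots> = (\<Sum>i<a. \<Sum>s<d. c i * (w (i * d + s) * (\<Sum>j<n i. X i j \<omega> s)))"
      by (rule sum_div_mod[of "\<lambda>i s. c i * (w (i * d + s) * (\<Sum>j<n i. X i j \<omega> s))"])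
    also have "\<dots> = (\<Sum>i<a. \<Sum>s<d. \<Sum>j<n i. c i * (w (i * d + s) * X i j \<omega> s))"
      by (simp add: sum_distrib_left)
    also have "\<dots> = (\<Sum>i<a. \<Sum>j<n i. \<Sum>s<d. c i * (w (i * d + s) * X i j \<omega> s))"
      by (intro sum.cong refl sum.swap)
    also have "\<dots> = (\<Sum>(i, j)\<in>I. c i * L (i, j) \<omega>)"
      unfolding I_def by (subst sum.Sigma) (auto simp: L_def sum_distrib_left)
    finally show ?thesis by (simp add: split_beta')
  qed
  have ind: "indep_vars (\<lambda>_. borel) (\<lambda>t \<omega>. c (fst t) * L t \<omega>) I"
  proof -
    have "indep_vars (\<lambda>_. borel) (\<lambda>t \<omega>. (\<lambda>x. c (fst t) * (\<Sum>s<d. w (fst t * d + s) * x s))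
        ((\<lambda>(i, j) \<omega>. restrict (X i j \<omega>) {..<d}) t \<omega>)) I"
      by (rule indep_vars_compose2[OF indep[unfolded I]]) measurable
    then show ?thesis by (simp add: L_def split_beta')
  qed
  have char1: "char (distr M borel (\<lambda>\<omega>. c (fst t) * L t \<omega>)) 1 = iexp (c (fst t) * e (fst t)) * exp (- ((c (fst t))\<^sup>2 * q (fst t) / 2))"
    if t: "t \<in> I" for t
  proof -
    obtain i j where ij: "t = (i, j)" "i < a" "j < n i" using t by (auto simp: I_def)
    have [measurable]: "(\<lambda>\<omega>. c (fst t) * L t \<omega>) \<in> borel_measurable M" using ind t by (auto simp: indep_vars_def)
    have "char (distr M borel (\<lambda>\<omega>. c (fst t) * L t \<omega>)) 1 = (CLINT \<omega>|M. iexp (c i * (\<Sum>s<d. w (i * d + s) * X i j \<omega> s)))"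
      by (simp add: char_def integral_distr) (simp add: ij L_def)
    also have "\<dots> = iexp (c i * e i) * exp (- ((c i)\<^sup>2 * q i / 2))"
      unfolding e_def q_def by (rule mvnormal_iexp_integral[OF normal[OF ij(2,3)] S mu[OF ij(2)]])
    finally show ?thesis by (simp add: ij)
  qed
  \<comment> \<open>The coefficient of one observation is sqrt N / n i; n i copies of it give sqrt N
    in the mean, and n i copies of its square give N / n i in the variance.\<close>
  have c1: "real (n i) * c i = sqrt (totalN a n)" and c2: "real (n i) * (c i)\<^sup>2 = real (totalN a n) / real (n i)" if "i < a" for i
    using n[OF that] by (auto simp: c_def power_divide power2_eq_square)
  have "(CLINT \<omega>|M. iexp (\<Sum>p<a * d. w p * (sqrt (totalN a n) * group_means a d n (\<lambda>i j. X i j \<omega>) $ p)))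
      = (CLINT \<omega>|M. iexp (\<Sum>t\<in>I. c (fst t) * L t \<omega>))" by (simp only: lin)
  also have "\<dots> = char (distr M borel (\<lambda>\<omega>. \<Sum>t\<in>I. c (fst t) * L t \<omega>)) 1"
  proof -
    have [measurable]: "(\<lambda>\<omega>. c (fst t) * L t \<omega>) \<in> borel_measurable M" if "t \<in> I" for t using ind that by (auto simp: indep_vars_def)
    have "(\<lambda>\<omega>. \<Sum>t\<in>I. c (fst t) * L t \<omega>) \<in> borel_measurable M" by measurable
    then show ?thesis unfolding char_def by (subst integral_distr) auto
  qed
  also have "\<dots> = (\<Prod>t\<in>I. char (distr M borel (\<lambda>\<omega>. c (fst t) * L t \<omega>)) 1)"
    by (rule char_distr_sum[OF ind])
  also have "\<dots> = (\<Prod>t\<in>I. iexp (c (fst t) * e (fst t)) * exp (- ((c (fst t))\<^sup>2 * q (fst t) / 2)))"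
    by (intro prod.cong refl char1)
  also have "\<dots> = (\<Prod>i<a. \<Prod>j<n i. iexp (c i * e i) * exp (- ((c i)\<^sup>2 * q i / 2)))"
    unfolding I_def by (subst prod.Sigma) (auto simp: split_beta')
  also have "\<dots> = (\<Prod>i<a. iexp (sqrt (totalN a n) * e i) * exp (- (real (totalN a n) / real (n i) * q i / 2)))"
  proof (intro prod.cong refl)
    fix i assume "i \<in> {..<a}"
    then have i: "i < a" by simp
    have "(iexp (c i * e i)) ^ n i = iexp (sqrt (totalN a n) * e i)"
      unfolding c1[OF i, symmetric] by (simp add: exp_of_nat_mult[symmetric] mult_ac)
    moreover have "exp (- ((c i)\<^sup>2 * q i / 2)) ^ n i = exp (- (real (totalN a n) / real (n i) * q i / 2))"
      unfolding c2[OF i, symmetric] by (simp add: exp_of_nat_mult[symmetric] mult_ac)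
    ultimately show "(\<Prod>j<n i. iexp (c i * e i) * exp (- ((c i)\<^sup>2 * q i / 2)))
        = iexp (sqrt (totalN a n) * e i) * exp (- (real (totalN a n) / real (n i) * q i / 2))"
      by (simp add: power_mult_distrib flip: of_real_power)
  qed
  also have "\<dots> = iexp (sqrt (totalN a n) * (\<Sum>i<a. e i)) * exp (- (\<Sum>i<a. real (totalN a n) / real (n i) * q i) / 2)"
    by (simp add: prod.distrib exp_sum[symmetric] sum_distrib_left sum_negf sum_divide_distrib flip: of_real_prod)
  also have "(\<Sum>i<a. e i) = (\<Sum>p<a * d. w p * stack a d mu $ p)"
  proof -
    have "(\<Sum>p<a * d. w p * stack a d mu $ p) = (\<Sum>p<a * d. w (p div d * d + p mod d) * mu (p div d) $ (p mod d))"
      by (intro sum.cong refl) (simp add: stack_def)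
    also have "\<dots> = (\<Sum>i<a. \<Sum>s<d. w (i * d + s) * mu i $ s)"
      by (rule sum_div_mod[of "\<lambda>i s. w (i * d + s) * mu i $ s"])
    finally show ?thesis by (simp add: e_def)
  qed
  also have "(\<Sum>i<a. real (totalN a n) / real (n i) * q i) = (\<Sum>p<a * d. \<Sum>q<a * d. w p * VN a d n S $$ (p, q) * w q)"
    unfolding VN_quadratic_form q_def ..
  finally show ?thesis .
qed

section \<open>Reduction of the statistic to the reference variables\<close>

lemma sum_mult_sum_swap:
  fixes x y :: "nat \<Rightarrow> real" and A :: "nat \<Rightarrow> nat \<Rightarrow> real"
  shows "(\<Sum>p<m. x p * (\<Sum>q<m. A p q * y q)) = (\<Sum>q<m. (\<Sum>p<m. A p q * x p) * y q)"
proof -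
  have "(\<Sum>p<m. x p * (\<Sum>q<m. A p q * y q)) = (\<Sum>p<m. \<Sum>q<m. A p q * x p * y q)"
    by (simp add: sum_distrib_left mult_ac)
  also have "\<dots> = (\<Sum>q<m. \<Sum>p<m. A p q * x p * y q)" by (rule sum.swap)
  finally show ?thesis by (simp add: sum_distrib_right)
qed

text \<open>Idempotence supplies a second factor T and symmetry moves it to the other side, which
  turns the form into a squared norm.\<close>

lemma orth_proj_quadratic_form:
  fixes x :: "nat \<Rightarrow> real"
  assumes T: "orth_proj m T"
  shows "(\<Sum>p<m. x p * (\<Sum>q<m. T $$ (p, q) * x q)) = (\<Sum>p<m. (\<Sum>q<m. T $$ (p, q) * x q)\<^sup>2)"
proof -
  have Tc: "T \<in> carrier_mat m m" and TT: "transpose_mat T = T" and T2: "T * T = T" using T by (auto simp: orth_proj_def)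
  have sym: "T $$ (p, q) = T $$ (q, p)" if "p < m" "q < m" for p q
    using TT Tc that by (metis carrier_matD index_transpose_mat(1))
  define y where "y = (\<lambda>p. \<Sum>q<m. T $$ (p, q) * x q)"
  have idem: "(\<Sum>r<m. T $$ (p, r) * y r) = y p" if "p < m" for p
  proof -
    have "(\<Sum>r<m. T $$ (p, r) * y r) = (\<Sum>q<m. (\<Sum>r<m. T $$ (p, r) * T $$ (r, q)) * x q)"
      unfolding y_def sum_mult_sum_swap by (simp add: mult.commute)
    also have "\<dots> = (\<Sum>q<m. (T * T) $$ (p, q) * x q)"
      using Tc that by (simp add: scalar_prod_def lessThan_atLeast0)
    finally show ?thesis by (simp add: T2 y_def)
  qed
  have "(\<Sum>p<m. (y p)\<^sup>2) = (\<Sum>p<m. y p * (\<Sum>q<m. T $$ (p, q) * x q))"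
    by (simp add: power2_eq_square y_def)
  also have "\<dots> = (\<Sum>q<m. (\<Sum>p<m. T $$ (p, q) * y p) * x q)" by (rule sum_mult_sum_swap)
  also have "\<dots> = (\<Sum>q<m. (\<Sum>p<m. T $$ (q, p) * y p) * x q)"
    by (intro sum.cong refl arg_cong2[of _ _ _ _ times]) (simp add: sym)
  also have "\<dots> = (\<Sum>q<m. x q * y q)" by (intro sum.cong refl) (simp add: idem)
  finally show ?thesis by (simp add: y_def)
qed

lemma parseval_of_completeness:
  fixes u :: "nat \<Rightarrow> nat \<Rightarrow> real"
  assumes "\<And>p q. p < m \<Longrightarrow> q < m \<Longrightarrow> (\<Sum>i<m. u i p * u i q) = (if p = q then 1 else 0)"
  shows "(\<Sum>i<m. (\<Sum>p<m. u i p * y p)\<^sup>2) = (\<Sum>p<m. (y p)\<^sup>2)"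
proof -
  have "(\<Sum>i<m. (\<Sum>p<m. u i p * y p)\<^sup>2) = (\<Sum>i<m. \<Sum>p<m. \<Sum>q<m. y p * y q * (u i p * u i q))"
    by (simp add: power2_eq_square sum_product mult_ac)
  also have "\<dots> = (\<Sum>p<m. \<Sum>i<m. \<Sum>q<m. y p * y q * (u i p * u i q))" by (rule sum.swap)
  also have "\<dots> = (\<Sum>p<m. \<Sum>q<m. \<Sum>i<m. y p * y q * (u i p * u i q))" by (intro sum.cong refl sum.swap)
  also have "\<dots> = (\<Sum>p<m. \<Sum>q<m. if p = q then y p * y q else 0)"
    by (intro sum.cong refl) (simp add: assms sum_distrib_left[symmetric])
  also have "\<dots> = (\<Sum>p<m. (y p)\<^sup>2)" by (simp add: sum.delta' power2_eq_square)
  finally show ?thesis .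
qed

lemma beta_properties:
  fixes TW TS S :: "real mat" and n :: "nat \<Rightarrow> nat"
  assumes W: "orth_proj a TW" "TW \<noteq> 0\<^sub>m a a" and TS: "orth_proj d TS" "TS \<noteq> 0\<^sub>m d d"
    and S: "pos_def d S" and n: "\<And>i. i < a \<Longrightarrow> n i \<ge> 1"
  shows "antimono (beta a d n TW TS S)" "0 \<le> beta a d n TW TS S s"
    "s \<ge> a * d \<Longrightarrow> beta a d n TW TS S s = 0" "(\<Sum>s<a * d. (beta a d n TW TS S s)\<^sup>2) = 1"
proof -
  define m where "m = a * d"
  obtain u l where ul: "design_eigensystem a d n TW TS S u l"
    using design_spectral[where n = n, OF W TS S n] by blast
  have anti: "\<And>i j. i \<le> j \<Longrightarrow> j < m \<Longrightarrow> l j \<le> l i" and pos: "\<And>i. i < m \<Longrightarrow> 0 \<le> l i"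
    and l2: "0 < (\<Sum>i<m. (l i)\<^sup>2)"
    and beta: "\<And>s. beta a d n TW TS S s = (if s < m then l s / sqrt (\<Sum>i<m. (l i)\<^sup>2) else 0)"
    using ul unfolding design_eigensystem_def m_def[symmetric] by simp_all
  show "antimono (beta a d n TW TS S)"
    using l2 pos by (intro antimonoI) (auto simp: beta intro!: divide_right_mono anti divide_nonneg_pos)
  show "0 \<le> beta a d n TW TS S s" using pos l2 by (simp add: beta)
  show "s \<ge> a * d \<Longrightarrow> beta a d n TW TS S s = 0" by (simp add: beta m_def)
  show "(\<Sum>s<a * d. (beta a d n TW TS S s)\<^sup>2) = 1"
    using l2 by (simp add: beta m_def[symmetric] power_divide sum_divide_distrib[symmetric])
qed

context chi2_normal_sequence
begin

lemma distr_Wtilde: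
  fixes M :: "'w measure" and X :: "nat \<Rightarrow> nat \<Rightarrow> 'w \<Rightarrow> nat \<Rightarrow> real" and TW TS S :: "real mat" and n :: "nat \<Rightarrow> nat"
  assumes W: "orth_proj a TW" "TW \<noteq> 0\<^sub>m a a" and TS: "orth_proj d TS" "TS \<noteq> 0\<^sub>m d d"
    and S: "pos_def d S" and n: "\<And>i. i < a \<Longrightarrow> n i \<ge> 1" and mu: "\<And>i. i < a \<Longrightarrow> dim_vec (mu i) = d"
    and H0: "kron TW TS *\<^sub>v stack a d mu = 0\<^sub>v (a * d)" and M: "prob_space M"
    and normal: "\<And>i j. i < a \<Longrightarrow> j < n i \<Longrightarrow> mvnormal M (X i j) d (mu i) S"
    and indep: "prob_space.indep_vars M (\<lambda>_. PiM {..<d} (\<lambda>_. borel)) (\<lambda>(i, j) \<omega>. restrict (X i j \<omega>) {..<d}) {(i, j). i < a \<and> j < n i}"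
  shows "distr M borel (\<lambda>\<omega>. Wtilde a d n TW TS S (\<lambda>i j. X i j \<omega>)) = distr P borel (chi2_mix (beta a d n TW TS S) (a * d))"
proof -
  interpret M: prob_space M by fact
  define m where "m = a * d"
  define T where "T = kron TW TS"
  obtain u l where ul: "design_eigensystem a d n TW TS S u l"
    using design_spectral[where n = n, OF W TS S n] by blast
  have comp: "\<And>p q. p < m \<Longrightarrow> q < m \<Longrightarrow> (\<Sum>i<m. u i p * u i q) = (if p = q then 1 else 0)"
    and pos: "\<And>i. i < m \<Longrightarrow> 0 \<le> l i"
    and E: "EQ0 a n TW TS S = (\<Sum>i<m. l i)" and V: "VarQ0 a n TW TS S = 2 * (\<Sum>i<m. (l i)\<^sup>2)"
    and beta: "\<And>s. beta a d n TW TS S s = (if s < m then l s / sqrt (\<Sum>i<m. (l i)\<^sup>2) else 0)"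
    using ul unfolding design_eigensystem_def m_def[symmetric] by simp_all
  have quad: "(\<Sum>p<m. \<Sum>q<m. w p * VN a d n S $$ (p, q) * w q) = (\<Sum>i<m. l i * (g i)\<^sup>2)"
    if "\<forall>p<m. w p = (\<Sum>q<m. T $$ (p, q) * (\<Sum>i<m. g i * u i q))" for g w
  proof -
    have Q: "\<forall>g w. (\<forall>p<m. w p = (\<Sum>q<m. T $$ (p, q) * (\<Sum>i<m. g i * u i q))) \<longrightarrow>
        (\<Sum>p<m. \<Sum>q<m. w p * VN a d n S $$ (p, q) * w q) = (\<Sum>i<m. l i * (g i)\<^sup>2)"
      using ul unfolding design_eigensystem_def m_def[symmetric] T_def[symmetric]
      by (rule conjunct2[THEN conjunct1])
    show ?thesis by (rule Q[THEN spec[of _ g], THEN spec[of _ w], THEN mp, OF that])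
  qed
  have Tp: "orth_proj m T" unfolding T_def m_def by (rule orth_proj_kron[OF W(1) TS(1)])
  then have Tc: "T \<in> carrier_mat m m" and TT: "transpose_mat T = T" by (auto simp: orth_proj_def)
  have sym: "T $$ (p, q) = T $$ (q, p)" if "p < m" "q < m" for p q
    using TT Tc that by (metis carrier_matD index_transpose_mat(1))
  define x where "x = (\<lambda>\<omega> p. sqrt (totalN a n) * group_means a d n (\<lambda>i j. X i j \<omega>) $ p)"
  \<comment> \<open>The eigenbasis coordinates are those of T x, not of x: T removes the mean, and
    Parseval turns the squared norm of T x into the sum of the squares of the Y i.\<close>
  define Y where "Y = (\<lambda>i \<omega>. \<Sum>p<m. u i p * (\<Sum>q<m. T $$ (p, q) * x \<omega> q))"
  have xm [measurable]: "(\<lambda>\<omega>. x \<omega> p) \<in> borel_measurable M" if "p < m" for p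
  proof -
    have p: "p div d < a" "p mod d < d" using that unfolding m_def
      by (auto simp: less_mult_imp_div_less intro!: mod_less_divisor gr0I)
    have "(\<lambda>\<omega>. X (p div d) j \<omega> (p mod d)) \<in> borel_measurable M" if "j < n (p div d)" for j
      using normal[OF p(1) that] p(2) by (auto simp: mvnormal_def)
    then show ?thesis using that by (auto simp: x_def group_means_def m_def intro!: borel_measurable_times borel_measurable_sum)
  qed
  have Ym [measurable]: "Y i \<in> borel_measurable M" for i
    unfolding Y_def by (intro borel_measurable_sum borel_measurable_times borel_measurable_const xm) auto
  have Q: "QN a d n TW TS (\<lambda>i j. X i j \<omega>) = (\<Sum>i<m. (Y i \<omega>)\<^sup>2)" for \<omega>
  proof -
    let ?g = "group_means a d n (\<lambda>i j. X i j \<omega>)"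
    have "QN a d n TW TS (\<lambda>i j. X i j \<omega>) = real (totalN a n) * (\<Sum>p<m. ?g $ p * (\<Sum>q<m. T $$ (p, q) * ?g $ q))"
      unfolding QN_def T_def[symmetric] using Tc
      by (simp add: scalar_prod_def lessThan_atLeast0 m_def group_means_def)
    also have "\<dots> = (\<Sum>p<m. x \<omega> p * (\<Sum>q<m. T $$ (p, q) * x \<omega> q))"
    proof -
      define c where "c = sqrt (totalN a n)"
      have N: "real (totalN a n) = c * c" by (simp add: c_def)
      have x: "x \<omega> p = c * ?g $ p" for p by (simp add: x_def c_def)
      show ?thesis unfolding x N by (simp add: sum_distrib_left mult_ac)
    qed
    also have "\<dots> = (\<Sum>i<m. (Y i \<omega>)\<^sup>2)"
      unfolding orth_proj_quadratic_form[OF Tp] Y_def by (rule parseval_of_completeness[OF comp, symmetric])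
    finally show ?thesis .
  qed
  have char: "(CLINT \<omega>|M. iexp (\<Sum>i<m. g i * Y i \<omega>)) = exp (- (\<Sum>i<m. l i * (g i)\<^sup>2) / 2)" for g
  proof -
    define h where "h = (\<lambda>p. \<Sum>i<m. g i * u i p)"
    define w where "w = (\<lambda>p. \<Sum>q<m. T $$ (p, q) * h q)"
    \<comment> \<open>Symmetry moves T from the data to the coefficient vector, so a combination of
      the Y i becomes the functional w = T h of the group means.\<close>
    have swap: "(\<Sum>p<m. h p * (\<Sum>q<m. T $$ (p, q) * z q)) = (\<Sum>p<m. w p * z p)" for z
      unfolding sum_mult_sum_swap w_def by (intro sum.cong refl arg_cong2[of _ _ _ _ times]) (simp add: sym)
    have "(\<Sum>i<m. g i * Y i \<omega>) = (\<Sum>p<m. w p * x \<omega> p)" for \<omega>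
    proof -
      have "(\<Sum>i<m. g i * Y i \<omega>) = (\<Sum>p<m. h p * (\<Sum>q<m. T $$ (p, q) * x \<omega> q))"
        unfolding Y_def by (subst sum_mult_sum_swap) (simp add: h_def mult.commute)
      then show ?thesis by (simp only: swap)
    qed
    then have "(CLINT \<omega>|M. iexp (\<Sum>i<m. g i * Y i \<omega>)) = (CLINT \<omega>|M. iexp (\<Sum>p<a * d. w p * (sqrt (totalN a n) * group_means a d n (\<lambda>i j. X i j \<omega>) $ p)))"
      by (simp only: x_def m_def)
    also have "\<dots> = iexp (sqrt (totalN a n) * (\<Sum>p<m. w p * stack a d mu $ p))
      * exp (- (\<Sum>p<m. \<Sum>q<m. w p * VN a d n S $$ (p, q) * w q) / 2)"
      unfolding m_def by (rule M.group_means_iexp_integral[where n = n and mu = mu and X = X, OF n S mu normal indep])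
    also have "(\<Sum>p<m. \<Sum>q<m. w p * VN a d n S $$ (p, q) * w q) = (\<Sum>i<m. l i * (g i)\<^sup>2)"
      by (rule quad) (simp add: w_def h_def)
    \<comment> \<open>Here the null hypothesis enters: moving T back onto the stacked mean gives
      zero, and the oscillating factor becomes 1.\<close>
    also have "(\<Sum>p<m. w p * stack a d mu $ p) = 0"
    proof -
      have "(\<Sum>q<m. T $$ (p, q) * stack a d mu $ q) = 0" if "p < m" for p
        using arg_cong[OF H0, of "\<lambda>v. v $ p"] that Tc
        by (simp add: T_def[symmetric] m_def[symmetric] scalar_prod_def lessThan_atLeast0 stack_def)
      then show ?thesis unfolding swap[symmetric] by simp
    qed
    finally show ?thesis by simp
  qed
  have law: "distr M borel (\<lambda>\<omega>. \<Sum>i<m. (Y i \<omega>)\<^sup>2) = distr P borel (\<lambda>x. \<Sum>i<m. l i * C i x)"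
    by (rule M.distr_sum_squares_eq[OF Ym char pos prob_space_axioms C_indep C_chi2])
  define f where "f = (\<lambda>q. (q - (\<Sum>i<m. l i)) / sqrt (2 * (\<Sum>i<m. (l i)\<^sup>2)))"
  have fm [measurable]: "f \<in> borel_measurable borel" unfolding f_def by measurable
  have "distr M borel (\<lambda>\<omega>. Wtilde a d n TW TS S (\<lambda>i j. X i j \<omega>)) = distr M borel (f \<circ> (\<lambda>\<omega>. \<Sum>i<m. (Y i \<omega>)\<^sup>2))"
    by (simp add: Wtilde_def Q E V f_def o_def)
  also have "\<dots> = distr (distr M borel (\<lambda>\<omega>. \<Sum>i<m. (Y i \<omega>)\<^sup>2)) borel f"
    by (subst distr_distr) auto
  also have "\<dots> = distr P borel (f \<circ> (\<lambda>x. \<Sum>i<m. l i * C i x))"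
    unfolding law by (subst distr_distr) auto
  also have "f \<circ> (\<lambda>x. \<Sum>i<m. l i * C i x) = chi2_mix (beta a d n TW TS S) m"
  proof
    fix z
    define r where "r = sqrt (\<Sum>i<m. (l i)\<^sup>2)"
    \<comment> \<open>With square sum 1 the coefficient of Z in \<open>chi2_mix\<close> is sqrt 0,
      so only the chi-square part remains to be matched.\<close>
    have one: "(\<Sum>s<m. (beta a d n TW TS S s)\<^sup>2) = 1"
      unfolding m_def by (rule beta_properties(4)[where n = n, OF W TS S n])
    have "(\<Sum>s<m. beta a d n TW TS S s * (C s z - 1) / sqrt 2) = (\<Sum>s<m. l s * (C s z - 1)) / (r * sqrt 2)"
      by (simp add: beta r_def sum_divide_distrib)
    also have "\<dots> = f (\<Sum>i<m. l i * C i z)"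
      by (simp add: f_def r_def real_sqrt_mult right_diff_distrib sum_subtractf mult.commute)
    finally show "(f \<circ> (\<lambda>x. \<Sum>i<m. l i * C i x)) z = chi2_mix (beta a d n TW TS S) m z"
      by (simp add: chi2_mix_def one)
  qed
  finally show ?thesis by (simp add: m_def)
qed

end

text \<open>The support of a nonincreasing nonnegative sequence is an initial segment, so its
  cardinality is the first index at which the sequence vanishes.\<close>

lemma antimono_finite_support:
  fixes b :: "nat \<Rightarrow> real"
  assumes "antimono b" "\<And>s. 0 \<le> b s" and fin: "finite {s. b s \<noteq> 0}" and s: "s \<ge> card {s. b s \<noteq> 0}"
  shows "b s = 0"
proof (rule ccontr)
  assume nz: "b s \<noteq> 0"
  have "{..s} \<subseteq> {s. b s \<noteq> 0}"
  proof
    fix j assume "j \<in> {..s}"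
    then have "b s \<le> b j" using assms by (auto dest: antimonoD)
    then show "j \<in> {s. b s \<noteq> 0}" using nz assms(2)[of s] by auto
  qed
  then have "card {..s} \<le> card {s. b s \<noteq> 0}" by (rule card_mono[OF fin])
  then show False using s by simp
qed

theorem theorem1:
  fixes a d :: "nat \<Rightarrow> nat"
    and n :: "nat \<Rightarrow> nat \<Rightarrow> nat"
    and Sigma TW TS :: "nat \<Rightarrow> real mat"
    and mu :: "nat \<Rightarrow> nat \<Rightarrow> real vec"
    and M :: "nat \<Rightarrow> 'w measure"
    and X :: "nat \<Rightarrow> nat \<Rightarrow> nat \<Rightarrow> 'w \<Rightarrow> nat \<Rightarrow> real"
    and P :: "'p measure"
    and C :: "nat \<Rightarrow> 'p \<Rightarrow> real"
    and Z :: "'p \<Rightarrow> real"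
  assumes groups: "\<And>k i. i < a k \<Longrightarrow> n k i \<ge> 1"
    and Sigma: "\<And>k. pos_def (d k) (Sigma k)"
    and mu_dim: "\<And>k i. i < a k \<Longrightarrow> dim_vec (mu k i) = d k"
    and TW: "\<And>k. orth_proj (a k) (TW k) \<and> TW k \<noteq> 0\<^sub>m (a k) (a k)"
    and TS: "\<And>k. orth_proj (d k) (TS k) \<and> TS k \<noteq> 0\<^sub>m (d k) (d k)"
    and H0: "\<And>k. kron (TW k) (TS k) *\<^sub>v stack (a k) (d k) (mu k) = 0\<^sub>v (a k * d k)"
    and prob: "\<And>k. prob_space (M k)"
    and normal: "\<And>k i j. i < a k \<Longrightarrow> j < n k i \<Longrightarrow>
                   mvnormal (M k) (X k i j) (d k) (mu k i) (Sigma k)"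
    and indep: "\<And>k. prob_space.indep_vars (M k) (\<lambda>_. PiM {..<d k} (\<lambda>_. borel))
                   (\<lambda>(i, j) \<omega>. restrict (X k i j \<omega>) {..<d k}) {(i, j). i < a k \<and> j < n k i}"
    and framework: "frameworks a d (\<lambda>k. nmax (a k) (n k))"
    and P_prob: "prob_space P"
    and C_chi2: "\<And>s. distr P borel (C s) = chi2_1"
    and Z_norm: "distributed P lborel Z std_normal_density"
    and CZ_indep: "prob_space.indep_vars P (\<lambda>_. borel)
                     (\<lambda>t. case t of None \<Rightarrow> Z | Some s \<Rightarrow> C s) UNIV"
  defines "W \<equiv> \<lambda>k \<omega>. Wtilde (a k) (d k) (n k) (TW k) (TS k) (Sigma k) (\<lambda>i j. X k i j \<omega>)"
    and "\<beta> \<equiv> \<lambda>k. beta (a k) (d k) (n k) (TW k) (TS k) (Sigma k)"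
  shows
    "(\<forall>b :: nat \<Rightarrow> real.
        antimono b \<and> (\<forall>s. 0 \<le> b s \<and> b s \<le> 1) \<and> finite {s. b s \<noteq> 0} \<and>
        (\<Sum>s<card {s. b s \<noteq> 0}. (b s)\<^sup>2) \<le> 1 \<longrightarrow>
        (weak_conv_m (\<lambda>k. distr (M k) borel (W k))
           (distr P borel (\<lambda>\<omega>. (\<Sum>s<card {s. b s \<noteq> 0}. b s * (C s \<omega> - 1) / sqrt 2)
               + sqrt (1 - (\<Sum>s<card {s. b s \<noteq> 0}. (b s)\<^sup>2)) * Z \<omega>))
         \<longleftrightarrow> (\<forall>s. (\<lambda>k. \<beta> k s) \<longlonglongrightarrow> b s)))
     \<and>
     (\<forall>b :: nat \<Rightarrow> real.
        antimono b \<and> (\<forall>s. 0 < b s \<and> b s < 1) \<and> (\<lambda>s. (b s)\<^sup>2) sums 1 \<and>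
        (\<forall>s. (\<lambda>k. \<beta> k s) \<longlonglongrightarrow> b s) \<longrightarrow>
        weak_conv_m (\<lambda>k. distr (M k) borel (W k))
           (distr P borel (\<lambda>\<omega>. \<Sum>s. b s * (C s \<omega> - 1) / sqrt 2)))"
proof -
  interpret chi2_normal_sequence P C Z
    using P_prob C_chi2 Z_norm CZ_indep
    by (simp add: chi2_normal_sequence_def chi2_normal_sequence_axioms_def)
  note TW' = conjunct1[OF TW] conjunct2[OF TW] and TS' = conjunct1[OF TS] conjunct2[OF TS]
  \<comment> \<open>After rewriting with this, the spaces \<open>M k\<close> disappear and both
    parts concern the laws of \<open>chi2_mix\<close> on P.\<close>
  have law: "distr (M k) borel (W k) = distr P borel (chi2_mix (\<beta> k) (a k * d k))" for k
    unfolding W_def \<beta>_def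
    by (rule distr_Wtilde[where n = "n k" and mu = "mu k" and X = "X k",
          OF TW' TS' Sigma groups mu_dim H0 prob normal indep])
  have \<beta>: "antimono (\<beta> k)" "0 \<le> \<beta> k s" "s \<ge> a k * d k \<Longrightarrow> \<beta> k s = 0" "(\<Sum>s<a k * d k. (\<beta> k s)\<^sup>2) = 1" for k s
    unfolding \<beta>_def using beta_properties[where n = "n k", OF TW' TS' Sigma groups] by auto
  have part_a: "weak_conv_m (\<lambda>k. distr (M k) borel (W k))
        (distr P borel (\<lambda>\<omega>. (\<Sum>s<r. b s * (C s \<omega> - 1) / sqrt 2) + sqrt (1 - (\<Sum>s<r. (b s)\<^sup>2)) * Z \<omega>))
      \<longleftrightarrow> (\<forall>s. (\<lambda>k. \<beta> k s) \<longlonglongrightarrow> b s)"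
    if "antimono b" "\<forall>s. 0 \<le> b s \<and> b s \<le> 1" "finite {s. b s \<noteq> 0}" "(\<Sum>s<r. (b s)\<^sup>2) \<le> 1" "r = card {s. b s \<noteq> 0}"
    for b :: "nat \<Rightarrow> real" and r
  proof -
    have b0: "\<And>s. 0 \<le> b s" using that(2) by blast
    have br: "\<And>s. s \<ge> r \<Longrightarrow> b s = 0" unfolding that(5) by (rule antimono_finite_support[OF that(1) b0 that(3)])
    show ?thesis
      unfolding law chi2_mix_def[of b r, abs_def, symmetric]
    proof (intro iffI allI)
      show "(\<lambda>k. \<beta> k s) \<longlonglongrightarrow> b s"
        if "weak_conv_m (\<lambda>k. distr P borel (chi2_mix (\<beta> k) (a k * d k))) (distr P borel (chi2_mix b r))" for s
        by (rule weak_conv_chi2_mix_imp_tendsto[where \<beta> = \<beta> and m = "\<lambda>k. a k * d k",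
              OF \<beta> \<open>antimono b\<close> b0 br \<open>(\<Sum>s<r. (b s)\<^sup>2) \<le> 1\<close> that])
      show "weak_conv_m (\<lambda>k. distr P borel (chi2_mix (\<beta> k) (a k * d k))) (distr P borel (chi2_mix b r))"
        if "\<forall>s. (\<lambda>k. \<beta> k s) \<longlonglongrightarrow> b s"
        by (rule weak_conv_chi2_mix[where \<beta> = \<beta> and m = "\<lambda>k. a k * d k",
              OF \<beta> br \<open>(\<Sum>s<r. (b s)\<^sup>2) \<le> 1\<close> that[rule_format]])
    qed
  qed
  have part_b: "weak_conv_m (\<lambda>k. distr (M k) borel (W k)) (distr P borel (\<lambda>\<omega>. \<Sum>s. b s * (C s \<omega> - 1) / sqrt 2))"
    if "(\<lambda>s. (b s)\<^sup>2) sums 1" "\<forall>s. (\<lambda>k. \<beta> k s) \<longlonglongrightarrow> b s" for b :: "nat \<Rightarrow> real"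
    unfolding law
    by (rule weak_conv_chi2_series[where \<beta> = \<beta> and m = "\<lambda>k. a k * d k", OF \<beta>(3,4) that(1) that(2)[rule_format]])
  show ?thesis using part_a part_b by blast
qed

end
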